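(* Let $d\ge 1$ be an integer, $s>0$ and $T>0$. Let $a,b,u_0,u_1$ be (possibly irregular) functions or distributions on $\mathbb{R}^d$. Assume that there exist an $L^{\infty}(\mathbb{R}^d)$-moderate approximation $(a_\varepsilon)_{\varepsilon\in(0,1]}$ of $a$ with $a_\varepsilon\ge 0$, an $L^{\infty}(\mathbb{R}^d)$-moderate approximation $(b_\varepsilon)_{\varepsilon\in(0,1]}$ of $b$ with $b_\varepsilon\ge 0$, an $H^s(\mathbb{R}^d)$-moderate approximation $(u_{0,\varepsilon})_{\varepsilon\in(0,1]}$ of $u_0$, and an $L^2(\mathbb{R}^d)$-moderate approximation $(u_{1,\varepsilon})_{\varepsilon\in(0,1]}$ of $u_1$. Then the Cauchy problem $$u_{tt}(t,x)+(-\Delta)^s u(t,x)+a(x)u(t,x)+b(x)u_t(t,x)=0,\ (t,x)\in[0,T]\times\mathbb{R}^d,\qquad u(0,x)=u_0(x),\ u_t(0,x)=u_1(x),\ x\in\mathbb{R}^d,$$ has a very weak solution.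
   Context: The fractional Laplacian is $(-\Delta)^s f=\mathcal{F}^{-1}(|\xi|^{2s}\widehat f)$, and $H^s(\mathbb{R}^d)=\{f\in L^2(\mathbb{R}^d): (-\Delta)^{s/2}f\in L^2(\mathbb{R}^d)\}$ with norm $\|f\|_{H^s}=\|f\|_{L^2}+\|(-\Delta)^{s/2}f\|_{L^2}$. An approximation of a function or distribution $f$ on $\mathbb{R}^d$ is a net $(f_\varepsilon)_{\varepsilon\in(0,1]}$ of smooth functions approximating $f$, not necessarily obtained by convolution with a mollifier (no particular mode of convergence is prescribed). For a normed space $X$ of functions on $\mathbb{R}^d$, a net $(f_\varepsilon)_{\varepsilon\in(0,1]}$ of elements of $X$ is $X$-moderate if there exist $N\in\mathbb{N}_0$ and $C>0$ with $\|f_\varepsilon\|_X\le C\varepsilon^{-N}$ for all $\varepsilon\in(0,1]$. Set $\|u(t,\cdot)\|_1:=\|u(t,\cdot)\|_{L^2}+\|(-\Delta)^{s/2}u(t,\cdot)\|_{L^2}+\|u_t(t,\cdot)\|_{L^2}$. A net $(u_\varepsilon)_{\varepsilon\in(0,1]}$ in $C([0,T];H^s(\mathbb{R}^d))\cap C^1([0,T];L^2(\mathbb{R}^d))$ is $C_1$-moderate if there exist $N\in\mathbb{N}_0$ and $C>0$ with $\sup_{t\in[0,T]}\|u_\varepsilon(t,\cdot)\|_1\le C\varepsilon^{-N}$ for all $\varepsilon\in(0,1]$. A net $(u_\varepsilon)_{\varepsilon\in(0,1]}$ in $C([0,T];H^s(\mathbb{R}^d))\cap C^1([0,T];L^2(\mathbb{R}^d))$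 is a very weak solution to the Cauchy problem if there exist $L^\infty(\mathbb{R}^d)$-moderate approximations $(a_\varepsilon)_\varepsilon$, $(b_\varepsilon)_\varepsilon$ of $a$, $b$ with $a_\varepsilon\ge0$, $b_\varepsilon\ge0$, an $H^s(\mathbb{R}^d)$-moderate approximation $(u_{0,\varepsilon})_\varepsilon$ of $u_0$ and an $L^2(\mathbb{R}^d)$-moderate approximation $(u_{1,\varepsilon})_\varepsilon$ of $u_1$ such that, for every $\varepsilon\in(0,1]$, $u_\varepsilon$ solves $$\partial_t^2u_\varepsilon+(-\Delta)^su_\varepsilon+a_\varepsilon(x)u_\varepsilon+b_\varepsilon(x)\partial_tu_\varepsilon=0\ \text{on }[0,T]\times\mathbb{R}^d,\quad u_\varepsilon(0,\cdot)=u_{0,\varepsilon},\ \partial_tu_\varepsilon(0,\cdot)=u_{1,\varepsilon},$$ and the net $(u_\varepsilon)_\varepsilon$ is $C_1$-moderate. The equation for $u_\varepsilon$ is understood in the sense of distributions on $(0,T)\times\mathbb{R}^d$. *)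

theory Defs
  imports "HOL-Analysis.Analysis" "HOL-Probability.Essential_Supremum" "HOL-Library.Nonpos_Ints"
begin

section \<open>Smooth functions, test functions, Schwartz functions\<close>

definition partial :: "'a \<Rightarrow> ('a::euclidean_space \<Rightarrow> complex) \<Rightarrow> 'a \<Rightarrow> complex" where
  "partial v f x = frechet_derivative f (at x) v"

text \<open>For a list \<open>vs\<close> of basis vectors, \<open>partials vs f\<close> is the iterated partial derivative
  of \<open>f\<close> of order \<open>length vs\<close>.\<close>

definition partials :: "'a list \<Rightarrow> ('a::euclidean_space \<Rightarrow> complex) \<Rightarrow> 'a \<Rightarrow> complex" where
  "partials vs f = foldr partial vs f"

definition smooth :: "('a::euclidean_space \<Rightarrow> complex) \<Rightarrow> bool" where
  "smooth f \<longleftrightarrow> (\<forall>vs\<in>lists Basis. partials vs f differentiable_on UNIV)"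

definition fun_support :: "('a::euclidean_space \<Rightarrow> complex) \<Rightarrow> 'a set" where
  "fun_support f = closure {x. f x \<noteq> 0}"

definition test_functions :: "'a set \<Rightarrow> ('a::euclidean_space \<Rightarrow> complex) set" where
  "test_functions \<Omega> = {\<phi>. smooth \<phi> \<and> compact (fun_support \<phi>) \<and> fun_support \<phi> \<subseteq> \<Omega>}"

definition schwartz :: "('a::euclidean_space \<Rightarrow> complex) set" where
  "schwartz = {\<phi>. smooth \<phi> \<and>
     (\<forall>vs\<in>lists Basis. \<forall>k::nat. \<exists>C. \<forall>x. norm x ^ k * norm (partials vs \<phi> x) \<le> C)}"


section \<open>Distributions\<close>

text \<open>Distributions and tempered distributions are represented by functionals on all functions;
  only their values on test functions, respectively on Schwartz functions, are relevant.\<close>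

type_synonym 'a functional = "('a \<Rightarrow> complex) \<Rightarrow> complex"

definition is_distribution :: "('a::euclidean_space) functional \<Rightarrow> bool" where
  "is_distribution \<Lambda> \<longleftrightarrow>
     (\<forall>\<phi>\<in>test_functions UNIV. \<forall>\<psi>\<in>test_functions UNIV. \<Lambda> (\<lambda>x. \<phi> x + \<psi> x) = \<Lambda> \<phi> + \<Lambda> \<psi>) \<and>
     (\<forall>\<phi>\<in>test_functions UNIV. \<forall>c. \<Lambda> (\<lambda>x. c * \<phi> x) = c * \<Lambda> \<phi>) \<and>
     (\<forall>K. compact K \<longrightarrow> (\<exists>C. \<exists>m::nat. \<forall>\<phi>\<in>test_functions K.
        norm (\<Lambda> \<phi>) \<le> C * (\<Sum>vs\<in>{vs\<in>lists Basis. length vs \<le> m}. SUP x. norm (partials vs \<phi> x))))"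

definition regular :: "('a::euclidean_space \<Rightarrow> complex) \<Rightarrow> 'a functional" where
  "regular f \<phi> = (LINT x|lborel. f x * \<phi> x)"

text \<open>A possibly irregular function or distribution on the whole space. No integrability is
  imposed on a function.\<close>

datatype 'a datum = Function "'a \<Rightarrow> complex" | Distribution "'a functional"

fun valid_datum :: "('a::euclidean_space) datum \<Rightarrow> bool" where
  "valid_datum (Function f) \<longleftrightarrow> True"
| "valid_datum (Distribution \<Lambda>) \<longleftrightarrow> is_distribution \<Lambda>"


section \<open>Lebesgue spaces\<close>

text \<open>Elements of Lebesgue and Sobolev spaces are represented by functions; equality in these
  spaces is equality almost everywhere.\<close>

definition L2_space :: "('a::euclidean_space \<Rightarrow> complex) set" where
  "L2_space = {f \<in> borel_measurable lborel. integrable lborel (\<lambda>x. (norm (f x))\<^sup>2)}"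

definition L2_norm :: "('a::euclidean_space \<Rightarrow> complex) \<Rightarrow> real" where
  "L2_norm f = sqrt (LINT x|lborel. (norm (f x))\<^sup>2)"

definition Linf_space :: "('a::euclidean_space \<Rightarrow> complex) set" where
  "Linf_space = {f \<in> borel_measurable lborel. esssup lborel (\<lambda>x. ereal (norm (f x))) < \<infinity>}"

definition Linf_norm :: "('a::euclidean_space \<Rightarrow> complex) \<Rightarrow> real" where
  "Linf_norm f = real_of_ereal (esssup lborel (\<lambda>x. ereal (norm (f x))))"


section \<open>Fourier transform and fractional Laplacian\<close>

definition fourier :: "('a::euclidean_space \<Rightarrow> complex) \<Rightarrow> 'a \<Rightarrow> complex" where
  "fourier \<phi> \<xi> = (LINT x|lborel. cis (- (x \<bullet> \<xi>)) * \<phi> x)"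

definition inv_fourier :: "('a::euclidean_space \<Rightarrow> complex) \<Rightarrow> 'a \<Rightarrow> complex" where
  "inv_fourier \<phi> x = (LINT \<xi>|lborel. cis (x \<bullet> \<xi>) * \<phi> \<xi>) / complex_of_real ((2 * pi) ^ DIM('a))"

definition fourier_distr :: "('a::euclidean_space) functional \<Rightarrow> 'a functional" where
  "fourier_distr \<Lambda> \<phi> = \<Lambda> (fourier \<phi>)"

definition inv_fourier_distr :: "('a::euclidean_space) functional \<Rightarrow> 'a functional" where
  "inv_fourier_distr \<Lambda> \<phi> = \<Lambda> (inv_fourier \<phi>)"

text \<open>\<open>is_L2 \<Lambda>\<close>: the tempered distribution \<open>\<Lambda>\<close> belongs to L2, that is, it is given by
  integration against an L2 function; \<open>L2_density \<Lambda>\<close> is that function, which is unique up to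
  equality almost everywhere.\<close>

definition represents :: "('a::euclidean_space \<Rightarrow> complex) \<Rightarrow> 'a functional \<Rightarrow> bool" where
  "represents g \<Lambda> \<longleftrightarrow> g \<in> L2_space \<and> (\<forall>\<phi>\<in>schwartz. \<Lambda> \<phi> = regular g \<phi>)"

definition is_L2 :: "('a::euclidean_space) functional \<Rightarrow> bool" where
  "is_L2 \<Lambda> \<longleftrightarrow> (\<exists>g. represents g \<Lambda>)"

definition L2_density :: "('a::euclidean_space) functional \<Rightarrow> 'a \<Rightarrow> complex" where
  "L2_density \<Lambda> = (SOME g. represents g \<Lambda>)"

text \<open>By Plancherel's theorem the distributional Fourier transform of an L2 function is an L2
  function.\<close>

definition fourier_L2 :: "('a::euclidean_space \<Rightarrow> complex) \<Rightarrow> 'a \<Rightarrow> complex" where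
  "fourier_L2 f = L2_density (fourier_distr (regular f))"

text \<open>\<open>frac_laplacian \<sigma> f\<close> is the tempered distribution obtained by applying the
  \<open>\<sigma>\<close>-th power of the negative Laplacian to the L2 function \<open>f\<close>.\<close>

definition frac_laplacian :: "real \<Rightarrow> ('a::euclidean_space \<Rightarrow> complex) \<Rightarrow> 'a functional" where
  "frac_laplacian \<sigma> f =
     inv_fourier_distr (regular (\<lambda>\<xi>. complex_of_real (norm \<xi> powr (2 * \<sigma>)) * fourier_L2 f \<xi>))"

definition H_space :: "real \<Rightarrow> ('a::euclidean_space \<Rightarrow> complex) set" where
  "H_space s = {f \<in> L2_space. is_L2 (frac_laplacian (s / 2) f)}"

definition frac_seminorm :: "real \<Rightarrow> ('a::euclidean_space \<Rightarrow> complex) \<Rightarrow> real" where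
  "frac_seminorm s f = L2_norm (L2_density (frac_laplacian (s / 2) f))"

definition H_norm :: "real \<Rightarrow> ('a::euclidean_space \<Rightarrow> complex) \<Rightarrow> real" where
  "H_norm s f = L2_norm f + frac_seminorm s f"


section \<open>Functions of time with values in a function space\<close>

text \<open>\<open>u t\<close> is the function \<open>x \<mapsto> u(t,x)\<close>. Since it is only determined almost everywhere
  for each \<open>t\<close>, no joint measurability in \<open>(t,x)\<close> is asked for.\<close>

definition cont_in_time ::
  "('a \<Rightarrow> complex) set \<Rightarrow> (('a \<Rightarrow> complex) \<Rightarrow> real) \<Rightarrow> real \<Rightarrow> (real \<Rightarrow> 'a \<Rightarrow> complex) \<Rightarrow> bool" where
  "cont_in_time X nrm T u \<longleftrightarrow> (\<forall>t\<in>{0..T}. u t \<in> X) \<and>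
     (\<forall>t\<in>{0..T}. ((\<lambda>\<tau>. nrm (\<lambda>x. u \<tau> x - u t x)) \<longlongrightarrow> 0) (at t within {0..T}))"

definition has_L2_time_deriv ::
  "real \<Rightarrow> (real \<Rightarrow> 'a::euclidean_space \<Rightarrow> complex) \<Rightarrow> real \<Rightarrow> ('a \<Rightarrow> complex) \<Rightarrow> bool" where
  "has_L2_time_deriv T u t v \<longleftrightarrow> v \<in> L2_space \<and>
     ((\<lambda>\<tau>. L2_norm (\<lambda>x. (u \<tau> x - u t x) / complex_of_real (\<tau> - t) - v x)) \<longlongrightarrow> 0)
       (at t within {0..T})"

definition L2_time_deriv ::
  "real \<Rightarrow> (real \<Rightarrow> 'a::euclidean_space \<Rightarrow> complex) \<Rightarrow> real \<Rightarrow> 'a \<Rightarrow> complex" where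
  "L2_time_deriv T u t = (SOME v. has_L2_time_deriv T u t v)"

definition C1_L2 :: "real \<Rightarrow> (real \<Rightarrow> 'a::euclidean_space \<Rightarrow> complex) set" where
  "C1_L2 T = {u. (\<forall>t\<in>{0..T}. u t \<in> L2_space \<and> (\<exists>v. has_L2_time_deriv T u t v)) \<and>
                 cont_in_time L2_space L2_norm T (L2_time_deriv T u)}"

definition energy_space :: "real \<Rightarrow> real \<Rightarrow> (real \<Rightarrow> 'a::euclidean_space \<Rightarrow> complex) set" where
  "energy_space s T = {u. cont_in_time (H_space s) (H_norm s) T u} \<inter> C1_L2 T"

definition norm1 :: "real \<Rightarrow> real \<Rightarrow> (real \<Rightarrow> 'a::euclidean_space \<Rightarrow> complex) \<Rightarrow> real \<Rightarrow> real" where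
  "norm1 s T u t = L2_norm (u t) + frac_seminorm s (u t) + L2_norm (L2_time_deriv T u t)"


section \<open>The equation in the sense of distributions on \<open>(0,T)\<close> times the space\<close>

text \<open>An L2-valued continuous function \<open>u\<close> of time, and the family of tempered distributions
  obtained from it by the fractional Laplacian, as distributions in \<open>(t,x)\<close>.\<close>

definition regular_spacetime ::
  "real \<Rightarrow> (real \<Rightarrow> 'a::euclidean_space \<Rightarrow> complex) \<Rightarrow> (real \<times> 'a) functional" where
  "regular_spacetime T u \<phi> = (LINT t:{0<..<T}|lborel. regular (u t) (\<lambda>x. \<phi> (t, x)))"

definition frac_laplacian_spacetime ::
  "real \<Rightarrow> real \<Rightarrow> (real \<Rightarrow> 'a::euclidean_space \<Rightarrow> complex) \<Rightarrow> (real \<times> 'a) functional" where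
  "frac_laplacian_spacetime s T u \<phi> =
     (LINT t:{0<..<T}|lborel. frac_laplacian s (u t) (\<lambda>x. \<phi> (t, x)))"

definition dt :: "(real \<times> 'a::euclidean_space) functional \<Rightarrow> (real \<times> 'a) functional" where
  "dt U \<phi> = - U (partial (1, 0) \<phi>)"

definition mult_coeff ::
  "('a::euclidean_space \<Rightarrow> complex) \<Rightarrow> (real \<times> 'a) functional \<Rightarrow> (real \<times> 'a) functional" where
  "mult_coeff a U \<phi> = U (\<lambda>(t, x). a x * \<phi> (t, x))"

definition solves_equation ::
  "real \<Rightarrow> real \<Rightarrow> ('a::euclidean_space \<Rightarrow> complex) \<Rightarrow> ('a \<Rightarrow> complex) \<Rightarrow> (real \<Rightarrow> 'a \<Rightarrow> complex) \<Rightarrow> bool"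
where
  "solves_equation s T a b u \<longleftrightarrow> (let U = regular_spacetime T u in
     \<forall>\<phi>\<in>test_functions ({0<..<T} \<times> UNIV).
       dt (dt U) \<phi> + frac_laplacian_spacetime s T u \<phi> + mult_coeff a U \<phi> + mult_coeff b (dt U) \<phi> = 0)"

definition solves_cauchy ::
  "real \<Rightarrow> real \<Rightarrow> ('a::euclidean_space \<Rightarrow> complex) \<Rightarrow> ('a \<Rightarrow> complex) \<Rightarrow>
   ('a \<Rightarrow> complex) \<Rightarrow> ('a \<Rightarrow> complex) \<Rightarrow> (real \<Rightarrow> 'a \<Rightarrow> complex) \<Rightarrow> bool" where
  "solves_cauchy s T a b u0 u1 u \<longleftrightarrow> solves_equation s T a b u \<and>
     (AE x in lborel. u 0 x = u0 x) \<and> (AE x in lborel. L2_time_deriv T u 0 x = u1 x)"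


section \<open>Nets, moderateness, very weak solutions\<close>

text \<open>Nets are indexed by \<open>\<epsilon> \<in> {0<..1}\<close>; values at other indices are irrelevant.\<close>

type_synonym 'a net = "real \<Rightarrow> 'a \<Rightarrow> complex"

text \<open>A mode of convergence says which nets approximate which function or distribution. None is
  prescribed for approximations, so it is kept as an arbitrary parameter.\<close>

type_synonym 'a conv_mode = "'a net \<Rightarrow> 'a datum \<Rightarrow> bool"

definition approximation ::
  "('a::euclidean_space) conv_mode \<Rightarrow> 'a datum \<Rightarrow> 'a net \<Rightarrow> bool" where
  "approximation conv f fe \<longleftrightarrow> (\<forall>\<epsilon>\<in>{0<..1}. smooth (fe \<epsilon>)) \<and> conv fe f"

definition moderate ::
  "('a \<Rightarrow> complex) set \<Rightarrow> (('a \<Rightarrow> complex) \<Rightarrow> real) \<Rightarrow> 'a net \<Rightarrow> bool" where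
  "moderate X nrm fe \<longleftrightarrow> (\<forall>\<epsilon>\<in>{0<..1}. fe \<epsilon> \<in> X) \<and>
     (\<exists>N::nat. \<exists>C>0. \<forall>\<epsilon>\<in>{0<..1}. nrm (fe \<epsilon>) \<le> C * \<epsilon> powi (- int N))"

definition C1_moderate ::
  "real \<Rightarrow> real \<Rightarrow> (real \<Rightarrow> real \<Rightarrow> 'a::euclidean_space \<Rightarrow> complex) \<Rightarrow> bool" where
  "C1_moderate s T ue \<longleftrightarrow> (\<forall>\<epsilon>\<in>{0<..1}. ue \<epsilon> \<in> energy_space s T) \<and>
     (\<exists>N::nat. \<exists>C>0. \<forall>\<epsilon>\<in>{0<..1}. \<forall>t\<in>{0..T}. norm1 s T (ue \<epsilon>) t \<le> C * \<epsilon> powi (- int N))"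

definition Linf_moderate_approx ::
  "('a::euclidean_space) conv_mode \<Rightarrow> 'a datum \<Rightarrow> 'a net \<Rightarrow> bool" where
  "Linf_moderate_approx conv f fe \<longleftrightarrow> approximation conv f fe \<and> moderate Linf_space Linf_norm fe"

definition L2_moderate_approx ::
  "('a::euclidean_space) conv_mode \<Rightarrow> 'a datum \<Rightarrow> 'a net \<Rightarrow> bool" where
  "L2_moderate_approx conv f fe \<longleftrightarrow> approximation conv f fe \<and> moderate L2_space L2_norm fe"

definition H_moderate_approx ::
  "real \<Rightarrow> ('a::euclidean_space) conv_mode \<Rightarrow> 'a datum \<Rightarrow> 'a net \<Rightarrow> bool" where
  "H_moderate_approx s conv f fe \<longleftrightarrow> approximation conv f fe \<and> moderate (H_space s) (H_norm s) fe"

text \<open>Membership in \<open>\<real>\<^sub>\<ge>\<^sub>0\<close> includes being real.\<close>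

definition nonneg_net :: "'a net \<Rightarrow> bool" where
  "nonneg_net fe \<longleftrightarrow> (\<forall>\<epsilon>\<in>{0<..1}. \<forall>x. fe \<epsilon> x \<in> \<real>\<^sub>\<ge>\<^sub>0)"

definition very_weak_solution ::
  "('a::euclidean_space) conv_mode \<Rightarrow> 'a conv_mode \<Rightarrow> 'a conv_mode \<Rightarrow> 'a conv_mode \<Rightarrow>
   real \<Rightarrow> real \<Rightarrow> 'a datum \<Rightarrow> 'a datum \<Rightarrow> 'a datum \<Rightarrow> 'a datum \<Rightarrow>
   (real \<Rightarrow> real \<Rightarrow> 'a \<Rightarrow> complex) \<Rightarrow> bool" where
  "very_weak_solution conva convb conv0 conv1 s T a b u0 u1 ue \<longleftrightarrow>
     (\<forall>\<epsilon>\<in>{0<..1}. ue \<epsilon> \<in> energy_space s T) \<and>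
     (\<exists>ae be u0e u1e.
        Linf_moderate_approx conva a ae \<and> nonneg_net ae \<and>
        Linf_moderate_approx convb b be \<and> nonneg_net be \<and>
        H_moderate_approx s conv0 u0 u0e \<and>
        L2_moderate_approx conv1 u1 u1e \<and>
        (\<forall>\<epsilon>\<in>{0<..1}. solves_cauchy s T (ae \<epsilon>) (be \<epsilon>) (u0e \<epsilon>) (u1e \<epsilon>) (ue \<epsilon>))) \<and>
     C1_moderate s T ue"

end

theory Submission
  imports Defs "HOL-Probability.Characteristic_Functions" "HOL-Probability.Sinc_Integral"
begin

text \<open>For fixed \<open>\<epsilon>\<close> the coefficients are bounded and nonnegative and the data have finite energy, so
  each regularised Cauchy problem should have a solution of finite energy. Existence alone is not
  enough: the norms of the solutions may grow only polynomially in \<open>1/\<epsilon>\<close>. A Gronwall estimate would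
  lose a factor exponential in \<open>\<parallel>a\<^sub>\<epsilon>\<parallel>\<^sub>\<infinity>\<close> and be useless here. The signs of the coefficients give
  more: the energy
  \<open>\<parallel>u\<^sub>t\<parallel>\<^sup>2 + \<parallel>(-\<Delta>)\<^bsup>s/2\<^esup> u\<parallel>\<^sup>2 + \<langle>a u, u\<rangle>\<close> has the derivative \<open>- 2 \<langle>b u\<^sub>t, u\<^sub>t\<rangle> \<le> 0\<close> because \<open>b \<ge> 0\<close>,
  and it controls the first two terms because \<open>a \<ge> 0\<close>. Its initial value involves \<open>a\<close> only through
  one power of \<open>\<parallel>a\<parallel>\<^sub>\<infinity>\<close>, and \<open>\<parallel>u(t)\<parallel>\<close> is recovered by integrating \<open>u\<^sub>t\<close> (lemma \<open>energy_bound\<close>).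

  The solution is constructed on the Fourier side in the Hilbert space of classes of square
  integrable functions. With \<open>m = |\<xi>|\<^sup>s\<close>, the Fourier transform \<open>p\<close> of \<open>u\<close> satisfies
  \<open>p'' + m\<^sup>2 p + g = 0\<close>, where \<open>g\<close> is the transform of \<open>a u + b u\<^sub>t\<close> and depends on \<open>(p, p')\<close>
  through bounded operators. Only \<open>m\<close> is unbounded, and it is removed by rotating the pair
  \<open>(m p, p')\<close> back by the angle \<open>m t\<close>: the rotated pair \<open>(y1, y2)\<close> satisfies
  \<open>y1' = sin (m t) g\<close> and \<open>y2' = - cos (m t) g\<close>. Together with \<open>p' = - sin (m t) y1 + cos (m t) y2\<close>
  this is an ordinary differential equation with a Lipschitz right-hand side in a Banach space
  (lemma \<open>lipschitz_ode_solution\<close>), and the energy identity becomes an exact computation with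
  differentiable functions. What was dropped is regained by cutting off the frequencies with
  \<open>m > R\<close>: below the cut-off everything is differentiable, which shows that the first rotated-forward
  component is indeed \<open>m p\<close> (lemma \<open>q_weighted\<close>) and, in the limit of large \<open>R\<close>, that the equation
  holds in the sense of distributions (lemma \<open>weak_form\<close>). The limit is possible because \<open>m\<close> times the
  Fourier transform of a test function is square integrable, uniformly in time (lemma \<open>symb_slice\<close>).

  All of this rests on Plancherel's theorem in arbitrary dimension. Its source is the family of
  translated Gaussians: their Fourier transforms are explicit, the inner products of the transforms
  agree with those of the Gaussians up to a constant (lemma \<open>fourier_bump_gram\<close>), and no nonzero
  square integrable function is orthogonal to all of them (lemma \<open>AE_zero_of_bump_integrals\<close>). A map
  that preserves the Gram matrix of a total family extends to an isometry (lemma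
  \<open>isometry_extension\<close>); symmetry of the bilinear pairing under the Fourier transform supplies the
  inverse. The same totality of Gaussians makes the density representing a tempered distribution
  unique and identifies the Sobolev space with a weighted space on the Fourier side
  (lemma \<open>H_space_weighted\<close>).\<close>

section \<open>Square integrable functions\<close>

lemma L2_spaceI: "f \<in> borel_measurable borel \<Longrightarrow> integrable lborel (\<lambda>x. (norm (f x))\<^sup>2) \<Longrightarrow> f \<in> L2_space"
  by (simp add: L2_space_def)

lemma L2_space_measurable: "f \<in> L2_space \<Longrightarrow> f \<in> borel_measurable borel"
  by (simp add: L2_space_def)

lemma L2_space_integrable: "f \<in> L2_space \<Longrightarrow> integrable lborel (\<lambda>x. (norm (f x))\<^sup>2)"
  by (simp add: L2_space_def)

lemma L2_space_dominated:
  assumes "g \<in> borel_measurable borel" "integrable lborel h" "AE x in lborel. (norm (g x))\<^sup>2 \<le> h x"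
  shows "g \<in> L2_space"
proof (rule L2_spaceI[OF assms(1)])
  show "integrable lborel (\<lambda>x. (norm (g x))\<^sup>2)"
    using assms by (intro Bochner_Integration.integrable_bound[OF assms(2)]) (auto elim!: eventually_mono)
qed

lemma L2_space_add:
  assumes "f \<in> L2_space" "g \<in> L2_space" shows "(\<lambda>x. f x + g x) \<in> L2_space"
proof (rule L2_space_dominated)
  show "(\<lambda>x. f x + g x) \<in> borel_measurable borel"
    using assms[THEN L2_space_measurable] by simp
  show "integrable lborel (\<lambda>x. 2 * (norm (f x))\<^sup>2 + 2 * (norm (g x))\<^sup>2)"
    using assms by (intro Bochner_Integration.integrable_add integrable_mult_right L2_space_integrable) auto
  show "AE x in lborel. (norm (f x + g x))\<^sup>2 \<le> 2 * (norm (f x))\<^sup>2 + 2 * (norm (g x))\<^sup>2"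
  proof (rule AE_I2)
    fix x
    have "(norm (f x + g x))\<^sup>2 \<le> (norm (f x) + norm (g x))\<^sup>2"
      by (intro power_mono norm_triangle_ineq) auto
    also have "\<dots> \<le> 2 * (norm (f x))\<^sup>2 + 2 * (norm (g x))\<^sup>2"
      using sum_squares_bound[of "norm (f x)" "norm (g x)"] by (simp add: power2_sum)
    finally show "(norm (f x + g x))\<^sup>2 \<le> 2 * (norm (f x))\<^sup>2 + 2 * (norm (g x))\<^sup>2" .
  qed
qed

lemma L2_space_mult:
  assumes "f \<in> L2_space" "m \<in> borel_measurable borel" "AE x in lborel. norm (m x) \<le> C"
  shows "(\<lambda>x. m x * f x) \<in> L2_space"
proof (rule L2_space_dominated)
  show "(\<lambda>x. m x * f x) \<in> borel_measurable borel"
    using assms by (auto dest: L2_space_measurable)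
  show "integrable lborel (\<lambda>x. C\<^sup>2 * (norm (f x))\<^sup>2)"
    using assms by (intro integrable_mult_right L2_space_integrable)
  show "AE x in lborel. (norm (m x * f x))\<^sup>2 \<le> C\<^sup>2 * (norm (f x))\<^sup>2"
    using assms(3) by eventually_elim (auto simp: norm_mult power_mult_distrib intro!: mult_right_mono power_mono)
qed

lemma L2_space_cmult: "f \<in> L2_space \<Longrightarrow> (\<lambda>x. c * f x) \<in> L2_space"
  by (rule L2_space_mult[where C="norm c"]) auto

lemma L2_space_uminus: "f \<in> L2_space \<Longrightarrow> (\<lambda>x. - f x) \<in> L2_space"
  using L2_space_cmult[of f "-1"] by simp

lemma L2_space_diff: "f \<in> L2_space \<Longrightarrow> g \<in> L2_space \<Longrightarrow> (\<lambda>x. f x - g x) \<in> L2_space"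
  using L2_space_add[OF _ L2_space_uminus, of f g] by simp

lemma L2_space_zero: "(\<lambda>x. 0) \<in> L2_space"
  by (simp add: L2_space_def)

lemma L2_space_cnj: "f \<in> L2_space \<Longrightarrow> (\<lambda>x. cnj (f x)) \<in> L2_space"
  using measurable_compose[OF _ borel_measurable_continuous_onI[OF continuous_on_cnj[OF continuous_on_id]], of f borel]
  by (auto simp: L2_space_def)

lemma L2_integrable_mult:
  assumes "f \<in> L2_space" "g \<in> L2_space" shows "integrable lborel (\<lambda>x. f x * g x)"
proof (rule Bochner_Integration.integrable_bound)
  show "integrable lborel (\<lambda>x. (norm (f x))\<^sup>2 + (norm (g x))\<^sup>2)"
    using assms by (intro Bochner_Integration.integrable_add L2_space_integrable)
  show "(\<lambda>x. f x * g x) \<in> borel_measurable lborel"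
    using assms by (auto dest!: L2_space_measurable)
  show "AE x in lborel. norm (f x * g x) \<le> norm ((norm (f x))\<^sup>2 + (norm (g x))\<^sup>2)"
  proof (rule AE_I2)
    fix x
    have "norm (f x * g x) \<le> 2 * norm (f x) * norm (g x)"
      using mult_nonneg_nonneg[of "norm (f x)" "norm (g x)"] by (simp add: norm_mult)
    also have "\<dots> \<le> (norm (f x))\<^sup>2 + (norm (g x))\<^sup>2" by (rule sum_squares_bound)
    finally show "norm (f x * g x) \<le> norm ((norm (f x))\<^sup>2 + (norm (g x))\<^sup>2)" by simp
  qed
qed

lemma L2_norm_nonneg: "L2_norm f \<ge> 0"
  by (simp add: L2_norm_def)

section \<open>The Hilbert space of classes of square integrable functions\<close>

text \<open>A quotient type, rather than functions modulo null sets handled by hand, makes the general theory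
  of Banach and inner product spaces (derivatives, integrals, fixed points) applicable.\<close>

definition L2_rel :: "('a::euclidean_space \<Rightarrow> complex) \<Rightarrow> ('a \<Rightarrow> complex) \<Rightarrow> bool" where
  "L2_rel f g \<longleftrightarrow> f \<in> L2_space \<and> g \<in> L2_space \<and> (AE x in lborel. f x = g x)"

quotient_type (overloaded) 'a l2 = "'a::euclidean_space \<Rightarrow> complex" / partial: L2_rel
proof (rule part_equivpI)
  show "\<exists>x. L2_rel x x" by (rule exI[of _ "\<lambda>_. 0"]) (simp add: L2_rel_def L2_space_zero)
  show "symp L2_rel" by (auto intro!: sympI simp: L2_rel_def)
  show "transp L2_rel" by (auto intro!: transpI simp: L2_rel_def elim: eventually_elim2)
qed

lemma rep_l2_mem [simp]: "rep_l2 f \<in> L2_space"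
  using Quotient3_rep_reflp[OF Quotient3_l2, of f] by (simp add: L2_rel_def)

lemma abs_rep_l2 [simp]: "abs_l2 (rep_l2 f) = f"
  by (rule Quotient3_abs_rep[OF Quotient3_l2])

lemma abs_l2_eq_iff: "f \<in> L2_space \<Longrightarrow> g \<in> L2_space \<Longrightarrow> abs_l2 f = abs_l2 g \<longleftrightarrow> (AE x in lborel. f x = g x)"
  using Quotient3_rel[OF Quotient3_l2, of f g] by (auto simp: L2_rel_def)

lemma rep_abs_l2: "f \<in> L2_space \<Longrightarrow> AE x in lborel. rep_l2 (abs_l2 f) x = f x"
  using abs_l2_eq_iff[of "rep_l2 (abs_l2 f)" f] by simp

lemma l2_eqI: "AE x in lborel. rep_l2 f x = rep_l2 g x \<Longrightarrow> f = g"
  using abs_l2_eq_iff[of "rep_l2 f" "rep_l2 g"] by simp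

lemma rep_l2_measurable [measurable]: "rep_l2 f \<in> borel_measurable borel"
  by (rule L2_space_measurable) simp

text \<open>The bilinear pairing of two classes, without complex conjugation: this is the pairing
  that represents an L2 function as a distribution.\<close>

lift_definition bil :: "('a::euclidean_space) l2 \<Rightarrow> 'a l2 \<Rightarrow> complex" is
  "\<lambda>f g. LINT x|lborel. f x * g x"
  by (intro integral_cong_AE) (auto simp: L2_rel_def dest!: L2_space_measurable)

lift_definition cnj_l2 :: "('a::euclidean_space) l2 \<Rightarrow> 'a l2" is "\<lambda>f x. cnj (f x)"
  by (auto simp: L2_rel_def intro!: L2_space_cnj)

lift_definition scaleC :: "complex \<Rightarrow> ('a::euclidean_space) l2 \<Rightarrow> 'a l2" is "\<lambda>c f x. c * f x"
  by (auto simp: L2_rel_def intro!: L2_space_cmult)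

instantiation l2 :: (euclidean_space) real_vector
begin

lift_definition zero_l2 :: "'a l2" is "\<lambda>x. 0" by (simp add: L2_rel_def L2_space_zero)
lift_definition plus_l2 :: "'a l2 \<Rightarrow> 'a l2 \<Rightarrow> 'a l2" is "\<lambda>f g x. f x + g x"
  by (auto simp: L2_rel_def intro!: L2_space_add)
lift_definition minus_l2 :: "'a l2 \<Rightarrow> 'a l2 \<Rightarrow> 'a l2" is "\<lambda>f g x. f x - g x"
  by (auto simp: L2_rel_def intro!: L2_space_diff)
lift_definition uminus_l2 :: "'a l2 \<Rightarrow> 'a l2" is "\<lambda>f x. - f x"
  by (auto simp: L2_rel_def intro!: L2_space_uminus)
lift_definition scaleR_l2 :: "real \<Rightarrow> 'a l2 \<Rightarrow> 'a l2" is "\<lambda>c f x. complex_of_real c * f x"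
  by (auto simp: L2_rel_def intro!: L2_space_cmult)
instance
proof
  fix f g h :: "'a l2" and c d :: real
  show "f + g + h = f + (g + h)" by transfer (auto simp: L2_rel_def intro!: L2_space_add)
  show "f + g = g + f" by transfer (auto simp: L2_rel_def intro!: L2_space_add)
  show "0 + f = f" by transfer (auto simp: L2_rel_def)
  show "- f + f = 0" by transfer (auto simp: L2_rel_def L2_space_zero)
  show "f - g = f + - g" by transfer (auto simp: L2_rel_def intro!: L2_space_diff)
  show "c *\<^sub>R (f + g) = c *\<^sub>R f + c *\<^sub>R g"
    by transfer (auto simp: L2_rel_def ring_distribs intro!: L2_space_add L2_space_cmult)
  show "(c + d) *\<^sub>R f = c *\<^sub>R f + d *\<^sub>R f"
    by transfer (auto simp: L2_rel_def ring_distribs intro!: L2_space_add L2_space_cmult)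
  show "c *\<^sub>R d *\<^sub>R f = (c * d) *\<^sub>R f"
    by transfer (auto simp: L2_rel_def ring_distribs intro!: L2_space_cmult)
  show "1 *\<^sub>R f = f" by transfer (auto simp: L2_rel_def)
qed

end

lemma L2_rel_refl: "L2_rel f f \<longleftrightarrow> f \<in> L2_space"
  by (simp add: L2_rel_def)

lemma bil_add: "bil (f + g) h = bil f h + bil g h"
  by transfer (auto simp: L2_rel_refl ring_distribs L2_integrable_mult
       intro!: Bochner_Integration.integral_add)

lemma bil_sym: "bil f g = bil g f"
  by transfer (simp add: mult.commute)

lemma bil_scaleC: "bil (scaleC c f) g = c * bil f g"
  by transfer (simp add: mult.assoc)

lemma bil_scaleC_right: "bil f (scaleC c g) = c * bil f g"
  by (metis bil_scaleC bil_sym)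

lemma scaleR_scaleC: "c *\<^sub>R f = scaleC (complex_of_real c) f"
  by transfer (auto simp: L2_rel_def L2_space_cmult)

lemma bil_cnj: "bil (cnj_l2 f) (cnj_l2 g) = cnj (bil f g)"
  by transfer (simp flip: complex_cnj_mult)

lemma cnj_cnj_l2 [simp]: "cnj_l2 (cnj_l2 f) = f"
  by transfer (auto simp: L2_rel_def L2_space_cnj)

lemma bil_abs:
  "f \<in> L2_space \<Longrightarrow> g \<in> L2_space \<Longrightarrow> bil (abs_l2 f) (abs_l2 g) = (LINT x|lborel. f x * g x)"
  by (simp add: bil.abs_eq L2_rel_refl)

lemma cnj_l2_abs: "f \<in> L2_space \<Longrightarrow> cnj_l2 (abs_l2 f) = abs_l2 (\<lambda>x. cnj (f x))"
  by (simp add: cnj_l2.abs_eq L2_rel_refl)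

lemma bil_cnj_self: "bil f (cnj_l2 f) = complex_of_real ((L2_norm (rep_l2 f))\<^sup>2)"
proof -
  have "bil f (cnj_l2 f) = (LINT x|lborel. rep_l2 f x * cnj (rep_l2 f x))"
    using bil_abs[of "rep_l2 f" "\<lambda>x. cnj (rep_l2 f x)"] cnj_l2_abs[of "rep_l2 f"] by (simp add: L2_space_cnj)
  also have "\<dots> = (LINT x|lborel. complex_of_real ((norm (rep_l2 f x))\<^sup>2))"
    by (intro Bochner_Integration.integral_cong) (auto simp: complex_norm_square[symmetric])
  also have "\<dots> = complex_of_real (LINT x|lborel. (norm (rep_l2 f x))\<^sup>2)"
    by (rule integral_complex_of_real)
  finally show ?thesis by (simp add: L2_norm_def)
qed

instantiation l2 :: (euclidean_space) real_inner
begin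

definition inner_l2 :: "'a l2 \<Rightarrow> 'a l2 \<Rightarrow> real" where "inner_l2 f g = Re (bil f (cnj_l2 g))"
definition norm_l2 :: "'a l2 \<Rightarrow> real" where "norm_l2 f = sqrt (inner f f)"
definition sgn_l2 :: "'a l2 \<Rightarrow> 'a l2" where "sgn_l2 f = f /\<^sub>R norm f"
definition dist_l2 :: "'a l2 \<Rightarrow> 'a l2 \<Rightarrow> real" where "dist_l2 f g = norm (f - g)"
definition uniformity_l2 :: "('a l2 \<times> 'a l2) filter" where
  "uniformity_l2 = (INF e\<in>{0 <..}. principal {(x, y). dist (x :: 'a l2) y < e})"
definition open_l2 :: "'a l2 set \<Rightarrow> bool" where
  "open_l2 U \<longleftrightarrow> (\<forall>x\<in>U. \<forall>\<^sub>F (x', y) in uniformity. x' = x \<longrightarrow> y \<in> U)"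

instance
proof
  fix f g h :: "'a l2" and c d :: real
  show "dist f g = norm (f - g)" by (rule dist_l2_def)
  show "sgn f = f /\<^sub>R norm f" by (rule sgn_l2_def)
  show "uniformity = (INF e\<in>{0 <..}. principal {(x, y). dist (x :: 'a l2) y < e})" by (rule uniformity_l2_def)
  show "open U \<longleftrightarrow> (\<forall>x\<in>U. \<forall>\<^sub>F (x', y) in uniformity. x' = x \<longrightarrow> y \<in> U)" for U :: "'a l2 set"
    by (rule open_l2_def)
  show "inner f g = inner g f"
    unfolding inner_l2_def using bil_cnj[of f "cnj_l2 g"] by (simp add: bil_sym)
  show "inner (f + g) h = inner f h + inner g h"
    by (simp add: inner_l2_def bil_add)
  show "inner (c *\<^sub>R f) g = c * inner f g"
    by (simp add: inner_l2_def scaleR_scaleC bil_scaleC)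
  show "norm f = sqrt (inner f f)" by (rule norm_l2_def)
  show "0 \<le> inner f f" by (simp add: inner_l2_def bil_cnj_self)
  have "L2_norm (rep_l2 f) = 0 \<longleftrightarrow> (AE x in lborel. rep_l2 f x = 0)"
    unfolding L2_norm_def by (simp add: integral_nonneg_eq_0_iff_AE L2_space_integrable)
  also have "\<dots> \<longleftrightarrow> f = 0"
  proof
    assume "AE x in lborel. rep_l2 f x = 0"
    then have "abs_l2 (rep_l2 f) = abs_l2 (\<lambda>x. 0)" by (subst abs_l2_eq_iff) (auto simp: L2_space_zero)
    then show "f = 0" by (simp add: zero_l2_def)
  next
    assume "f = 0"
    then show "AE x in lborel. rep_l2 f x = 0"
      using rep_abs_l2[OF L2_space_zero] by (simp add: zero_l2_def)
  qed
  finally show "inner f f = 0 \<longleftrightarrow> f = 0" by (simp add: inner_l2_def bil_cnj_self)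
qed

end

lemma bil_rep: "bil f g = (LINT x|lborel. rep_l2 f x * rep_l2 g x)"
  using bil_abs[of "rep_l2 f" "rep_l2 g"] by simp

lemma norm_l2_rep: "norm f = L2_norm (rep_l2 f)"
  by (simp add: norm_l2_def inner_l2_def bil_cnj_self L2_norm_nonneg)

lemma L2_norm_cong_AE:
  assumes "f \<in> borel_measurable borel" "g \<in> borel_measurable borel" "AE x in lborel. f x = g x"
  shows "L2_norm f = L2_norm g"
  unfolding L2_norm_def using assms
  by (intro arg_cong[of _ _ sqrt] integral_cong_AE) (auto elim!: eventually_mono)

lemma norm_abs_l2: "f \<in> L2_space \<Longrightarrow> norm (abs_l2 f) = L2_norm f"
  unfolding norm_l2_rep
  by (intro L2_norm_cong_AE rep_abs_l2) (auto dest: L2_space_measurable)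

lemma abs_l2_add: "f \<in> L2_space \<Longrightarrow> g \<in> L2_space \<Longrightarrow> abs_l2 (\<lambda>x. f x + g x) = abs_l2 f + abs_l2 g"
  by (simp add: plus_l2.abs_eq L2_rel_refl)

lemma abs_l2_diff: "f \<in> L2_space \<Longrightarrow> g \<in> L2_space \<Longrightarrow> abs_l2 (\<lambda>x. f x - g x) = abs_l2 f - abs_l2 g"
  by (simp add: minus_l2.abs_eq L2_rel_refl)

lemma abs_l2_scaleC: "f \<in> L2_space \<Longrightarrow> abs_l2 (\<lambda>x. c * f x) = scaleC c (abs_l2 f)"
  by (simp add: scaleC.abs_eq L2_rel_refl)

lemma rep_l2_add: "AE x in lborel. rep_l2 (f + g) x = rep_l2 f x + rep_l2 g x"
  using rep_abs_l2[of "\<lambda>x. rep_l2 f x + rep_l2 g x"] abs_l2_add[of "rep_l2 f" "rep_l2 g"]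
  by (simp add: L2_space_add)

lemma rep_l2_diff: "AE x in lborel. rep_l2 (f - g) x = rep_l2 f x - rep_l2 g x"
  using rep_abs_l2[of "\<lambda>x. rep_l2 f x - rep_l2 g x"] abs_l2_diff[of "rep_l2 f" "rep_l2 g"]
  by (simp add: L2_space_diff)

lemma rep_l2_scaleC: "AE x in lborel. rep_l2 (scaleC c f) x = c * rep_l2 f x"
  using rep_abs_l2[of "\<lambda>x. c * rep_l2 f x"] abs_l2_scaleC[of "rep_l2 f"]
  by (simp add: L2_space_cmult)

lemma rep_l2_cnj: "AE x in lborel. rep_l2 (cnj_l2 f) x = cnj (rep_l2 f x)"
  using rep_abs_l2[of "\<lambda>x. cnj (rep_l2 f x)"] cnj_l2_abs[of "rep_l2 f"]
  by (simp add: L2_space_cnj)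

lemma inner_l2_rep: "inner f g = Re (LINT x|lborel. rep_l2 f x * cnj (rep_l2 g x))"
  using bil_abs[of "rep_l2 f" "\<lambda>x. cnj (rep_l2 g x)"] cnj_l2_abs[of "rep_l2 g"]
  by (simp add: inner_l2_def L2_space_cnj)

lemma nn_integral_l2: "(\<integral>\<^sup>+x. ennreal ((norm (rep_l2 f x))\<^sup>2) \<partial>lborel) = ennreal ((norm f)\<^sup>2)"
  by (subst nn_integral_eq_integral) (auto simp: norm_l2_rep L2_norm_def L2_space_integrable)

lemma nn_integral_l2_diff:
  "(\<integral>\<^sup>+x. ennreal ((norm (rep_l2 f x - rep_l2 g x))\<^sup>2) \<partial>lborel) = ennreal ((norm (f - g))\<^sup>2)"
  unfolding nn_integral_l2[symmetric]
  by (intro nn_integral_cong_AE) (use rep_l2_diff[of f g] in eventually_elim, simp)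

lemma norm_scaleC: "norm (scaleC c f) = norm c * norm f"
proof -
  have "inner (scaleC c f) (scaleC c f) = (norm c)\<^sup>2 * inner f f"
  proof -
    have "cnj_l2 (scaleC c f) = scaleC (cnj c) (cnj_l2 f)"
      by transfer (auto simp: L2_rel_def L2_space_cnj L2_space_cmult)
    then have "bil (scaleC c f) (cnj_l2 (scaleC c f)) = (c * cnj c) * bil f (cnj_l2 f)"
      by (simp add: bil_scaleC bil_scaleC_right)
    then show ?thesis
      by (simp add: inner_l2_def bil_cnj_self flip: complex_norm_square of_real_mult of_real_power)
  qed
  then show ?thesis by (simp add: norm_eq_sqrt_inner real_sqrt_mult)
qed

lemma norm_cnj_l2 [simp]: "norm (cnj_l2 f) = norm f"
proof -
  have "inner (cnj_l2 f) (cnj_l2 f) = inner f f"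
    by (simp add: inner_l2_def bil_sym)
  then show ?thesis by (simp add: norm_eq_sqrt_inner)
qed

text \<open>Multiplying \<open>f\<close> by a phase makes the pairing real, where the Cauchy-Schwarz inequality of the
  real inner product applies.\<close>

lemma norm_bil_le: "norm (bil f g) \<le> norm f * norm g"
proof -
  define c where "c = cnj (sgn (bil f g))"
  have "norm (bil f g) = Re (c * bil f g)"
  proof -
    have "cnj (sgn z) * z = complex_of_real (norm z)" for z :: complex
      by (cases "z = 0") (simp_all add: sgn_eq mult.commute flip: complex_norm_square, simp add: power2_eq_square)
    then show ?thesis by (simp add: c_def)
  qed
  also have "\<dots> = inner (scaleC c f) (cnj_l2 g)"
    by (simp add: inner_l2_def bil_scaleC)
  also have "\<dots> \<le> norm (scaleC c f) * norm (cnj_l2 g)" by (rule norm_cauchy_schwarz)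
  also have "\<dots> \<le> norm f * norm g"
    by (auto simp: norm_scaleC c_def norm_sgn)
  finally show ?thesis .
qed

lemma bounded_bilinear_bil: "bounded_bilinear bil"
proof
  fix f f' g g' :: "'a l2" and r :: real
  show "bil (f + f') g = bil f g + bil f' g" by (rule bil_add)
  show "bil f (g + g') = bil f g + bil f g'" by (metis bil_add bil_sym)
  show "bil (r *\<^sub>R f) g = r *\<^sub>R bil f g" by (simp add: scaleR_scaleC bil_scaleC scaleR_conv_of_real)
  show "bil f (r *\<^sub>R g) = r *\<^sub>R bil f g"
    by (metis scaleR_scaleC bil_scaleC scaleR_conv_of_real bil_sym)
  show "\<exists>K. \<forall>f g :: 'a l2. norm (bil f g) \<le> norm f * norm g * K"
    by (intro exI[of _ 1]) (simp add: norm_bil_le)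
qed

lemma bounded_linear_cnj_l2: "bounded_linear cnj_l2"
proof (rule bounded_linear_intro[where K=1])
  show "cnj_l2 (f + g) = cnj_l2 f + cnj_l2 g" for f g :: "'a l2"
    by transfer (auto simp: L2_rel_def L2_space_cnj L2_space_add)
  show "cnj_l2 (r *\<^sub>R f) = r *\<^sub>R cnj_l2 f" for r and f :: "'a l2"
    by transfer (auto simp: L2_rel_def L2_space_cnj L2_space_cmult)
qed simp

lemma bounded_linear_scaleC: "bounded_linear (scaleC c)"
proof (rule bounded_linear_intro[where K="norm c"])
  show "scaleC c (f + g) = scaleC c f + scaleC c g" for f g :: "'a l2"
    by transfer (auto simp: L2_rel_def L2_space_cmult L2_space_add ring_distribs)
  show "scaleC c (r *\<^sub>R f) = r *\<^sub>R scaleC c f" for r and f :: "'a l2"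
    by transfer (auto simp: L2_rel_def L2_space_cmult)
qed (simp add: norm_scaleC mult.commute)

text \<open>Along a subsequence the successive differences have norm at most
  \<open>2\<^sup>-\<^sup>k\<close>; summing their squares with weights \<open>2\<^sup>k\<close> shows that they decay geometrically at almost
  every point, which gives a pointwise limit. Fatou's lemma turns this into convergence in L2.\<close>

instance l2 :: (euclidean_space) complete_space
proof
  fix X :: "nat \<Rightarrow> 'a l2" assume X: "Cauchy X"
  have "\<exists>N. \<forall>m\<ge>N. \<forall>n\<ge>N. norm (X m - X n) < (1/2)^k" for k
    using CauchyD[OF X, of "(1/2)^k"] by auto
  then obtain N where N: "\<And>k m n. m \<ge> N k \<Longrightarrow> n \<ge> N k \<Longrightarrow> norm (X m - X n) < (1/2)^k"
    by metis
  define r where "r k = k + (\<Sum>i\<le>k. N i)" for k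
  have r: "strict_mono r" by (auto simp: r_def strict_mono_Suc_iff)
  have r_mono: "r k \<le> r j" if "k \<le> j" for k j
    using monoD[OF strict_mono_mono[OF r] that] .
  have rN: "r k \<ge> N k" for k
    using member_le_sum[of k "{..k}" N] by (simp add: r_def trans_le_add2)
  define f where "f k = rep_l2 (X (r k))" for k
  have [measurable]: "f k \<in> borel_measurable borel" for k by (simp add: f_def)
  have "(\<integral>\<^sup>+x. (\<Sum>k. ennreal (2^k * (norm (f (Suc k) x - f k x))\<^sup>2)) \<partial>lborel)
      = (\<Sum>k. \<integral>\<^sup>+x. ennreal (2^k * (norm (f (Suc k) x - f k x))\<^sup>2) \<partial>lborel)"
    by (rule nn_integral_suminf) measurable
  also have "\<dots> = (\<Sum>k. ennreal (2^k * (norm (X (r (Suc k)) - X (r k)))\<^sup>2))"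
    by (simp add: ennreal_mult nn_integral_cmult nn_integral_l2_diff f_def)
  also have "\<dots> \<le> (\<Sum>k. ennreal ((1/2)^k))"
  proof (rule suminf_le)
    fix k
    have "norm (X (r (Suc k)) - X (r k)) \<le> (1/2)^k"
      by (rule less_imp_le[OF N]) (use rN[of k] r_mono[of k "Suc k"] in linarith)+
    then have "2^k * (norm (X (r (Suc k)) - X (r k)))\<^sup>2 \<le> 2^k * ((1/2)^k)\<^sup>2"
      by (intro mult_left_mono power_mono) auto
    also have "\<dots> = (1/2)^k" by (simp add: power2_eq_square flip: power_mult_distrib)
    finally show "ennreal (2^k * (norm (X (r (Suc k)) - X (r k)))\<^sup>2) \<le> ennreal ((1/2)^k)"
      by (rule ennreal_leI)
  qed auto
  also have "\<dots> = ennreal (\<Sum>k. (1/2)^k)"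
    by (intro suminf_ennreal2) (auto intro: summable_geometric)
  also have "\<dots> < \<infinity>" by simp
  finally have "AE x in lborel. (\<Sum>k. ennreal (2^k * (norm (f (Suc k) x - f k x))\<^sup>2)) \<noteq> \<infinity>"
    by (intro nn_integral_PInf_AE) auto
  then have conv: "AE x in lborel. (\<lambda>k. f k x) \<longlonglongrightarrow> lim (\<lambda>k. f k x)"
  proof eventually_elim
    case (elim x)
    define d where "d k = norm (f (Suc k) x - f k x)" for k
    from elim have "summable (\<lambda>k. 2^k * (d k)\<^sup>2)"
      by (intro summable_suminf_not_top) (auto simp: d_def)
    then have "Bseq (\<lambda>k. 2^k * (d k)\<^sup>2)"
      by (intro convergent_imp_Bseq) (auto dest!: summable_LIMSEQ_zero simp: convergent_def)
    then obtain K where K: "K > 0" "\<And>k. 2^k * (d k)\<^sup>2 \<le> K"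
      by (auto simp: Bseq_def)
    have "summable (\<lambda>k. norm (f (Suc k) x - f k x))"
    proof (rule summable_comparison_test)
      show "summable (\<lambda>k. sqrt K * (1 / sqrt 2)^k)"
        by (intro summable_mult summable_geometric) (auto simp: real_less_rsqrt)
      have "d k \<le> sqrt K * (1 / sqrt 2)^k" for k
      proof (rule power2_le_imp_le)
        have "((1 / sqrt 2)^k)\<^sup>2 = ((1 / sqrt 2)\<^sup>2)^k" by (simp add: mult.commute flip: power_mult)
        then have "(sqrt K * (1 / sqrt 2)^k)\<^sup>2 = K / 2^k"
          using K(1) by (simp add: power_mult_distrib power_divide)
        then show "(d k)\<^sup>2 \<le> (sqrt K * (1 / sqrt 2)^k)\<^sup>2"
          using K(2)[of k] by (simp add: pos_le_divide_eq mult.commute)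
      qed (use K in auto)
      then show "\<exists>N. \<forall>n\<ge>N. norm (norm (f (Suc n) x - f n x)) \<le> sqrt K * (1 / sqrt 2)^n"
        by (auto simp: d_def)
    qed
    then have "summable (\<lambda>k. f (Suc k) x - f k x)" by (rule summable_norm_cancel)
    then have "convergent (\<lambda>n. \<Sum>k<n. f (Suc k) x - f k x)"
      by (simp add: summable_iff_convergent)
    then have "convergent (\<lambda>n. (f n x - f 0 x) + f 0 x)"
      by (intro convergent_add convergent_const) (simp add: sum_lessThan_telescope[of "\<lambda>k. f k x"])
    then show ?case by (simp add: convergent_LIMSEQ_iff)
  qed
  define g where "g x = lim (\<lambda>k. f k x)" for x
  have [measurable]: "g \<in> borel_measurable borel"
    unfolding g_def by (rule borel_measurable_lim_metric) measurable
  have fatou: "(\<integral>\<^sup>+x. ennreal ((norm (g x - f n x))\<^sup>2) \<partial>lborel) \<le> ennreal (e\<^sup>2)"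
    if e: "\<And>j. j \<ge> n \<Longrightarrow> norm (X (r j) - X (r n)) \<le> e" for n e
  proof -
    have "(\<integral>\<^sup>+x. ennreal ((norm (g x - f n x))\<^sup>2) \<partial>lborel)
        = (\<integral>\<^sup>+x. liminf (\<lambda>j. ennreal ((norm (f j x - f n x))\<^sup>2)) \<partial>lborel)"
    proof (rule nn_integral_cong_AE)
      show "AE x in lborel. ennreal ((norm (g x - f n x))\<^sup>2) = liminf (\<lambda>j. ennreal ((norm (f j x - f n x))\<^sup>2))"
        using conv
      proof eventually_elim
        case (elim x)
        then have "(\<lambda>j. ennreal ((norm (f j x - f n x))\<^sup>2)) \<longlonglongrightarrow> ennreal ((norm (g x - f n x))\<^sup>2)"
          by (intro tendsto_intros tendsto_ennrealI) (simp add: g_def)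
        then show ?case by (rule lim_imp_Liminf[OF trivial_limit_sequentially, symmetric])
      qed
    qed
    also have "\<dots> \<le> liminf (\<lambda>j. \<integral>\<^sup>+x. ennreal ((norm (f j x - f n x))\<^sup>2) \<partial>lborel)"
      by (rule nn_integral_liminf) measurable
    also have "\<dots> = liminf (\<lambda>j. ennreal ((norm (X (r j) - X (r n)))\<^sup>2))"
      by (simp add: f_def nn_integral_l2_diff)
    also have "\<dots> \<le> ennreal (e\<^sup>2)"
      by (rule Liminf_le) (use e in \<open>auto intro!: eventually_sequentiallyI[of n] ennreal_leI power_mono\<close>)
    finally show ?thesis .
  qed
  have *: "norm (X (r j) - X (r n)) \<le> (1/2)^k" if "k \<le> n" "n \<le> j" for n j k
    by (rule less_imp_le[OF N]) (use rN[of k] r_mono[of k j] r_mono[of k n] that in linarith)+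
  have gL2: "g \<in> L2_space"
  proof -
    have "(\<integral>\<^sup>+x. ennreal ((norm (g x - f 0 x))\<^sup>2) \<partial>lborel) < \<infinity>"
      using fatou[of 0 1] *[of 0 0] by (auto intro: le_less_trans)
    then have "(\<lambda>x. g x - f 0 x) \<in> L2_space"
      by (intro L2_spaceI integrableI_bounded) auto
    from L2_space_add[OF this, of "f 0"] show ?thesis by (simp add: f_def)
  qed
  have "(\<lambda>n. X (r n)) \<longlonglongrightarrow> abs_l2 g"
  proof (rule LIMSEQ_I)
    fix e :: real assume "e > 0"
    then obtain k where k: "(1/2)^k < e" using real_arch_pow_inv[of e "1/2"] by auto
    have "norm (X (r n) - abs_l2 g) \<le> (1/2)^k" if "n \<ge> k" for n
    proof -
      have "ennreal ((norm (abs_l2 g - X (r n)))\<^sup>2) = (\<integral>\<^sup>+x. ennreal ((norm (g x - f n x))\<^sup>2) \<partial>lborel)"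
        unfolding nn_integral_l2_diff[symmetric] f_def
        by (intro nn_integral_cong_AE) (use rep_abs_l2[OF gL2] in eventually_elim, simp)
      also have "\<dots> \<le> ennreal (((1/2)^k)\<^sup>2)" by (intro fatou *) (use that in auto)
      finally have "(norm (abs_l2 g - X (r n)))\<^sup>2 \<le> ((1/2)^k)\<^sup>2" by (simp add: ennreal_le_iff)
      then have "norm (abs_l2 g - X (r n)) \<le> (1/2)^k" by (rule power2_le_imp_le) simp
      then show ?thesis by (simp add: norm_minus_commute)
    qed
    then show "\<exists>no. \<forall>n\<ge>no. norm (X (r n) - abs_l2 g) < e"
      using k by (intro exI[of _ k]) (auto intro: le_less_trans)
  qed
  then have "X \<longlonglongrightarrow> abs_l2 g"
    by (intro Cauchy_converges_subseq[OF X r]) (simp add: o_def)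
  then show "convergent X" by (auto simp: convergent_def)
qed

section \<open>Closed subspaces and isometries of Hilbert spaces\<close>

text \<open>Otherwise a point outside \<open>M\<close> would have a nearest point in \<open>M\<close>: by the parallelogram law a
  minimising sequence is Cauchy. The difference between the two is orthogonal to \<open>M\<close>.\<close>

lemma closed_subspace_eq_UNIV:
  fixes M :: "'h::{real_inner,complete_space} set"
  assumes M: "subspace M" "closed M" and orth: "\<And>w. (\<And>x. x \<in> M \<Longrightarrow> inner x w = 0) \<Longrightarrow> w = 0"
  shows "M = UNIV"
proof -
  have "y \<in> M" for y
  proof -
    define d where "d = infdist y M"
    have ne: "M \<noteq> {}" using subspace_0[OF M(1)] by auto
    have d: "d \<ge> 0" "\<And>x. x \<in> M \<Longrightarrow> d \<le> norm (y - x)"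
      using infdist_le[of _ M y] by (auto simp: d_def infdist_nonneg dist_norm)
    have "\<exists>x\<in>M. (norm (y - x))\<^sup>2 < d\<^sup>2 + 1 / real (Suc n)" for n
    proof -
      have "d < sqrt (d\<^sup>2 + 1 / real (Suc n))" using d(1) by (intro real_less_rsqrt) simp
      moreover have "bdd_below ((\<lambda>x. norm (y - x)) ` M)" by (intro bdd_belowI2[of _ 0]) auto
      moreover have "d = (INF x\<in>M. norm (y - x))" using ne by (simp add: d_def infdist_notempty dist_norm)
      ultimately obtain x where "x \<in> M" "norm (y - x) < sqrt (d\<^sup>2 + 1 / real (Suc n))"
        using cINF_less_iff[OF ne, of "\<lambda>x. norm (y - x)"] by metis
      moreover from this(2) have "(norm (y - x))\<^sup>2 < (sqrt (d\<^sup>2 + 1 / real (Suc n)))\<^sup>2"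
        by (intro power_strict_mono) auto
      ultimately show ?thesis by (intro bexI[of _ x]) (auto simp: add_nonneg_nonneg)
    qed
    then obtain x where x: "\<And>n. x n \<in> M" "\<And>n. (norm (y - x n))\<^sup>2 < d\<^sup>2 + 1 / real (Suc n)" by metis
    have par: "(norm (x n - x m))\<^sup>2 \<le> 2 / real (Suc n) + 2 / real (Suc m)" for n m
    proof -
      have "(1/2) *\<^sub>R (x n + x m) \<in> M" by (intro subspace_scale subspace_add M x)
      then have "d\<^sup>2 \<le> (norm (y - (1/2) *\<^sub>R (x n + x m)))\<^sup>2" by (intro power_mono d)
      moreover have "(norm (x n - x m))\<^sup>2 =
          2 * (norm (y - x n))\<^sup>2 + 2 * (norm (y - x m))\<^sup>2 - 4 * (norm (y - (1/2) *\<^sub>R (x n + x m)))\<^sup>2"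
        by (simp add: power2_norm_eq_inner inner_simps inner_commute algebra_simps)
      ultimately show ?thesis using x(2)[of n] x(2)[of m] by simp
    qed
    have "Cauchy x"
    proof (rule CauchyI)
      fix e :: real assume e: "e > 0"
      obtain K where K: "1 / real (Suc K) < e\<^sup>2 / 4"
        using reals_Archimedean[of "e\<^sup>2 / 4"] e by (auto simp: inverse_eq_divide)
      have "norm (x m - x n) < e" if "m \<ge> K" "n \<ge> K" for m n
      proof (rule power2_less_imp_less)
        have "1 / real (Suc j) \<le> 1 / real (Suc K)" if "j \<ge> K" for j
          using that by (intro divide_left_mono) auto
        from this[OF that(1)] this[OF that(2)] par[of m n] K
        show "(norm (x m - x n))\<^sup>2 < e\<^sup>2" by simp
      qed (use e in auto)
      then show "\<exists>M. \<forall>m\<ge>M. \<forall>n\<ge>M. norm (x m - x n) < e" by blast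
    qed
    then obtain z where z: "x \<longlonglongrightarrow> z" by (auto simp: Cauchy_convergent_iff convergent_def)
    have zM: "z \<in> M" using closed_sequentially[OF M(2)] x(1) z by blast
    have "(norm (y - z))\<^sup>2 \<le> d\<^sup>2"
    proof (rule LIMSEQ_le)
      show "(\<lambda>n. (norm (y - x n))\<^sup>2) \<longlonglongrightarrow> (norm (y - z))\<^sup>2" by (intro tendsto_intros z)
      show "(\<lambda>n. d\<^sup>2 + 1 / real (Suc n)) \<longlonglongrightarrow> d\<^sup>2"
        using tendsto_add[OF tendsto_const[of "d\<^sup>2"] LIMSEQ_inverse_real_of_nat] by (simp add: inverse_eq_divide)
    qed (use x(2) in \<open>auto intro: less_imp_le\<close>)
    have "inner v (y - z) = 0" if v: "v \<in> M" for v
    proof (cases "v = 0")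
      case False
      \<comment> \<open>the value at which the distance from \<open>y\<close> to \<open>z + t v\<close> is smallest\<close>
      define t where "t = inner v (y - z) / (norm v)\<^sup>2"
      have "z + t *\<^sub>R v \<in> M" by (intro subspace_add subspace_scale M zM v)
      then have "d\<^sup>2 \<le> (norm (y - (z + t *\<^sub>R v)))\<^sup>2" by (intro power_mono d)
      moreover have "(norm (y - (z + t *\<^sub>R v)))\<^sup>2 = (norm (y - z))\<^sup>2 - 2 * t * inner v (y - z) + t\<^sup>2 * (norm v)\<^sup>2"
        unfolding power2_norm_eq_inner by (simp add: inner_simps inner_commute power2_eq_square algebra_simps)
      moreover have "\<dots> = (norm (y - z))\<^sup>2 - (inner v (y - z))\<^sup>2 / (norm v)\<^sup>2"
        using False by (simp add: t_def power2_eq_square)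
      ultimately have "(inner v (y - z))\<^sup>2 / (norm v)\<^sup>2 \<le> 0" using \<open>(norm (y - z))\<^sup>2 \<le> d\<^sup>2\<close> by linarith
      then show ?thesis using False by (simp add: divide_le_0_iff)
    qed simp
    then have "y - z = 0" by (rule orth)
    with zM show "y \<in> M" by simp
  qed
  then show ?thesis by auto
qed

lemma subspace_closure:
  fixes S :: "'h::real_normed_vector set"
  assumes "subspace S" shows "subspace (closure S)"
proof (rule subspaceI)
  show "0 \<in> closure S"
    by (rule subsetD[OF closure_subset subspace_0[OF assms]])
next
  fix x y assume "x \<in> closure S" "y \<in> closure S"
  then obtain a b where "\<And>n. a n \<in> S" "a \<longlonglongrightarrow> x" "\<And>n. b n \<in> S" "b \<longlonglongrightarrow> y"
    by (auto simp: closure_sequential)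
  then show "x + y \<in> closure S"
    unfolding closure_sequential
    by (intro exI[of _ "\<lambda>n. a n + b n"]) (auto intro: tendsto_add subspace_add[OF assms])
next
  fix c x assume "x \<in> closure S"
  then obtain a where "\<And>n. a n \<in> S" "a \<longlonglongrightarrow> x"
    by (auto simp: closure_sequential)
  then show "c *\<^sub>R x \<in> closure S"
    unfolding closure_sequential
    by (intro exI[of _ "\<lambda>n. c *\<^sub>R a n"]) (auto intro: tendsto_scaleR subspace_scale[OF assms])
qed

lemma bounded_linear_eq_on_total:
  fixes g :: "'i \<Rightarrow> 'h::{real_inner,complete_space}"
  assumes total: "\<And>w. (\<And>i. inner (g i) w = 0) \<Longrightarrow> w = 0"
    and F: "bounded_linear F" "bounded_linear G" "\<And>i. F (g i) = G (g i)"
  shows "F x = G x"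
proof -
  interpret F: bounded_linear F by fact
  interpret G: bounded_linear G by fact
  have "{x. F x = G x} = UNIV"
  proof (rule closed_subspace_eq_UNIV)
    show "subspace {x. F x = G x}"
      by (auto simp: subspace_def F.add G.add F.scaleR G.scaleR F.zero G.zero)
    show "closed {x. F x = G x}"
      by (intro closed_Collect_eq linear_continuous_on F)
    show "w = 0" if "\<And>x. x \<in> {x. F x = G x} \<Longrightarrow> inner x w = 0" for w
      using that F(3) by (intro total) auto
  qed
  then show ?thesis by auto
qed

text \<open>The graph of the extension is the closed span of the pairs \<open>(g i, T i)\<close>. Equality of the
  Gram matrices makes both components of every element of it equally long, so it is the graph of a
  function, and its domain is closed and contains the total family \<open>g\<close>.\<close>

lemma isometry_extension:
  fixes g T :: "'i \<Rightarrow> 'h::{real_inner,complete_space}"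
  assumes gram: "\<And>i j. inner (T i) (T j) = inner (g i) (g j)"
    and total: "\<And>w. (\<And>i. inner (g i) w = 0) \<Longrightarrow> w = 0"
  shows "\<exists>U. bounded_linear U \<and> (\<forall>i. U (g i) = T i) \<and> (\<forall>x. norm (U x) = norm x)"
proof -
  define S where "S = span (range (\<lambda>i. (g i, T i)))"
  define G where "G = closure S"
  have sub: "subspace G" unfolding G_def S_def by (intro subspace_closure subspace_span)
  have gen: "(g i, T i) \<in> G" for i
    unfolding G_def S_def by (rule subsetD[OF closure_subset]) (auto intro: span_base)
  have 1: "\<forall>i. inner (fst p) (g i) = inner (snd p) (T i)" if "p \<in> S" for p
    using that unfolding S_def
    by (induction rule: span_induct) (auto simp: gram subspace_def inner_simps)
  have 2: "inner (fst p) (fst q) = inner (snd p) (snd q)" if "p \<in> S" "q \<in> S" for p q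
    using that(2) unfolding S_def
    by (induction rule: span_induct) (use 1[OF that(1)] in \<open>auto simp: subspace_def inner_simps\<close>)
  have S_iso: "S \<subseteq> {p. norm (fst p) = norm (snd p)}"
    using 2 by (auto simp: norm_eq_sqrt_inner)
  have iso: "norm (fst p) = norm (snd p)" if "p \<in> G" for p
  proof -
    have "closure S \<subseteq> {p. norm (fst p) = norm (snd p)}"
      by (intro closure_minimal S_iso closed_Collect_eq continuous_intros)
    then show ?thesis using that by (auto simp: G_def)
  qed
  have "fst ` G = UNIV"
  proof (rule closed_subspace_eq_UNIV)
    show "subspace (fst ` G)" by (intro linear_subspace_image sub bounded_linear.linear bounded_linear_fst)
    have "complete (fst ` G)"
    proof (rule complete_isometric_image[where e="1/2"])
      show "\<forall>x\<in>G. norm (fst x) \<ge> 1/2 * norm x"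
      proof
        fix x assume "x \<in> G"
        then show "norm (fst x) \<ge> 1/2 * norm x"
          using iso[of x] norm_Pair_le[of "fst x" "snd x"] by simp
      qed
      show "complete G" by (simp add: complete_eq_closed G_def)
    qed (use sub in \<open>auto intro: bounded_linear_fst\<close>)
    then show "closed (fst ` G)" by (rule complete_imp_closed)
    show "w = 0" if "\<And>x. x \<in> fst ` G \<Longrightarrow> inner x w = 0" for w
      using that gen by (intro total) force
  qed
  then have "\<exists>y. (x, y) \<in> G" for x by (metis UNIV_I imageE prod.collapse)
  then obtain U where U: "\<And>x. (x, U x) \<in> G" by metis
  have uniq: "y = U x" if "(x, y) \<in> G" for x y
    using iso[OF subspace_diff[OF sub that U[of x]]] by simp
  have "bounded_linear U"
  proof (rule bounded_linear_intro[where K=1])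
    show "U (x + y) = U x + U y" for x y
      using uniq[of "x + y" "U x + U y"] subspace_add[OF sub U[of x] U[of y]] by simp
    show "U (r *\<^sub>R x) = r *\<^sub>R U x" for r x
      using uniq[of "r *\<^sub>R x" "r *\<^sub>R U x"] subspace_scale[OF sub U[of x]] by simp
    show "norm (U x) \<le> norm x * 1" for x
      using iso[OF U[of x]] by simp
  qed
  moreover have "U (g i) = T i" for i using uniq[OF gen[of i]] by simp
  moreover have "norm (U x) = norm x" for x using iso[OF U[of x]] by simp
  ultimately show ?thesis by blast
qed

section \<open>Integration in Euclidean spaces\<close>

lemma
  fixes f :: "'a::euclidean_space \<Rightarrow> real \<Rightarrow> 'b::{real_normed_field,banach,second_countable_topology}"
  assumes f: "\<And>b. b \<in> Basis \<Longrightarrow> integrable lborel (f b)"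
  shows integrable_lborel_prod: "integrable lborel (\<lambda>x::'a. \<Prod>b\<in>Basis. f b (x \<bullet> b))"
    and integral_lborel_prod: "(LINT x|lborel. (\<Prod>b\<in>(Basis::'a set). f b (x \<bullet> b))) = (\<Prod>b\<in>Basis. LINT t|lborel. f b t)"
proof -
  interpret product_sigma_finite "\<lambda>_::'a. lborel :: real measure" ..
  have [measurable]: "f b \<in> borel_measurable borel" if "b \<in> Basis" for b
    using f[OF that] by auto
  have m: "(\<lambda>x::'a. \<Prod>b\<in>Basis. f b (x \<bullet> b)) \<in> borel_measurable borel"
    by (intro borel_measurable_prod) measurable
  have T: "(\<lambda>g. \<Sum>b\<in>Basis. g b *\<^sub>R b) \<in> measurable (\<Pi>\<^sub>M b\<in>(Basis::'a set). lborel :: real measure) borel"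
    by measurable
  have eq: "(\<Prod>b\<in>Basis. f b ((\<Sum>b\<in>Basis. g b *\<^sub>R b) \<bullet> b)) = (\<Prod>b\<in>(Basis::'a set). f b (g b))" for g
    by (intro prod.cong) simp_all
  show "integrable lborel (\<lambda>x::'a. \<Prod>b\<in>Basis. f b (x \<bullet> b))"
    by (subst lborel_eq, subst integrable_distr_eq[OF T m]) (simp only: eq product_integrable_prod finite_Basis f)
  show "(LINT x|lborel. (\<Prod>b\<in>(Basis::'a set). f b (x \<bullet> b))) = (\<Prod>b\<in>Basis. LINT t|lborel. f b t)"
    by (subst lborel_eq, subst integral_distr[OF T m]) (simp only: eq product_integral_prod finite_Basis f)
qed

lemma
  fixes f :: "'a::euclidean_space \<Rightarrow> 'b::{banach,second_countable_topology}"
  assumes "c \<noteq> 0"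
  shows integrable_lborel_affine: "integrable lborel f \<Longrightarrow> integrable lborel (\<lambda>x. f (t + c *\<^sub>R x))"
    and integral_lborel_affine: "f \<in> borel_measurable borel \<Longrightarrow>
      (LINT x|lborel. f x) = \<bar>c\<bar> ^ DIM('a) *\<^sub>R (LINT x|lborel. f (t + c *\<^sub>R x))"
proof -
  have T: "(\<lambda>x::'a. t + c *\<^sub>R x) \<in> measurable lborel borel" by measurable
  have eq: "lborel = density (distr lborel borel (\<lambda>x::'a. t + c *\<^sub>R x)) (\<lambda>_. ennreal (\<bar>c\<bar> ^ DIM('a)))"
    using lborel_affine[OF assms, of t] by (simp add: ennreal_power)
  show "integrable lborel (\<lambda>x. f (t + c *\<^sub>R x))" if f: "integrable lborel f"
  proof -
    have [measurable]: "f \<in> borel_measurable borel" using f by auto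
    have "integrable (density (distr lborel borel (\<lambda>x::'a. t + c *\<^sub>R x)) (\<lambda>_. ennreal (\<bar>c\<bar> ^ DIM('a)))) f"
      using f eq by simp
    then have "integrable (distr lborel borel (\<lambda>x::'a. t + c *\<^sub>R x)) (\<lambda>x. (\<bar>c\<bar> ^ DIM('a)) *\<^sub>R f x)"
      by (subst (asm) integrable_density) auto
    then have "integrable lborel (\<lambda>x. (\<bar>c\<bar> ^ DIM('a)) *\<^sub>R f (t + c *\<^sub>R x))"
      by (subst (asm) integrable_distr_eq[OF T]) auto
    from integrable_scaleR_right[OF this, of "1 / \<bar>c\<bar> ^ DIM('a)"] show ?thesis using assms by simp
  qed
  assume [measurable]: "f \<in> borel_measurable borel"
  have "(LINT x|lborel. f x) = (LINT x|density (distr lborel borel (\<lambda>x::'a. t + c *\<^sub>R x)) (\<lambda>_. ennreal (\<bar>c\<bar> ^ DIM('a))). f x)"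
    by (subst eq) (rule refl)
  also have "\<dots> = (LINT x|distr lborel borel (\<lambda>x::'a. t + c *\<^sub>R x). (\<bar>c\<bar> ^ DIM('a)) *\<^sub>R f x)"
    by (subst integral_density) auto
  also have "\<dots> = (LINT x|lborel. (\<bar>c\<bar> ^ DIM('a)) *\<^sub>R f (t + c *\<^sub>R x))"
    by (subst integral_distr[OF T]) auto
  finally show "(LINT x|lborel. f x) = \<bar>c\<bar> ^ DIM('a) *\<^sub>R (LINT x|lborel. f (t + c *\<^sub>R x))" by simp
qed

text \<open>The sets over which \<open>f\<close> integrates to zero form a Dynkin system containing the boxes.\<close>

lemma AE_zero_of_box_integrals:
  fixes f :: "'a::euclidean_space \<Rightarrow> complex"
  assumes f: "integrable lborel f" and box: "\<And>a b. (LINT x:box a b|lborel. f x) = 0"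
  shows "AE x in lborel. f x = 0"
proof -
  have si: "set_integrable lborel A f" if "A \<in> sets borel" for A
    using f that unfolding set_integrable_def by (intro integrable_mult_indicator) auto
  have UN: "(LINT x:(\<Union>i. A i)|lborel. f x) = (\<Sum>i. (LINT x:(A i)|lborel. f x))"
    if "disjoint_family A" "range A \<subseteq> sets borel" for A :: "nat \<Rightarrow> 'a set"
    using that by (intro lebesgue_integral_countable_add si) (auto simp: disjoint_family_on_def)
  have all: "(LINT x|lborel. f x) = 0"
  proof -
    define B :: "nat \<Rightarrow> 'a set" where "B i = box (- (real i *\<^sub>R One)) (real i *\<^sub>R One)" for i
    have "(\<lambda>i. LINT x:B i|lborel. f x) \<longlonglongrightarrow> (LINT x:(\<Union>i. B i)|lborel. f x)"
    proof (rule set_integral_cont_up)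
      show "incseq B"
        by (auto simp: incseq_def B_def mem_box inner_sum_left_Basis intro: le_less_trans less_le_trans)
          (smt (verit) of_nat_mono)+
      show "set_integrable lborel (\<Union> (range B)) f" by (rule si) (auto simp: B_def)
    qed (auto simp: B_def)
    moreover have "(\<Union>i. B i) = UNIV" unfolding B_def by (rule UN_box_eq_UNIV)
    ultimately show ?thesis
      by (simp add: B_def box LIMSEQ_const_iff) (simp add: set_lebesgue_integral_def)
  qed
  have *: "(LINT x:A|lborel. f x) = 0" if A: "A \<in> sets borel" for A
  proof -
    have st: "Int_stable (range (\<lambda>(a, b). box a b :: 'a set))"
      by (auto simp: Int_stable_def box_Int_box)
    have sub: "range (\<lambda>(a, b). box a b :: 'a set) \<subseteq> Pow UNIV" by simp
    have "A \<in> sigma_sets UNIV (range (\<lambda>(a, b). box a b :: 'a set))"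
      using A by (simp add: borel_eq_box)
    with st sub show ?thesis
    proof (induction rule: sigma_sets_induct_disjoint)
      case (basic A) then show ?case by (auto simp: box)
    next
      case empty then show ?case by (simp add: set_lebesgue_integral_def)
    next
      case (compl A)
      then have A: "A \<in> sets borel" by (simp add: borel_eq_box)
      have "(LINT x:A \<union> - A|lborel. f x) = (LINT x:A|lborel. f x) + (LINT x:- A|lborel. f x)"
        using A by (intro set_integral_Un si) auto
      then show ?case using compl all by (simp add: set_lebesgue_integral_def Compl_eq_Diff_UNIV)
    next
      case (union A)
      then have "range A \<subseteq> sets borel" by (simp add: borel_eq_box)
      with union show ?case by (subst UN) auto
    qed
  qed
  have re: "(LINT x:A|lborel. Re (f x)) = 0" "(LINT x:A|lborel. Im (f x)) = 0" if "A \<in> sets lborel" for A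
  proof -
    have A: "integrable lborel (\<lambda>x. indicator A x *\<^sub>R f x)"
      using si[of A] that by (simp add: set_integrable_def)
    show "(LINT x:A|lborel. Re (f x)) = 0" "(LINT x:A|lborel. Im (f x)) = 0"
      using *[of A] that integral_Re[OF A] integral_Im[OF A] by (simp_all add: set_lebesgue_integral_def)
  qed
  have "AE x in lborel. Re (f x) = 0" "AE x in lborel. Im (f x) = 0"
    using f re by (intro density_unique_real; simp add: set_lebesgue_integral_def)+
  then show ?thesis by eventually_elim (simp add: complex_eq_iff)
qed

section \<open>Gaussians\<close>

text \<open>A rescaling of the characteristic function of the standard normal distribution.\<close>

lemma gauss_1d:
  fixes c k :: real assumes c: "c > 0"
  shows "integrable lborel (\<lambda>t. complex_of_real (exp (- c * t\<^sup>2)) * cis (- (t * k)))"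
    and "(LINT t|lborel. complex_of_real (exp (- c * t\<^sup>2)) * cis (- (t * k))) = complex_of_real (sqrt (pi / c) * exp (- k\<^sup>2 / (4 * c)))"
proof -
  define s where "s = sqrt (2 * c)"
  have s: "s > 0" "s\<^sup>2 = 2 * c" using c by (auto simp: s_def)
  define F where "F x = complex_of_real (std_normal_density x) * cis (x * (- k / s))" for x
  have [measurable]: "(\<lambda>x. cis (x * (- k / s))) \<in> borel_measurable borel"
    by (intro borel_measurable_continuous_onI continuous_intros)
  have F_int: "integrable lborel F"
    unfolding F_def
    by (rule Bochner_Integration.integrable_bound[OF integrable_normal_density[where \<mu>=0 and \<sigma>=1]])
      (measurable, auto simp: norm_mult)
  have eq: "complex_of_real (exp (- c * t\<^sup>2)) * cis (- (t * k)) = complex_of_real (sqrt (2 * pi)) * F (0 + s * t)" for t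
    using s c by (simp add: F_def std_normal_density_def power_mult_distrib)
  have "(LINT x|lborel. F x) = char std_normal_distribution (- k / s)"
    unfolding char_def F_def
    by (subst integral_density) (auto simp: cis_conv_exp mult_ac scaleR_conv_of_real)
  also have "\<dots> = complex_of_real (exp (- k\<^sup>2 / (4 * c)))"
    using s by (simp add: char_std_normal_distribution power_divide)
  finally have F: "(LINT x|lborel. F x) = complex_of_real (exp (- k\<^sup>2 / (4 * c)))" .
  show "integrable lborel (\<lambda>t. complex_of_real (exp (- c * t\<^sup>2)) * cis (- (t * k)))"
    unfolding eq using s by (intro integrable_mult_right lborel_integrable_real_affine F_int) auto
  have "(LINT x|lborel. F x) = s *\<^sub>R (LINT t|lborel. F (0 + s * t))"
    using lborel_integral_real_affine[of s F 0] s by simp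
  then have "(LINT t|lborel. F (0 + s * t)) = complex_of_real (exp (- k\<^sup>2 / (4 * c)) / s)"
    using s by (simp add: F scaleR_conv_of_real field_simps)
  moreover have "sqrt (2 * pi) / s = sqrt (pi / c)"
    by (simp add: s_def flip: real_sqrt_divide)
  ultimately show "(LINT t|lborel. complex_of_real (exp (- c * t\<^sup>2)) * cis (- (t * k))) = complex_of_real (sqrt (pi / c) * exp (- k\<^sup>2 / (4 * c)))"
    unfolding eq integral_mult_right_zero by (metis (no_types, lifting) of_real_mult times_divide_eq_left times_divide_eq_right)
qed

lemma gauss_integral:
  fixes k :: "'a::euclidean_space" and c :: real assumes c: "c > 0"
  shows "integrable lborel (\<lambda>x. complex_of_real (exp (- c * (norm x)\<^sup>2)) * cis (- (x \<bullet> k)))" (is ?A)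
    and "(LINT x|lborel. complex_of_real (exp (- c * (norm x)\<^sup>2)) * cis (- (x \<bullet> k)))
      = complex_of_real (sqrt (pi / c) ^ DIM('a) * exp (- (norm k)\<^sup>2 / (4 * c)))" (is ?B)
proof -
  have norm2: "(norm x)\<^sup>2 = (\<Sum>b\<in>Basis. (x \<bullet> b)\<^sup>2)" for x :: 'a
    unfolding power2_norm_eq_inner by (subst euclidean_inner) (simp add: power2_eq_square)
  have cis_sum: "cis (\<Sum>b\<in>B. g b) = (\<Prod>b\<in>B. cis (g b))" if "finite B" for B :: "'a set" and g
    using that by induction (auto simp: cis_mult[symmetric])
  have eq: "complex_of_real (exp (- c * (norm x)\<^sup>2)) * cis (- (x \<bullet> k))
      = (\<Prod>b\<in>Basis. complex_of_real (exp (- c * (x \<bullet> b)\<^sup>2)) * cis (- ((x \<bullet> b) * (k \<bullet> b))))" for x :: 'a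
    by (subst euclidean_inner)
      (simp add: norm2 sum_distrib_left exp_sum prod.distrib cis_sum flip: sum_negf)
  show ?A unfolding eq by (intro integrable_lborel_prod gauss_1d c)
  have "(LINT x|lborel. complex_of_real (exp (- c * (norm x)\<^sup>2)) * cis (- (x \<bullet> k)))
      = (\<Prod>b\<in>Basis. complex_of_real (sqrt (pi / c) * exp (- (k \<bullet> b)\<^sup>2 / (4 * c))))"
    unfolding eq by (subst integral_lborel_prod, rule gauss_1d(1)[OF c]) (simp only: gauss_1d(2)[OF c])
  also have "\<dots> = complex_of_real (sqrt (pi / c) ^ DIM('a) * exp (- (norm k)\<^sup>2 / (4 * c)))"
    by (simp add: prod.distrib norm2 sum_divide_distrib exp_sum sum_negf[symmetric] flip: of_real_prod)
  finally show ?B .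
qed

lemma gauss_real_integral:
  fixes c :: real assumes c: "c > 0"
  shows "integrable lborel (\<lambda>x::'a::euclidean_space. exp (- c * (norm x)\<^sup>2))"
    and "(LINT x|lborel. exp (- c * (norm (x::'a))\<^sup>2)) = sqrt (pi / c) ^ DIM('a)"
proof -
  show *: "integrable lborel (\<lambda>x::'a. exp (- c * (norm x)\<^sup>2))"
    using integrable_norm[OF gauss_integral(1)[OF c, of 0]] by (simp add: norm_mult)
  have "complex_of_real (LINT x|lborel. exp (- c * (norm (x::'a))\<^sup>2)) = complex_of_real (sqrt (pi / c) ^ DIM('a))"
    using gauss_integral(2)[OF c, of "0::'a"] by (simp del: of_real_exp)
  then show "(LINT x|lborel. exp (- c * (norm (x::'a))\<^sup>2)) = sqrt (pi / c) ^ DIM('a)"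
    by (simp only: of_real_eq_iff)
qed

definition bump :: "real \<Rightarrow> 'a::euclidean_space \<Rightarrow> 'a \<Rightarrow> complex" where
  "bump c y x = complex_of_real (exp (- c * (norm (x - y))\<^sup>2))"

lemma bump_measurable [measurable]: "bump c y \<in> borel_measurable borel"
  unfolding bump_def by measurable

lemma bump_integrable: "c > 0 \<Longrightarrow> integrable lborel (bump c y)"
  using integrable_of_real[OF integrable_lborel_affine[OF _ gauss_real_integral(1), of 1 c "- y"], where 'a=complex]
  by (simp add: bump_def[abs_def] del: of_real_exp)

text \<open>Completing the square: a product of Gaussians is a multiple of a Gaussian centred between them.\<close>

lemma bump_mult:
  assumes "c > 0" "e > 0"
  shows "bump c y x * bump e z x =
    complex_of_real (exp (- (c * e / (c + e)) * (norm (y - z))\<^sup>2)) * bump (c + e) ((c / (c + e)) *\<^sub>R y + (e / (c + e)) *\<^sub>R z) x"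
proof -
  have "c * (norm (x - y))\<^sup>2 + e * (norm (x - z))\<^sup>2 = (c * e / (c + e)) * (norm (y - z))\<^sup>2
      + (c + e) * (norm (x - ((c / (c + e)) *\<^sub>R y + (e / (c + e)) *\<^sub>R z)))\<^sup>2"
  proof -
    define \<alpha> \<beta> where "\<alpha> = c / (c + e)" and "\<beta> = e / (c + e)"
    have ab: "c = \<alpha> * (c + e)" "e = \<beta> * (c + e)" "\<alpha> + \<beta> = 1" "c * e / (c + e) = \<alpha> * \<beta> * (c + e)"
      using assms by (auto simp: \<alpha>_def \<beta>_def add_divide_distrib[symmetric])
    have b: "\<beta> = 1 - \<alpha>" using ab by simp
    define r where "r = c + e"
    have "\<alpha> * r * (norm (x - y))\<^sup>2 + \<beta> * r * (norm (x - z))\<^sup>2 = (\<alpha> * \<beta> * r) * (norm (y - z))\<^sup>2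
      + r * (norm (x - (\<alpha> *\<^sub>R y + \<beta> *\<^sub>R z)))\<^sup>2"
      unfolding b power2_norm_eq_inner
      by (simp add: inner_simps inner_commute algebra_simps power2_eq_square)
    then show ?thesis using ab unfolding \<alpha>_def[symmetric] \<beta>_def[symmetric] r_def by metis
  qed
  then show ?thesis
    unfolding bump_def of_real_mult[symmetric] exp_add[symmetric]
    by (intro arg_cong[of _ _ "\<lambda>x. complex_of_real (exp x)"]) linarith
qed

lemma bump_L2: "c > 0 \<Longrightarrow> bump c y \<in> L2_space"
proof (rule L2_spaceI)
  assume "c > 0"
  then have "integrable lborel (\<lambda>x. norm (bump (c + c) ((c / (c + c)) *\<^sub>R y + (c / (c + c)) *\<^sub>R y) x))"
    by (intro integrable_norm bump_integrable) simp
  moreover have "(norm (bump c y x))\<^sup>2 = norm (bump (c + c) ((c / (c + c)) *\<^sub>R y + (c / (c + c)) *\<^sub>R y) x)" for x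
    using bump_mult[OF \<open>c > 0\<close> \<open>c > 0\<close>, of y x y] by (simp add: power2_eq_square flip: norm_mult)
  ultimately show "integrable lborel (\<lambda>x. (norm (bump c y x))\<^sup>2)" by simp
qed measurable


text \<open>The weighted function \<open>H = F * bump 1 0\<close> is integrable and is again orthogonal to all Gaussians,
  since a product of Gaussians is a multiple of a Gaussian. So the integral of \<open>H\<close> against the
  indicator of a box, smeared out by a Gaussian of width \<open>1/n\<close>, is zero, and dominated convergence
  carries this over to the box itself. Only the weighted function is assumed integrable, so that \<open>F\<close> may
  also be a bounded function or grow polynomially.\<close>

lemma AE_zero_of_bump_integrals:
  fixes F :: "'a::euclidean_space \<Rightarrow> complex"
  assumes int: "integrable lborel (\<lambda>x. F x * bump 1 0 x)"
    and zero: "\<And>c y. c > 0 \<Longrightarrow> (LINT x|lborel. F x * bump c y x) = 0"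
  shows "AE x in lborel. F x = 0"
proof -
  define H where "H x = F x * bump 1 0 x" for x
  have [measurable]: "H \<in> borel_measurable borel" and H: "integrable lborel H"
    using int by (auto simp: H_def[abs_def])
  have zeroH: "(LINT x|lborel. H x * bump c y x) = 0" if "c > 0" for c y
  proof -
    have "H x * bump c y x = complex_of_real (exp (- (1 * c / (1 + c)) * (norm (0 - y))\<^sup>2))
         * (F x * bump (1 + c) ((1 / (1 + c)) *\<^sub>R 0 + (c / (1 + c)) *\<^sub>R y) x)" for x
      using bump_mult[of 1 c 0 x y] that by (simp add: H_def mult_ac)
    then show ?thesis using zero[of "1 + c"] that by simp
  qed
  have "(LINT x:box a b|lborel. H x) = 0" for a b :: 'a
  proof -
    define I where "I = (LINT z|lborel. bump 1 0 (z::'a))"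
    have I: "I \<noteq> 0"
      using gauss_real_integral(2)[of 1, where 'a='a] unfolding I_def bump_def
      by (simp del: of_real_exp)
    define \<psi> :: "'a \<Rightarrow> complex" where "\<psi> = (\<lambda>x. indicator (box a b) x)"
    have [measurable]: "\<psi> \<in> borel_measurable borel" unfolding \<psi>_def by measurable
    have \<psi>1: "norm (\<psi> x) \<le> 1" for x by (auto simp: \<psi>_def indicator_def)
    define \<psi>n where "\<psi>n n x = (LINT z|lborel. \<psi> (x + (1 / real (Suc n)) *\<^sub>R z) * bump 1 0 z)" for n x
    have bnd: "norm (\<psi>n n x) \<le> (LINT z|lborel. norm (bump 1 0 (z::'a)))" for n x
      unfolding \<psi>n_def
      by (rule order_trans[OF integral_norm_bound integral_mono'])
        (auto simp: norm_mult bump_integrable intro!: mult_left_le_one_le \<psi>1 integrable_norm)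
    have ker: "\<psi>n n x = complex_of_real (real (Suc n) ^ DIM('a)) * (LINT y|lborel. \<psi> y * bump ((real (Suc n))\<^sup>2) y x)" for n x
    proof -
      have scale: "bump ((real (Suc n))\<^sup>2) (x + (1 / real (Suc n)) *\<^sub>R z) x = bump 1 0 z" for z
        by (simp add: bump_def power_mult_distrib power_divide del: of_nat_Suc)
      have "(LINT y|lborel. \<psi> y * bump ((real (Suc n))\<^sup>2) y x)
        = \<bar>1 / real (Suc n)\<bar> ^ DIM('a) *\<^sub>R (LINT z|lborel. \<psi> (x + (1 / real (Suc n)) *\<^sub>R z) * bump ((real (Suc n))\<^sup>2) (x + (1 / real (Suc n)) *\<^sub>R z) x)"
        by (rule integral_lborel_affine) (auto simp: bump_def)
      then show ?thesis
        unfolding scale by (simp add: \<psi>n_def scaleR_conv_of_real power_divide del: of_nat_Suc)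
    qed
    have [measurable]: "\<psi>n n \<in> borel_measurable borel" for n
      unfolding \<psi>n_def by (rule lborel.borel_measurable_lebesgue_integral) measurable
    have 0: "(LINT x|lborel. H x * \<psi>n n x) = 0" for n
    proof -
      define N where "N = (real (Suc n))\<^sup>2"
      have N: "N > 0" by (simp add: N_def)
      have "(LINT x|lborel. H x * (LINT y|lborel. \<psi> y * bump N y x))
          = (LINT x|lborel. (LINT y|lborel. H x * (\<psi> y * bump N y x)))"
        by simp
      also have "\<dots> = (LINT y|lborel. (LINT x|lborel. H x * (\<psi> y * bump N y x)))"
      proof (rule lborel_pair.Fubini_integral[symmetric])
        have 1: "integrable (lborel \<Otimes>\<^sub>M lborel) (\<lambda>(x, y). H x * \<psi> y)"
        proof (rule lborel_pair.Fubini_integrable)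
          have \<psi>_int: "integrable lborel \<psi>"
          proof (rule Bochner_Integration.integrable_bound)
            show "integrable lborel (indicat_real (box a b))"
              by (rule integrable_real_indicator) (auto simp: emeasure_lborel_box_eq)
          qed (auto simp: \<psi>_def indicator_def)
          show "integrable lborel (\<lambda>x. LINT y|lborel. norm (case (x, y) of (x, y) \<Rightarrow> H x * \<psi> y))"
            using H by (simp add: norm_mult)
          show "AE x in lborel. integrable lborel (\<lambda>y. case (x, y) of (x, y) \<Rightarrow> H x * \<psi> y)"
            using \<psi>_int by simp
        qed measurable
        show "integrable (lborel \<Otimes>\<^sub>M lborel) (\<lambda>(y, x). H y * (\<psi> x * bump N x y))"
          using N by (intro Bochner_Integration.integrable_bound[OF 1])
            (auto simp: norm_mult bump_def split_beta' intro!: mult_left_le mult_left_mono)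
      qed
      also have "\<dots> = (LINT y|lborel. \<psi> y * (LINT x|lborel. H x * bump N y x))"
        by (simp add: mult.left_commute[of "H _"])
      also have "\<dots> = 0" by (simp add: zeroH N)
      finally show ?thesis
        by (simp add: ker N_def mult.left_commute[of "H _"])
    qed
    have lim: "AE x in lborel. (\<lambda>n. \<psi>n n x) \<longlonglongrightarrow> \<psi> x * I"
    proof -
      \<comment> \<open>on the boundary of the box the smeared indicators need not converge to the indicator\<close>
      have "AE x in lborel. x \<notin> cbox a b - box a b"
        by (intro AE_not_in) (auto simp: null_sets_def emeasure_lborel_cbox_eq emeasure_lborel_box_eq
          emeasure_Diff box_subset_cbox)
      then show ?thesis
      proof eventually_elim
        case (elim x)
        have "(\<lambda>n. LINT z|lborel. \<psi> (x + (1 / real (Suc n)) *\<^sub>R z) * bump 1 0 z) \<longlonglongrightarrow> (LINT z|lborel. \<psi> x * bump 1 0 (z::'a))"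
        proof (rule integral_dominated_convergence)
          show "integrable lborel (\<lambda>z::'a. norm (bump 1 0 z))" by (intro integrable_norm bump_integrable) simp
          show "AE z in lborel. (\<lambda>n. \<psi> (x + (1 / real (Suc n)) *\<^sub>R z) * bump 1 0 z) \<longlonglongrightarrow> \<psi> x * bump 1 0 z"
          proof (rule AE_I2, rule tendsto_mult_right)
            fix z :: 'a
            have "(\<lambda>n. x + (1 / real (Suc n)) *\<^sub>R z) \<longlonglongrightarrow> x + 0 *\<^sub>R z"
              using LIMSEQ_inverse_real_of_nat by (intro tendsto_intros) (simp add: inverse_eq_divide)
            then have lim: "(\<lambda>n. x + (1 / real (Suc n)) *\<^sub>R z) \<longlonglongrightarrow> x" by simp
            have "open (box a b)" "open (- cbox a b)" by auto
            then have "\<forall>\<^sub>F n in sequentially. \<psi> (x + (1 / real (Suc n)) *\<^sub>R z) = \<psi> x"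
            proof (cases "x \<in> box a b")
              case True
              then have "\<forall>\<^sub>F n in sequentially. x + (1 / real (Suc n)) *\<^sub>R z \<in> box a b"
                by (intro topological_tendstoD[OF lim]) auto
              then show ?thesis by eventually_elim (use True in \<open>simp add: \<psi>_def\<close>)
            next
              case False
              then have "\<forall>\<^sub>F n in sequentially. x + (1 / real (Suc n)) *\<^sub>R z \<in> - cbox a b"
                using elim by (intro topological_tendstoD[OF lim]) auto
              then show ?thesis
                by eventually_elim (use False box_subset_cbox[of a b] in \<open>auto simp: \<psi>_def indicator_def\<close>)
            qed
            then show "(\<lambda>n. \<psi> (x + (1 / real (Suc n)) *\<^sub>R z)) \<longlonglongrightarrow> \<psi> x"
              by (rule tendsto_eventually)
          qed
          show "AE z in lborel. norm (\<psi> (x + (1 / real (Suc n)) *\<^sub>R z) * bump 1 0 z) \<le> norm (bump 1 0 z)" for n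
            by (auto simp: norm_mult intro!: mult_left_le_one_le \<psi>1)
        qed auto
        then show ?case by (simp add: \<psi>n_def I_def)
      qed
    qed
    have "(\<lambda>n. LINT x|lborel. H x * \<psi>n n x) \<longlonglongrightarrow> (LINT x|lborel. H x * (\<psi> x * I))"
    proof (rule integral_dominated_convergence)
      show "integrable lborel (\<lambda>x. norm (H x) * (LINT z|lborel. norm (bump 1 0 (z::'a))))"
        using H by simp
      show "AE x in lborel. (\<lambda>n. H x * \<psi>n n x) \<longlonglongrightarrow> H x * (\<psi> x * I)"
        using lim by eventually_elim (intro tendsto_intros)
      show "AE x in lborel. norm (H x * \<psi>n n x) \<le> norm (H x) * (LINT z|lborel. norm (bump 1 0 (z::'a)))" for n
        by (auto simp: norm_mult intro!: mult_left_mono bnd)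
    qed auto
    then have "(LINT x|lborel. H x * \<psi> x) * I = 0"
      unfolding 0 by (simp add: LIMSEQ_const_iff flip: mult.assoc)
    then have "(LINT x|lborel. H x * \<psi> x) = 0" using I by simp
    then show ?thesis
      unfolding set_lebesgue_integral_def \<psi>_def
      by (subst (asm) Bochner_Integration.integral_cong[OF refl, where g="\<lambda>x. indicat_real (box a b) x *\<^sub>R H x"])
        (auto simp: indicator_def)
  qed
  then have "AE x in lborel. H x = 0" by (rule AE_zero_of_box_integrals[OF H])
  then show ?thesis by eventually_elim (simp add: H_def bump_def)
qed

section \<open>Schwartz functions\<close>

lemma partials_Cons: "partials (v # vs) f = partial v (partials vs f)"
  by (simp add: partials_def)

lemma partials_Nil [simp]: "partials [] f = f"
  by (simp add: partials_def)

lemma partial_eq: "(f has_derivative f') (at x) \<Longrightarrow> partial v f x = f' v"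
  by (simp add: partial_def flip: frechet_derivative_at)

text \<open>Partial derivatives of a polynomial times an exponential of a quadratic are of the same form, which
  is what the induction over iterated partial derivatives needs.\<close>

inductive poly_fun :: "('a::euclidean_space \<Rightarrow> complex) \<Rightarrow> bool" where
  poly_const: "poly_fun (\<lambda>x. c)"
| poly_coord: "poly_fun (\<lambda>x. complex_of_real (x \<bullet> v))"
| poly_add: "poly_fun p \<Longrightarrow> poly_fun q \<Longrightarrow> poly_fun (\<lambda>x. p x + q x)"
| poly_mult: "poly_fun p \<Longrightarrow> poly_fun q \<Longrightarrow> poly_fun (\<lambda>x. p x * q x)"

lemma poly_fun_derivative:
  "poly_fun p \<Longrightarrow> \<exists>P. (\<forall>x. (p has_derivative (\<lambda>v. P v x)) (at x)) \<and> (\<forall>v. poly_fun (P v))"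
proof (induction rule: poly_fun.induct)
  case (poly_const c)
  show ?case by (intro exI[of _ "\<lambda>v x. 0"]) (auto intro: poly_fun.intros)
next
  case (poly_coord v)
  show ?case
    by (intro exI[of _ "\<lambda>w x. complex_of_real (w \<bullet> v)"]) (auto intro!: poly_fun.intros derivative_eq_intros)
next
  case (poly_add p q)
  then obtain P Q where P: "\<And>x. (p has_derivative (\<lambda>v. P v x)) (at x)" "\<And>v. poly_fun (P v)"
    and Q: "\<And>x. (q has_derivative (\<lambda>v. Q v x)) (at x)" "\<And>v. poly_fun (Q v)" by blast
  then show ?case
    by (intro exI[of _ "\<lambda>v x. P v x + Q v x"]) (auto intro!: poly_fun.intros has_derivative_add)
next
  case (poly_mult p q)
  then obtain P Q where P: "\<And>x. (p has_derivative (\<lambda>v. P v x)) (at x)" "\<And>v. poly_fun (P v)"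
    and Q: "\<And>x. (q has_derivative (\<lambda>v. Q v x)) (at x)" "\<And>v. poly_fun (Q v)" by blast
  then show ?case using poly_mult
    by (intro exI[of _ "\<lambda>v x. p x * Q v x + P v x * q x"]) (auto intro!: poly_fun.intros has_derivative_mult)
qed

lemma poly_fun_bound: "poly_fun p \<Longrightarrow> \<exists>C k. C \<ge> 0 \<and> (\<forall>x. norm (p x) \<le> C * (1 + norm x) ^ k)"
proof (induction rule: poly_fun.induct)
  case (poly_const c)
  show ?case by (intro exI[of _ "norm c"] exI[of _ 0]) auto
next
  case (poly_coord v)
  have "\<bar>x \<bullet> v\<bar> \<le> norm v * (1 + norm x)" for x :: 'a
    using Cauchy_Schwarz_ineq2[of x v] by (auto simp: algebra_simps intro: order_trans)
  then show ?case by (intro exI[of _ "norm v"] exI[of _ 1]) auto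
next
  case (poly_add p q)
  then obtain C k D l where C: "C \<ge> 0" "\<And>x. norm (p x) \<le> C * (1 + norm x) ^ k"
    and D: "D \<ge> 0" "\<And>x. norm (q x) \<le> D * (1 + norm x) ^ l" by blast
  have "norm (p x + q x) \<le> (C + D) * (1 + norm x) ^ (k + l)" for x
  proof -
    have "norm (p x + q x) \<le> C * (1 + norm x) ^ k + D * (1 + norm x) ^ l"
      using C(2)[of x] D(2)[of x] norm_triangle_ineq[of "p x" "q x"] by linarith
    also have "\<dots> \<le> C * (1 + norm x) ^ (k + l) + D * (1 + norm x) ^ (k + l)"
      using C(1) D(1) by (intro add_mono mult_left_mono power_increasing) auto
    finally show ?thesis by (simp add: ring_distribs)
  qed
  then show ?case using C D by (intro exI[of _ "C + D"] exI[of _ "k + l"]) auto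
next
  case (poly_mult p q)
  then obtain C k D l where C: "C \<ge> 0" "\<And>x. norm (p x) \<le> C * (1 + norm x) ^ k"
    and D: "D \<ge> 0" "\<And>x. norm (q x) \<le> D * (1 + norm x) ^ l" by blast
  have "norm (p x * q x) \<le> (C * D) * (1 + norm x) ^ (k + l)" for x
    using mult_mono[OF C(2)[of x] D(2)[of x]] C(1) by (simp add: norm_mult power_add mult_ac)
  then show ?case using C D by (intro exI[of _ "C * D"] exI[of _ "k + l"]) auto
qed

text \<open>The linear terms in the exponent cover at once the translates of a Gaussian (\<open>y\<close>) and its
  modulations (\<open>z\<close>).\<close>

definition gauss :: "real \<Rightarrow> 'a::euclidean_space \<Rightarrow> 'a \<Rightarrow> 'a \<Rightarrow> complex" where
  "gauss c y z x = exp (complex_of_real (x \<bullet> y - c * (x \<bullet> x)) + \<i> * complex_of_real (x \<bullet> z))"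

lemma gauss_has_derivative:
  "(gauss c y z has_derivative
    (\<lambda>v. (complex_of_real (v \<bullet> y) + complex_of_real (- 2 * c) * complex_of_real (x \<bullet> v) + \<i> * complex_of_real (v \<bullet> z)) * gauss c y z x)) (at x)"
proof -
  define E where "E x = complex_of_real (x \<bullet> y - c * (x \<bullet> x)) + \<i> * complex_of_real (x \<bullet> z)" for x
  have "(E has_derivative (\<lambda>v. complex_of_real (v \<bullet> y) + complex_of_real (- 2 * c) * complex_of_real (x \<bullet> v) + \<i> * complex_of_real (v \<bullet> z))) (at x)"
    unfolding E_def by (auto intro!: derivative_eq_intros simp: inner_commute algebra_simps)
  moreover have "(exp has_derivative (\<lambda>h. exp (E x) * h)) (at (E x))"
    using DERIV_exp[of "E x"] by (simp add: has_field_derivative_def)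
  ultimately have "(exp \<circ> E has_derivative ((\<lambda>h. exp (E x) * h) \<circ> (\<lambda>v. complex_of_real (v \<bullet> y) + complex_of_real (- 2 * c) * complex_of_real (x \<bullet> v) + \<i> * complex_of_real (v \<bullet> z)))) (at x)"
    by (rule diff_chain_at)
  moreover have "gauss c y z = exp \<circ> E" by (simp add: fun_eq_iff gauss_def E_def)
  ultimately show ?thesis by (simp add: o_def mult.commute)
qed

lemma partials_poly_gauss:
  assumes "poly_fun p"
  shows "\<exists>q. poly_fun q \<and> partials vs (\<lambda>x. p x * gauss c y z x) = (\<lambda>x. q x * gauss c y z x)"
proof (induction vs)
  case Nil
  show ?case using assms by auto
next
  case (Cons v vs)
  then obtain q where q: "poly_fun q" "partials vs (\<lambda>x. p x * gauss c y z x) = (\<lambda>x. q x * gauss c y z x)"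
    by blast
  obtain Q where Q: "\<And>x. (q has_derivative (\<lambda>v. Q v x)) (at x)" "\<And>v. poly_fun (Q v)"
    using poly_fun_derivative[OF q(1)] by blast
  define r where "r x = q x * (complex_of_real (v \<bullet> y) + complex_of_real (- 2 * c) * complex_of_real (x \<bullet> v) + \<i> * complex_of_real (v \<bullet> z)) + Q v x" for x
  have "poly_fun r" unfolding r_def by (intro poly_fun.intros q Q)
  moreover have "partials (v # vs) (\<lambda>x. p x * gauss c y z x) = (\<lambda>x. r x * gauss c y z x)"
    unfolding partials_Cons q(2)
    by (rule ext, subst partial_eq[OF has_derivative_mult[OF Q(1) gauss_has_derivative]])
      (simp add: r_def algebra_simps)
  ultimately show ?case by blast
qed

text \<open>By \<open>1 + r \<le> exp r\<close> every power of the norm is absorbed into an exponential of the norm, and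
  \<open>a r - c r\<^sup>2 \<le> a\<^sup>2 / (4 c)\<close> bounds what remains.\<close>

lemma poly_gauss_schwartz:
  assumes c: "c > 0" and p: "poly_fun p" shows "(\<lambda>x. p x * gauss c y z x) \<in> schwartz"
proof -
  have P: "\<exists>q. poly_fun q \<and> partials vs (\<lambda>x. p x * gauss c y z x) = (\<lambda>x. q x * gauss c y z x)" for vs
    by (rule partials_poly_gauss[OF p])
  have "smooth (\<lambda>x. p x * gauss c y z x)"
    unfolding smooth_def
  proof
    fix vs
    obtain q where q: "poly_fun q" "partials vs (\<lambda>x. p x * gauss c y z x) = (\<lambda>x. q x * gauss c y z x)" using P by blast
    then show "partials vs (\<lambda>x. p x * gauss c y z x) differentiable_on UNIV"
      using poly_fun_derivative[OF q(1)] gauss_has_derivative[of c y z]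
      by (auto simp: differentiable_on_def intro!: differentiable_mult) (auto simp: differentiable_def)
  qed
  moreover have "\<exists>C. \<forall>x. norm x ^ k * norm (partials vs (\<lambda>x. p x * gauss c y z x) x) \<le> C" for vs k
  proof -
    obtain q where q: "poly_fun q" "partials vs (\<lambda>x. p x * gauss c y z x) = (\<lambda>x. q x * gauss c y z x)" using P by blast
    obtain C l where C: "C \<ge> 0" "\<And>x. norm (q x) \<le> C * (1 + norm x) ^ l" using poly_fun_bound[OF q(1)] by blast
    define a where "a = real (k + l) + norm y"
    have "norm x ^ k * norm (q x * gauss c y z x) \<le> C * exp (a\<^sup>2 / (4 * c))" for x
    proof -
      have g: "norm (gauss c y z x) \<le> exp (norm x * norm y - c * (norm x)\<^sup>2)"
        using norm_cauchy_schwarz[of x y] by (simp add: gauss_def power2_norm_eq_inner)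
      have e: "norm x \<le> exp (norm x)" "1 + norm x \<le> exp (norm x)"
        using exp_ge_add_one_self[of "norm x"] by linarith+
      have e1: "norm x ^ k \<le> exp (norm x) ^ k" by (rule power_mono[OF e(1)]) simp
      have "norm (q x) \<le> C * exp (norm x) ^ l"
        using C e by (intro order_trans[OF C(2) mult_left_mono] power_mono) auto
      from mult_mono[OF e1 mult_mono[OF this g]]
      have "norm x ^ k * (norm (q x) * norm (gauss c y z x))
          \<le> exp (norm x) ^ k * ((C * exp (norm x) ^ l) * exp (norm x * norm y - c * (norm x)\<^sup>2))"
        using C(1) by simp
      also have "\<dots> = C * exp (a * norm x - c * (norm x)\<^sup>2)"
        by (simp add: a_def exp_diff exp_add ring_distribs mult_ac flip: exp_of_nat_mult)
      also have "a * norm x - c * (norm x)\<^sup>2 \<le> a\<^sup>2 / (4 * c)"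
      proof -
        have "4 * c * (a * norm x - c * (norm x)\<^sup>2) = a\<^sup>2 - (a - 2 * c * norm x)\<^sup>2"
          by (simp add: power2_eq_square algebra_simps)
        then have "4 * c * (a * norm x - c * (norm x)\<^sup>2) \<le> a\<^sup>2" by simp
        then show ?thesis using c by (simp add: pos_le_divide_eq mult.commute)
      qed
      finally show ?thesis using C(1) by (simp add: norm_mult mult_left_mono)
    qed
    then show ?thesis unfolding q(2) by blast
  qed
  ultimately show ?thesis by (simp add: schwartz_def)
qed

lemma gauss_schwartz: "c > 0 \<Longrightarrow> gauss c y z \<in> schwartz"
  using poly_gauss_schwartz[OF _ poly_const[of 1]] by simp

lemma bump_schwartz: "c > 0 \<Longrightarrow> bump c y \<in> schwartz"
proof -
  assume c: "c > 0"
  have "bump c y x = complex_of_real (exp (- c * (y \<bullet> y))) * gauss c ((2 * c) *\<^sub>R y) 0 x" for x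
  proof -
    have "- c * (norm (x - y))\<^sup>2 = - c * (y \<bullet> y) + (x \<bullet> ((2 * c) *\<^sub>R y) - c * (x \<bullet> x))"
      unfolding power2_norm_eq_inner by (simp add: inner_simps inner_commute algebra_simps)
    then show ?thesis by (simp only: bump_def gauss_def exp_add exp_of_real) simp
  qed
  then have "bump c y = (\<lambda>x. complex_of_real (exp (- c * (y \<bullet> y))) * gauss c ((2 * c) *\<^sub>R y) 0 x)" by (rule ext)
  then show ?thesis using poly_gauss_schwartz[OF c poly_const] by metis
qed

lemma schwartz_measurable: "\<phi> \<in> schwartz \<Longrightarrow> \<phi> \<in> borel_measurable borel"
proof -
  assume "\<phi> \<in> schwartz"
  then have "partials [] \<phi> differentiable_on UNIV" unfolding schwartz_def smooth_def by blast
  then show ?thesis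
    by (intro borel_measurable_continuous_onI) (simp add: differentiable_imp_continuous_on)
qed

text \<open>Decay of order \<open>2 DIM('a)\<close> beyond the growth of the weight suffices for a comparison with the
  integrable product of the functions \<open>1 / (1 + x\<^sub>b\<^sup>2)\<close> of the single coordinates.\<close>

lemma schwartz_weight:
  fixes \<phi> :: "'a::euclidean_space \<Rightarrow> complex"
  assumes \<phi>: "\<phi> \<in> schwartz" and w: "w \<in> borel_measurable borel" "\<And>x. norm (w x) \<le> (1 + norm x) ^ n"
  shows "integrable lborel (\<lambda>x. w x * \<phi> x)" "(\<lambda>x. w x * \<phi> x) \<in> L2_space"
proof -
  have B: "\<exists>C. \<forall>x. (1 + norm x) ^ k * norm (\<phi> x) \<le> C" for k
  proof -
    obtain C D where C: "\<And>x. norm x ^ 0 * norm (partials [] \<phi> x) \<le> C" "\<And>x. norm x ^ k * norm (partials [] \<phi> x) \<le> D"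
      using \<phi> unfolding schwartz_def by blast
    have "(1 + norm x) ^ k * norm (\<phi> x) \<le> 2 ^ k * (C + D)" for x
    proof -
      have "(1 + norm x) ^ k \<le> 2 ^ k * (1 + norm x ^ k)"
      proof (cases "norm x \<le> 1")
        case True
        then have "(1 + norm x) ^ k \<le> 2 ^ k * 1" by (simp add: power_mono)
        also have "\<dots> \<le> 2 ^ k * (1 + norm x ^ k)" by (intro mult_left_mono) auto
        finally show ?thesis .
      next
        case False
        then have "(1 + norm x) ^ k \<le> (2 * norm x) ^ k" by (intro power_mono) auto
        also have "\<dots> \<le> 2 ^ k * (1 + norm x ^ k)" by (simp add: power_mult_distrib)
        finally show ?thesis .
      qed
      then have "(1 + norm x) ^ k * norm (\<phi> x) \<le> (2 ^ k * (1 + norm x ^ k)) * norm (\<phi> x)"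
        by (intro mult_right_mono) auto
      also have "\<dots> = 2 ^ k * (norm (\<phi> x) + norm x ^ k * norm (\<phi> x))" by (simp add: algebra_simps)
      also have "\<dots> \<le> 2 ^ k * (C + D)" using C[of x] by (intro mult_left_mono add_mono) auto
      finally show ?thesis .
    qed
    then show ?thesis by blast
  qed
  obtain C where C: "\<And>x. (1 + norm x) ^ (2 * DIM('a) + n) * norm (\<phi> x) \<le> C" using B by blast
  obtain K where K: "\<And>x. (1 + norm x) ^ n * norm (\<phi> x) \<le> K" using B by blast
  have [measurable]: "\<phi> \<in> borel_measurable borel" "w \<in> borel_measurable borel"
    using schwartz_measurable[OF \<phi>] w by auto
  have 1: "integrable lborel (\<lambda>t::real. inverse (1 + t\<^sup>2))"
    using integrable_inverse_1_plus_square by (simp add: set_integrable_def)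
  have D: "norm (w x * \<phi> x) \<le> C * (\<Prod>b\<in>Basis. inverse (1 + (x \<bullet> b)\<^sup>2))" for x
  proof -
    have "(\<Prod>b\<in>Basis. 1 + (x \<bullet> b)\<^sup>2) \<le> (\<Prod>b\<in>(Basis::'a set). (1 + norm x)\<^sup>2)"
    proof (intro prod_mono conjI)
      fix b :: 'a assume "b \<in> Basis"
      then have "(x \<bullet> b)\<^sup>2 \<le> (norm x)\<^sup>2" using Basis_le_norm[of b x] by (simp add: abs_le_square_iff[symmetric])
      also have "(norm x)\<^sup>2 + 1 \<le> (1 + norm x)\<^sup>2" by (simp add: power2_sum)
      finally show "1 + (x \<bullet> b)\<^sup>2 \<le> (1 + norm x)\<^sup>2" by simp
    qed simp
    also have "\<dots> = (1 + norm x) ^ (2 * DIM('a))" by (simp add: power_mult)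
    finally have le: "(\<Prod>b\<in>Basis. 1 + (x \<bullet> b)\<^sup>2) \<le> (1 + norm x) ^ (2 * DIM('a))" .
    have pos: "(\<Prod>b\<in>Basis. 1 + (x \<bullet> b)\<^sup>2) > 0" by (intro prod_pos) (simp add: add_pos_nonneg)
    have "norm (w x * \<phi> x) * (\<Prod>b\<in>Basis. 1 + (x \<bullet> b)\<^sup>2) \<le> ((1 + norm x) ^ n * norm (\<phi> x)) * (1 + norm x) ^ (2 * DIM('a))"
      unfolding norm_mult using w(2) le pos by (intro mult_mono) auto
    also have "\<dots> \<le> C" using C[of x] by (simp add: power_add mult_ac)
    finally have "norm (w x * \<phi> x) \<le> C / (\<Prod>b\<in>Basis. 1 + (x \<bullet> b)\<^sup>2)"
      using pos by (simp add: pos_le_divide_eq)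
    then show ?thesis
      using prod_inversef[of "\<lambda>b. 1 + (x \<bullet> b)\<^sup>2" Basis] by (simp add: o_def divide_inverse)
  qed
  show int: "integrable lborel (\<lambda>x. w x * \<phi> x)"
  proof (rule Bochner_Integration.integrable_bound)
    show "integrable lborel (\<lambda>x::'a. C * (\<Prod>b\<in>Basis. inverse (1 + (x \<bullet> b)\<^sup>2)))"
      by (intro integrable_mult_right integrable_lborel_prod 1)
    show "AE x in lborel. norm (w x * \<phi> x) \<le> norm (C * (\<Prod>b\<in>Basis. inverse (1 + (x \<bullet> b)\<^sup>2)))"
      using order_trans[OF D abs_ge_self] by (intro AE_I2) simp
  qed measurable
  show "(\<lambda>x. w x * \<phi> x) \<in> L2_space"
  proof (rule L2_space_dominated)
    show "integrable lborel (\<lambda>x. K * norm (w x * \<phi> x))" using int by (intro integrable_mult_right integrable_norm)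
    have "norm (w x * \<phi> x) \<le> K" for x
      unfolding norm_mult by (rule order_trans[OF mult_right_mono[OF w(2)] K]) simp
    then show "AE x in lborel. (norm (w x * \<phi> x))\<^sup>2 \<le> K * norm (w x * \<phi> x)"
      unfolding power2_eq_square by (intro AE_I2 mult_right_mono) auto
  qed measurable
qed

lemma schwartz_integrable: "\<phi> \<in> schwartz \<Longrightarrow> integrable lborel \<phi>"
  using schwartz_weight(1)[of \<phi> "\<lambda>x. 1" 0] by simp

lemma schwartz_L2: "\<phi> \<in> schwartz \<Longrightarrow> \<phi> \<in> L2_space"
  using schwartz_weight(2)[of \<phi> "\<lambda>x. 1" 0] by simp

section \<open>Plancherel's theorem\<close>

lemma cis_measurable [measurable]: "cis \<in> borel_measurable borel"
  by (intro borel_measurable_continuous_onI continuous_intros)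

lemma fourier_measurable:
  assumes "\<phi> \<in> borel_measurable borel"
  shows "fourier \<phi> \<in> borel_measurable (borel :: 'a::euclidean_space measure)"
proof -
  note [measurable] = assms
  show ?thesis
    unfolding fourier_def[abs_def] by (rule lborel.borel_measurable_lebesgue_integral) measurable
qed

lemma inv_fourier_measurable:
  assumes "\<phi> \<in> borel_measurable borel"
  shows "inv_fourier \<phi> \<in> borel_measurable (borel :: 'a::euclidean_space measure)"
proof -
  note [measurable] = assms
  show ?thesis
    unfolding inv_fourier_def[abs_def]
    by (intro borel_measurable_divide borel_measurable_const lborel.borel_measurable_lebesgue_integral) measurable
qed

lemma norm_fourier_le: "norm (fourier \<phi> \<xi>) \<le> (LINT x|lborel. norm (\<phi> x))"
  unfolding fourier_def by (rule order_trans[OF integral_norm_bound]) (simp add: norm_mult)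

lemma fourier_mult_formula:
  fixes f g :: "'a::euclidean_space \<Rightarrow> complex"
  assumes f: "integrable lborel f" and g: "integrable lborel g"
  shows "(LINT x|lborel. fourier f x * g x) = (LINT x|lborel. f x * fourier g x)"
proof -
  have [measurable]: "f \<in> borel_measurable borel" "g \<in> borel_measurable borel" using f g by auto
  have int: "integrable (lborel \<Otimes>\<^sub>M lborel) (\<lambda>(x, y). cis (- (y \<bullet> x)) * f y * g x)"
  proof (rule lborel_pair.Fubini_integrable)
    have fg: "integrable lborel (\<lambda>y. cis (- (y \<bullet> x)) * f y)" for x
      by (rule Bochner_Integration.integrable_bound[OF f]) (auto simp: norm_mult)
    show "integrable lborel (\<lambda>x. LINT y|lborel. norm (case (x, y) of (x, y) \<Rightarrow> cis (- (y \<bullet> x)) * f y * g x))"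
      using g by (simp add: norm_mult)
    show "AE x in lborel. integrable lborel (\<lambda>y. case (x, y) of (x, y) \<Rightarrow> cis (- (y \<bullet> x)) * f y * g x)"
      using fg by simp
  qed measurable
  have "(LINT x|lborel. fourier f x * g x) = (LINT x|lborel. LINT y|lborel. cis (- (y \<bullet> x)) * f y * g x)"
    by (simp add: fourier_def)
  also have "\<dots> = (LINT y|lborel. LINT x|lborel. cis (- (y \<bullet> x)) * f y * g x)"
    by (rule lborel_pair.Fubini_integral[symmetric]) (rule int)
  also have "\<dots> = (LINT y|lborel. f y * fourier g y)"
    by (simp add: fourier_def mult.left_commute[of _ "f _"] mult.assoc inner_commute)
  finally show ?thesis .
qed

text \<open>The ratio between the Fourier transform and the unitary operator that it becomes on
  square integrable functions.\<close>

definition fconst :: "'a::euclidean_space itself \<Rightarrow> real" where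
  "fconst _ = sqrt (2 * pi) ^ DIM('a)"

lemma fconst_pos [simp]: "fconst T > 0"
  by (simp add: fconst_def)

lemma fconst_nonzero [simp]: "fconst T \<noteq> 0"
  using fconst_pos[of T] by (metis less_irrefl)

lemma fconst_square: "fconst TYPE('a::euclidean_space) * fconst TYPE('a) = (2 * pi) ^ DIM('a)"
  unfolding fconst_def power_mult_distrib[symmetric] by simp

lemma fourier_bump:
  fixes y :: "'a::euclidean_space"
  assumes c: "c > 0"
  shows "fourier (bump c y) \<xi> = complex_of_real (sqrt (pi / c) ^ DIM('a) * exp (- (norm \<xi>)\<^sup>2 / (4 * c))) * cis (- (y \<bullet> \<xi>))"
proof -
  have split: "cis (- ((y + x) \<bullet> \<xi>)) = cis (- (y \<bullet> \<xi>)) * cis (- (x \<bullet> \<xi>))" for x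
    by (simp add: cis_mult inner_simps)
  have "fourier (bump c y) \<xi> = (LINT x|lborel. cis (- ((y + 1 *\<^sub>R x) \<bullet> \<xi>)) * bump c y (y + 1 *\<^sub>R x))"
    unfolding fourier_def by (subst integral_lborel_affine[of 1 _ y]) auto
  also have "\<dots> = (LINT x|lborel. cis (- (y \<bullet> \<xi>)) * (complex_of_real (exp (- c * (norm x)\<^sup>2)) * cis (- (x \<bullet> \<xi>))))"
    by (intro Bochner_Integration.integral_cong refl)
      (simp add: bump_def split mult_ac)
  also have "\<dots> = cis (- (y \<bullet> \<xi>)) * complex_of_real (sqrt (pi / c) ^ DIM('a) * exp (- (norm \<xi>)\<^sup>2 / (4 * c)))"
    by (simp only: integral_mult_right_zero gauss_integral(2)[OF c])
  finally show ?thesis by (simp only: mult.commute)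
qed

lemma fourier_bump_L2: "c > 0 \<Longrightarrow> fourier (bump c y) \<in> L2_space"
proof -
  assume c: "c > 0"
  have m: "(\<lambda>\<xi>. cis (- (y \<bullet> \<xi>))) \<in> borel_measurable borel" by measurable
  have "(\<lambda>\<xi>. cis (- (y \<bullet> \<xi>)) * (complex_of_real (sqrt (pi / c) ^ DIM('a)) * bump (1 / (4 * c)) 0 \<xi>)) \<in> L2_space"
    using c by (intro L2_space_mult[OF L2_space_cmult[OF bump_L2] m, of _ 1]) auto
  also have "(\<lambda>\<xi>. cis (- (y \<bullet> \<xi>)) * (complex_of_real (sqrt (pi / c) ^ DIM('a)) * bump (1 / (4 * c)) 0 \<xi>)) = fourier (bump c y)"
    by (rule ext) (simp add: fourier_bump[OF c] bump_def mult_ac)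
  finally show ?thesis .
qed

text \<open>Plancherel's identity for two translated Gaussians, by evaluating both sides: each is a Gaussian
  function of the distance of the centres.\<close>

lemma fourier_bump_gram:
  fixes y z :: "'a::euclidean_space"
  assumes c: "c > 0" and e: "e > 0"
  shows "(LINT \<xi>|lborel. fourier (bump c y) \<xi> * cnj (fourier (bump e z) \<xi>))
    = complex_of_real ((fconst TYPE('a))\<^sup>2) * (LINT x|lborel. bump c y x * bump e z x)"
proof -
  \<comment> \<open>the transforms decay like \<open>exp (- |\<xi>|\<^sup>2 / (4 c))\<close> and \<open>exp (- |\<xi>|\<^sup>2 / (4 e))\<close>, their product like \<open>exp (- \<sigma> |\<xi>|\<^sup>2)\<close>\<close>
  define \<sigma> where "\<sigma> = (c + e) / (4 * c * e)"
  have \<sigma>: "\<sigma> > 0" using c e by (simp add: \<sigma>_def)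
  have "fourier (bump c y) \<xi> * cnj (fourier (bump e z) \<xi>)
      = complex_of_real (sqrt (pi / c) ^ DIM('a) * sqrt (pi / e) ^ DIM('a))
        * (complex_of_real (exp (- \<sigma> * (norm \<xi>)\<^sup>2)) * cis (- (\<xi> \<bullet> (y - z))))" for \<xi>
  proof -
    have "- (norm \<xi>)\<^sup>2 / (4 * c) + - (norm \<xi>)\<^sup>2 / (4 * e) = - \<sigma> * (norm \<xi>)\<^sup>2"
      using c e by (simp add: \<sigma>_def field_simps)
    then have E: "exp (- (norm \<xi>)\<^sup>2 / (4 * c)) * exp (- (norm \<xi>)\<^sup>2 / (4 * e)) = exp (- \<sigma> * (norm \<xi>)\<^sup>2)"
      by (simp only: exp_add[symmetric])
    have C: "cis (- (y \<bullet> \<xi>)) * cis (z \<bullet> \<xi>) = cis (- (\<xi> \<bullet> (y - z)))"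
      by (simp add: cis_mult inner_simps inner_commute)
    show ?thesis
      unfolding fourier_bump[OF c] fourier_bump[OF e] E[symmetric] C[symmetric]
      by (simp add: cis_cnj mult_ac)
  qed
  then have "(LINT \<xi>|lborel. fourier (bump c y) \<xi> * cnj (fourier (bump e z) \<xi>))
      = complex_of_real (sqrt (pi / c) ^ DIM('a) * sqrt (pi / e) ^ DIM('a))
        * complex_of_real (sqrt (pi / \<sigma>) ^ DIM('a) * exp (- (norm (y - z))\<^sup>2 / (4 * \<sigma>)))"
    by (simp only: integral_mult_right_zero gauss_integral(2)[OF \<sigma>])
  also have "\<dots> = complex_of_real (((sqrt (pi / c) * sqrt (pi / e) * sqrt (pi / \<sigma>)) ^ DIM('a)) * exp (- (norm (y - z))\<^sup>2 / (4 * \<sigma>)))"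
    by (simp add: power_mult_distrib)
  also have "sqrt (pi / c) * sqrt (pi / e) * sqrt (pi / \<sigma>) = sqrt (2 * pi) * sqrt (2 * pi) * sqrt (pi / (c + e))"
    using c e by (simp only: real_sqrt_mult[symmetric]) (simp add: \<sigma>_def field_simps)
  finally have L: "(LINT \<xi>|lborel. fourier (bump c y) \<xi> * cnj (fourier (bump e z) \<xi>))
      = complex_of_real ((fconst TYPE('a))\<^sup>2) * complex_of_real (sqrt (pi / (c + e)) ^ DIM('a) * exp (- (norm (y - z))\<^sup>2 / (4 * \<sigma>)))"
    by (simp add: power_mult_distrib power2_eq_square[of "fconst _"] fconst_square flip: of_real_mult)
  have "(LINT x|lborel. bump c y x * bump e z x)
      = complex_of_real (exp (- (c * e / (c + e)) * (norm (y - z))\<^sup>2)) * (LINT x|lborel. bump (c + e) ((c / (c + e)) *\<^sub>R y + (e / (c + e)) *\<^sub>R z) x)"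
    by (simp only: bump_mult[OF c e] integral_mult_right_zero)
  also have "(LINT x|lborel. bump (c + e) w x) = complex_of_real (sqrt (pi / (c + e)) ^ DIM('a))" for w :: 'a
  proof -
    have "(LINT x|lborel. bump (c + e) w x) = fourier (bump (c + e) w) 0" by (simp add: fourier_def)
    then show ?thesis using c e by (simp add: fourier_bump)
  qed
  also have "- (c * e / (c + e)) * (norm (y - z))\<^sup>2 = - (norm (y - z))\<^sup>2 / (4 * \<sigma>)"
    using c e by (simp add: \<sigma>_def field_simps)
  finally show ?thesis unfolding L by simp
qed

lemma bump_total:
  assumes "\<And>c y. c > 0 \<Longrightarrow> bil (abs_l2 (bump c y)) w = 0"
  shows "w = 0"
proof (rule l2_eqI)
  have "AE x in lborel. rep_l2 w x = 0"
  proof (rule AE_zero_of_bump_integrals)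
    show "integrable lborel (\<lambda>x. rep_l2 w x * bump 1 0 x)" by (intro L2_integrable_mult bump_L2) auto
    show "(LINT x|lborel. rep_l2 w x * bump c y x) = 0" if "c > 0" for c y
      using assms[OF that, of y] bil_abs[OF rep_l2_mem bump_L2[OF that], of w y] by (simp add: bil_sym)
  qed
  moreover have "AE x in lborel. rep_l2 (0 :: 'a l2) x = 0"
    using rep_abs_l2[OF L2_space_zero] by (simp add: zero_l2_def)
  ultimately show "AE x in lborel. rep_l2 w x = rep_l2 0 x" by eventually_elim simp
qed

text \<open>Translated Gaussians are total in the complex Hilbert space; as a real Hilbert space one adds
  their multiples by the imaginary unit. Writing the exponents as \<open>exp r\<close> makes every real \<open>r\<close> an
  admissible index.\<close>

definition gen :: "bool \<times> real \<times> 'a::euclidean_space \<Rightarrow> 'a l2" where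
  "gen = (\<lambda>(k, r, y). scaleC (if k then 1 else \<i>) (abs_l2 (bump (exp r) y)))"

lemma scaleC_one [simp]: "scaleC 1 f = f"
  by transfer (auto simp: L2_rel_def)

lemma scaleC_scaleC: "scaleC c (scaleC d f) = scaleC (c * d) f"
  by transfer (auto simp: L2_rel_def L2_space_cmult mult.assoc)

lemma scaleC_add_left: "scaleC (c + d) f = scaleC c f + scaleC d f"
  by transfer (auto simp: L2_rel_def L2_space_cmult L2_space_add ring_distribs)

lemma gen_total:
  assumes "\<And>i. inner (gen i) w = 0" shows "w = (0 :: 'a::euclidean_space l2)"
proof -
  have "bil (abs_l2 (bump c y)) (cnj_l2 w) = 0" if "c > 0" for c and y :: 'a
    using assms[of "(True, ln c, y)"] assms[of "(False, ln c, y)"] that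
    by (simp add: gen_def inner_l2_def bil_scaleC complex_eq_iff)
  then have "cnj_l2 w = 0" by (rule bump_total)
  then have "cnj_l2 (cnj_l2 w) = cnj_l2 0" by simp
  then show ?thesis using linear_0[OF bounded_linear.linear[OF bounded_linear_cnj_l2]] by simp
qed

lemma bounded_linear_eq_on_bumps:
  fixes F G :: "'a::euclidean_space l2 \<Rightarrow> 'b::real_normed_vector"
  assumes "bounded_linear F" "bounded_linear G"
    and "\<And>c y. c > 0 \<Longrightarrow> F (abs_l2 (bump c y)) = G (abs_l2 (bump c y))"
    and "\<And>c y. c > 0 \<Longrightarrow> F (scaleC \<i> (abs_l2 (bump c y))) = G (scaleC \<i> (abs_l2 (bump c y)))"
  shows "F x = G x"
proof (rule bounded_linear_eq_on_total[OF gen_total assms(1,2)])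
  show "F (gen i) = G (gen i)" for i using assms(3,4) by (cases i) (auto simp: gen_def)
qed

lemma fourier_l2_exists:
  "\<exists>U :: 'a::euclidean_space l2 \<Rightarrow> 'a l2. bounded_linear U \<and> (\<forall>x. norm (U x) = norm x) \<and>
    (\<forall>k c y. c > 0 \<longrightarrow> U (scaleC (if k then 1 else \<i>) (abs_l2 (bump c y)))
      = scaleC ((if k then 1 else \<i>) / fconst TYPE('a)) (abs_l2 (fourier (bump c y))))"
proof -
  define T :: "bool \<times> real \<times> 'a \<Rightarrow> 'a l2" where
    "T = (\<lambda>(k, r, y). scaleC ((if k then 1 else \<i>) / fconst TYPE('a)) (abs_l2 (fourier (bump (exp r) y))))"
  have cnj_sc: "cnj_l2 (scaleC a f) = scaleC (cnj a) (cnj_l2 f)" for a and f :: "'a l2"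
    by transfer (auto simp: L2_rel_def L2_space_cnj L2_space_cmult)
  have gram: "inner (T i) (T j) = inner (gen i) (gen j)" for i j
  proof -
    obtain k r y k' r' y' where ij: "i = (k, r, y)" "j = (k', r', y')" by (metis prod.collapse)
    have "bil (abs_l2 (fourier (bump (exp r) y))) (cnj_l2 (abs_l2 (fourier (bump (exp r') y'))))
       = complex_of_real ((fconst TYPE('a))\<^sup>2) * bil (abs_l2 (bump (exp r) y)) (cnj_l2 (abs_l2 (bump (exp r') y')))"
      by (simp add: cnj_l2_abs bil_abs fourier_bump_L2 bump_L2 L2_space_cnj fourier_bump_gram)
        (simp add: bump_def)
    then have "bil (T i) (cnj_l2 (T j)) = bil (gen i) (cnj_l2 (gen j))"
      by (simp add: ij T_def gen_def cnj_sc bil_scaleC bil_scaleC_right power2_eq_square field_simps)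
    then show ?thesis by (simp add: inner_l2_def)
  qed
  obtain U where U: "bounded_linear U" "\<And>i. U (gen i) = T i" "\<And>x. norm (U x) = norm x"
    using isometry_extension[of T gen, OF gram gen_total] by blast
  have "U (scaleC (if k then 1 else \<i>) (abs_l2 (bump c y)))
      = scaleC ((if k then 1 else \<i>) / fconst TYPE('a)) (abs_l2 (fourier (bump c y)))" if "c > 0" for k c y
    using U(2)[of "(k, ln c, y)"] that by (simp add: gen_def T_def)
  with U show ?thesis by blast
qed

text \<open>The Fourier transform of classes of square integrable functions, normalised to be unitary.\<close>

definition fourier_l2 :: "'a::euclidean_space l2 \<Rightarrow> 'a l2" where
  "fourier_l2 = (SOME U. bounded_linear U \<and> (\<forall>x. norm (U x) = norm x) \<and>
    (\<forall>k c y. c > 0 \<longrightarrow> U (scaleC (if k then 1 else \<i>) (abs_l2 (bump c y)))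
      = scaleC ((if k then 1 else \<i>) / fconst TYPE('a)) (abs_l2 (fourier (bump c y)))))"

lemma fourier_l2_spec:
  fixes U :: "'a::euclidean_space l2 \<Rightarrow> 'a l2"
  defines "U \<equiv> fourier_l2"
  shows "bounded_linear U \<and> (\<forall>x. norm (U x) = norm x) \<and>
    (\<forall>k c y. c > 0 \<longrightarrow> U (scaleC (if k then 1 else \<i>) (abs_l2 (bump c y)))
      = scaleC ((if k then 1 else \<i>) / fconst TYPE('a)) (abs_l2 (fourier (bump c y))))"
  unfolding U_def fourier_l2_def by (rule someI_ex[OF fourier_l2_exists])

lemma bounded_linear_fourier_l2: "bounded_linear fourier_l2"
  using fourier_l2_spec by (rule conjunct1)

lemma norm_fourier_l2 [simp]: "norm (fourier_l2 f) = norm f"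
  using fourier_l2_spec[THEN conjunct2, THEN conjunct1] by blast

lemma fourier_l2_bump: "c > 0 \<Longrightarrow> fourier_l2 (abs_l2 (bump c (y :: 'a::euclidean_space)))
      = scaleC (1 / fconst TYPE('a)) (abs_l2 (fourier (bump c y)))"
  using fourier_l2_spec[THEN conjunct2, THEN conjunct2, rule_format, of c True y] by simp

lemma fourier_l2_i_bump: "c > 0 \<Longrightarrow> fourier_l2 (scaleC \<i> (abs_l2 (bump c (y :: 'a::euclidean_space))))
      = scaleC (\<i> / fconst TYPE('a)) (abs_l2 (fourier (bump c y)))"
  using fourier_l2_spec[THEN conjunct2, THEN conjunct2, rule_format, of c False y] by simp

lemma fourier_l2_scaleC: "fourier_l2 (scaleC c f) = scaleC c (fourier_l2 f)"
proof -
  have i: "fourier_l2 (scaleC \<i> f) = scaleC \<i> (fourier_l2 f)" for f :: "'a l2"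
  proof (rule bounded_linear_eq_on_bumps[where F="\<lambda>f. fourier_l2 (scaleC \<i> f)" and G="\<lambda>f. scaleC \<i> (fourier_l2 f)"])
    show "bounded_linear (\<lambda>f::'a l2. fourier_l2 (scaleC \<i> f))"
      by (intro bounded_linear_compose[OF bounded_linear_fourier_l2 bounded_linear_scaleC])
    show "bounded_linear (\<lambda>f::'a l2. scaleC \<i> (fourier_l2 f))"
      by (intro bounded_linear_compose[OF bounded_linear_scaleC bounded_linear_fourier_l2])
    fix c :: real and y :: 'a assume c: "c > 0"
    show "fourier_l2 (scaleC \<i> (abs_l2 (bump c y))) = scaleC \<i> (fourier_l2 (abs_l2 (bump c y)))"
      by (simp add: fourier_l2_bump fourier_l2_i_bump c scaleC_scaleC)
    have "scaleC \<i> (scaleC \<i> (abs_l2 (bump c y))) = - 1 *\<^sub>R abs_l2 (bump c y)"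
      by (simp only: scaleC_scaleC scaleR_scaleC) simp
    then have "fourier_l2 (scaleC \<i> (scaleC \<i> (abs_l2 (bump c y)))) = - 1 *\<^sub>R fourier_l2 (abs_l2 (bump c y))"
      by (simp only: bounded_linear.linear[OF bounded_linear_fourier_l2, THEN linear_cmul])
    then show "fourier_l2 (scaleC \<i> (scaleC \<i> (abs_l2 (bump c y)))) = scaleC \<i> (fourier_l2 (scaleC \<i> (abs_l2 (bump c y))))"
      by (simp only: fourier_l2_bump fourier_l2_i_bump c scaleC_scaleC scaleR_scaleC) simp
  qed
  have dec: "scaleC c f = Re c *\<^sub>R f + Im c *\<^sub>R scaleC \<i> f" for f :: "'a l2"
    by (simp only: scaleR_scaleC scaleC_scaleC scaleC_add_left[symmetric]) (simp add: complex_eq[symmetric] mult.commute)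
  interpret bounded_linear "fourier_l2 :: 'a l2 \<Rightarrow> 'a l2" by (rule bounded_linear_fourier_l2)
  show ?thesis by (simp only: dec add scaleR i)
qed

text \<open>By Fubini this holds for integrable functions, hence for Gaussians, and both sides are continuous.
  It links the operator with the distributional Fourier transform, which is defined by transposition.\<close>

lemma bil_fourier_l2: "bil (fourier_l2 f) g = bil f (fourier_l2 g)"
proof -
  interpret bil: bounded_bilinear "bil :: 'a l2 \<Rightarrow> 'a l2 \<Rightarrow> complex" by (rule bounded_bilinear_bil)
  note bl = bounded_linear_compose[OF bil.bounded_linear_left bounded_linear_fourier_l2]
    bounded_linear_compose[OF bil.bounded_linear_right bounded_linear_fourier_l2]
    bil.bounded_linear_left bil.bounded_linear_right
  have 1: "bil (fourier_l2 (abs_l2 (bump c y))) (abs_l2 (bump e z)) = bil (abs_l2 (bump c y)) (fourier_l2 (abs_l2 (bump e z)))"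
    if "c > 0" "e > 0" for c e and y z :: 'a
    using that by (simp add: fourier_l2_bump bil_scaleC bil_scaleC_right bil_abs fourier_bump_L2 bump_L2
        fourier_mult_formula bump_integrable)
  have 2: "bil (fourier_l2 f) (abs_l2 (bump e z)) = bil f (fourier_l2 (abs_l2 (bump e z)))"
    if "e > 0" for e z and f :: "'a l2"
    by (rule bounded_linear_eq_on_bumps[of _ _ f, OF bl(1) bl(3)])
      (simp_all add: 1 that fourier_l2_scaleC bil_scaleC)
  show ?thesis
    by (rule bounded_linear_eq_on_bumps[of _ _ g, OF bl(4) bl(2)])
      (simp_all add: 2 fourier_l2_scaleC bil_scaleC_right)
qed

text \<open>Conjugation turns the kernel \<open>exp (- i x \<xi>)\<close> into \<open>exp (i x \<xi>)\<close>. By the symmetry of the pairing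
  this operator is the adjoint of \<open>fourier_l2\<close>.\<close>

definition inv_fourier_l2 :: "'a::euclidean_space l2 \<Rightarrow> 'a l2" where
  "inv_fourier_l2 f = cnj_l2 (fourier_l2 (cnj_l2 f))"

lemma bounded_linear_inv_fourier_l2: "bounded_linear inv_fourier_l2"
  unfolding inv_fourier_l2_def[abs_def]
  by (intro bounded_linear_compose[OF bounded_linear_cnj_l2] bounded_linear_compose[OF bounded_linear_fourier_l2] bounded_linear_cnj_l2)

lemma norm_inv_fourier_l2 [simp]: "norm (inv_fourier_l2 f) = norm f"
  by (simp add: inv_fourier_l2_def)

lemma bil_inv_fourier_l2: "bil (inv_fourier_l2 f) g = bil f (inv_fourier_l2 g)"
  using bil_cnj[of "fourier_l2 (cnj_l2 f)" "cnj_l2 g"] bil_cnj[of "cnj_l2 f" "fourier_l2 (cnj_l2 g)"]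
  by (simp add: inv_fourier_l2_def bil_fourier_l2)

lemma inner_fourier_l2: "inner (fourier_l2 f) g = inner f (inv_fourier_l2 g)"
  by (simp add: inner_l2_def inv_fourier_l2_def bil_fourier_l2)

lemma inner_fourier_l2_fourier_l2 [simp]: "inner (fourier_l2 f) (fourier_l2 g) = inner f g"
proof -
  have "norm (fourier_l2 f + fourier_l2 g) = norm (f + g)"
    by (simp flip: bounded_linear.linear[OF bounded_linear_fourier_l2, THEN linear_add])
  then show ?thesis by (simp add: dot_norm)
qed

lemma inv_fourier_fourier_l2 [simp]: "inv_fourier_l2 (fourier_l2 f) = f"
proof -
  have "inner g (inv_fourier_l2 (fourier_l2 f)) = inner g f" for g
    by (simp flip: inner_fourier_l2)
  then show ?thesis by (metis vector_eq_rdot inner_commute)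
qed

text \<open>The adjoint of an isometry is a left inverse. Here the adjoint is an isometry as well, hence
  injective, so that it is also a right inverse.\<close>

lemma fourier_inv_fourier_l2 [simp]: "fourier_l2 (inv_fourier_l2 g) = g"
proof -
  have "norm (inv_fourier_l2 (fourier_l2 (inv_fourier_l2 g) - g)) = 0"
    by (simp only: bounded_linear.linear[OF bounded_linear_inv_fourier_l2, THEN linear_diff] inv_fourier_fourier_l2) simp
  then show ?thesis by simp
qed

text \<open>Both sides pair equally with all Gaussians; the difference is a bounded function plus a square
  integrable one, so that the totality of Gaussians applies without knowing beforehand that \<open>fourier \<phi>\<close>
  is square integrable.\<close>

lemma fourier_eq_fourier_l2:
  fixes \<phi> :: "'a::euclidean_space \<Rightarrow> complex"
  assumes \<phi>: "\<phi> \<in> L2_space" "integrable lborel \<phi>"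
  shows "AE \<xi> in lborel. fourier \<phi> \<xi> = fconst TYPE('a) * rep_l2 (fourier_l2 (abs_l2 \<phi>)) \<xi>"
proof -
  define F where "F \<xi> = fourier \<phi> \<xi> - fconst TYPE('a) * rep_l2 (fourier_l2 (abs_l2 \<phi>)) \<xi>" for \<xi>
  have [measurable]: "fourier \<phi> \<in> borel_measurable borel" using \<phi> by (intro fourier_measurable) auto
  have 1: "integrable lborel (\<lambda>\<xi>. fourier \<phi> \<xi> * bump c y \<xi>)" if "c > 0" for c y
  proof (rule Bochner_Integration.integrable_bound)
    show "integrable lborel (\<lambda>\<xi>. (LINT x|lborel. norm (\<phi> x)) * norm (bump c y \<xi>))"
      using that by (intro integrable_mult_right integrable_norm bump_integrable)
    show "AE \<xi> in lborel. norm (fourier \<phi> \<xi> * bump c y \<xi>) \<le> norm ((LINT x|lborel. norm (\<phi> x)) * norm (bump c y \<xi>))"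
      by (intro AE_I2) (auto simp: norm_mult intro!: mult_right_mono norm_fourier_le)
  qed measurable
  have 2: "integrable lborel (\<lambda>\<xi>. rep_l2 (fourier_l2 (abs_l2 \<phi>)) \<xi> * bump c y \<xi>)" if "c > 0" for c y
    using that by (intro L2_integrable_mult bump_L2) auto
  have "AE \<xi> in lborel. F \<xi> = 0"
  proof (rule AE_zero_of_bump_integrals)
    show "integrable lborel (\<lambda>\<xi>. F \<xi> * bump 1 0 \<xi>)"
      unfolding F_def using 1 2 by (simp add: left_diff_distrib mult.assoc)
    fix c :: real and y :: 'a assume c: "c > 0"
    have "(LINT \<xi>|lborel. F \<xi> * bump c y \<xi>)
        = (LINT \<xi>|lborel. fourier \<phi> \<xi> * bump c y \<xi>) - fconst TYPE('a) * (LINT \<xi>|lborel. rep_l2 (fourier_l2 (abs_l2 \<phi>)) \<xi> * bump c y \<xi>)"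
      unfolding F_def using 1[OF c] 2[OF c] by (simp add: left_diff_distrib mult.assoc)
    also have "(LINT \<xi>|lborel. rep_l2 (fourier_l2 (abs_l2 \<phi>)) \<xi> * bump c y \<xi>) = bil (fourier_l2 (abs_l2 \<phi>)) (abs_l2 (bump c y))"
      using bil_abs[OF rep_l2_mem bump_L2[OF c, of y]] by simp
    also have "\<dots> = (1 / fconst TYPE('a)) * (LINT \<xi>|lborel. \<phi> \<xi> * fourier (bump c y) \<xi>)"
      by (simp add: bil_fourier_l2 fourier_l2_bump c bil_scaleC_right bil_abs \<phi> fourier_bump_L2)
    also have "(LINT \<xi>|lborel. fourier \<phi> \<xi> * bump c y \<xi>) = (LINT \<xi>|lborel. \<phi> \<xi> * fourier (bump c y) \<xi>)"
      by (rule fourier_mult_formula[OF \<phi>(2) bump_integrable[OF c]])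
    finally show "(LINT \<xi>|lborel. F \<xi> * bump c y \<xi>) = 0" by simp
  qed
  then show ?thesis by eventually_elim (simp add: F_def)
qed

lemma inv_fourier_eq_inv_fourier_l2:
  fixes \<phi> :: "'a::euclidean_space \<Rightarrow> complex"
  assumes \<phi>: "\<phi> \<in> L2_space" "integrable lborel \<phi>"
  shows "AE x in lborel. inv_fourier \<phi> x = rep_l2 (inv_fourier_l2 (abs_l2 \<phi>)) x / fconst TYPE('a)"
proof -
  have eq: "inv_fourier \<phi> x = cnj (fourier (\<lambda>x. cnj (\<phi> x)) x) / (fconst TYPE('a) * fconst TYPE('a))" for x
    unfolding inv_fourier_def fourier_def Bochner_Integration.integral_cnj[symmetric] fconst_square[symmetric]
    by (simp add: cis_cnj inner_commute)
  have "(\<lambda>x. cnj (\<phi> x)) \<in> L2_space" "integrable lborel (\<lambda>x. cnj (\<phi> x))"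
    using \<phi> by (auto intro: L2_space_cnj)
  from fourier_eq_fourier_l2[OF this] rep_l2_cnj[of "fourier_l2 (cnj_l2 (abs_l2 \<phi>))"]
  show ?thesis
  proof eventually_elim
    case (elim x)
    show ?case using elim by (simp add: eq inv_fourier_l2_def cnj_l2_abs \<phi>(1))
  qed
qed

section \<open>The fractional Laplacian on the Fourier side\<close>

text \<open>Gaussians are Schwartz functions.\<close>

lemma represents_unique:
  assumes "represents g \<Lambda>" "represents h \<Lambda>" shows "AE x in lborel. g x = h x"
proof -
  have gh: "g \<in> L2_space" "h \<in> L2_space" using assms by (auto simp: represents_def)
  have "AE x in lborel. g x - h x = 0"
  proof (rule AE_zero_of_bump_integrals)
    have int: "integrable lborel (\<lambda>x. g x * bump c y x)" "integrable lborel (\<lambda>x. h x * bump c y x)" if "c > 0" for c y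
      using that gh by (auto intro!: L2_integrable_mult bump_L2)
    show "integrable lborel (\<lambda>x. (g x - h x) * bump 1 0 x)"
      using int[of 1 0] by (simp add: left_diff_distrib)
    fix c :: real and y assume c: "c > 0"
    have "regular g (bump c y) = regular h (bump c y)"
      using assms bump_schwartz[OF c, of y] unfolding represents_def by metis
    then show "(LINT x|lborel. (g x - h x) * bump c y x) = 0"
      using int[OF c, of y] by (simp add: left_diff_distrib regular_def)
  qed
  then show ?thesis by eventually_elim simp
qed

lemma represents_density: "represents g \<Lambda> \<Longrightarrow> represents (L2_density \<Lambda>) \<Lambda>"
  unfolding L2_density_def by (rule someI[where P="\<lambda>g. represents g \<Lambda>"])

lemma L2_density_eq: "represents g \<Lambda> \<Longrightarrow> AE x in lborel. L2_density \<Lambda> x = g x"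
  using represents_unique[OF represents_density] by blast

lemma L2_norm_density: "represents g \<Lambda> \<Longrightarrow> L2_norm (L2_density \<Lambda>) = L2_norm g"
  using represents_density[of g \<Lambda>]
  by (intro L2_norm_cong_AE L2_density_eq) (auto simp: represents_def dest: L2_space_measurable)

text \<open>This identifies the transform \<open>fourier_L2\<close>, chosen among the densities of a tempered
  distribution, with the unitary operator.\<close>

lemma represents_fourier:
  assumes f: "f \<in> L2_space"
  shows "represents (\<lambda>\<xi>. fconst TYPE('a) * rep_l2 (fourier_l2 (abs_l2 f)) \<xi>) (fourier_distr (regular (f :: 'a::euclidean_space \<Rightarrow> complex)))"
  unfolding represents_def
proof (intro conjI ballI)
  show "(\<lambda>\<xi>. fconst TYPE('a) * rep_l2 (fourier_l2 (abs_l2 f)) \<xi>) \<in> L2_space"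
    by (intro L2_space_cmult) simp
  fix \<phi> :: "'a \<Rightarrow> complex" assume \<phi>: "\<phi> \<in> schwartz"
  note ae = fourier_eq_fourier_l2[OF schwartz_L2 schwartz_integrable, OF \<phi> \<phi>]
  have [measurable]: "f \<in> borel_measurable borel" "\<phi> \<in> borel_measurable borel" "fourier \<phi> \<in> borel_measurable borel"
    using f schwartz_measurable[OF \<phi>] by (auto dest: L2_space_measurable intro: fourier_measurable)
  have "fourier_distr (regular f) \<phi> = (LINT x|lborel. f x * (fconst TYPE('a) * rep_l2 (fourier_l2 (abs_l2 \<phi>)) x))"
    unfolding fourier_distr_def regular_def
    by (intro integral_cong_AE) (measurable, use ae in eventually_elim, simp)
  also have "\<dots> = fconst TYPE('a) * bil (abs_l2 f) (fourier_l2 (abs_l2 \<phi>))"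
    using bil_abs[OF f rep_l2_mem, of "fourier_l2 (abs_l2 \<phi>)"] by (simp add: mult.left_commute[of "f _"])
  also have "bil (abs_l2 f) (fourier_l2 (abs_l2 \<phi>)) = (LINT x|lborel. rep_l2 (fourier_l2 (abs_l2 f)) x * \<phi> x)"
    using bil_abs[OF rep_l2_mem schwartz_L2[OF \<phi>], of "fourier_l2 (abs_l2 f)"] by (simp add: bil_fourier_l2)
  also have "fconst TYPE('a) * (LINT x|lborel. rep_l2 (fourier_l2 (abs_l2 f)) x * \<phi> x)
      = regular (\<lambda>\<xi>. fconst TYPE('a) * rep_l2 (fourier_l2 (abs_l2 f)) \<xi>) \<phi>"
    by (simp add: regular_def mult.assoc)
  finally show "fourier_distr (regular f) \<phi> = regular (\<lambda>\<xi>. fconst TYPE('a) * rep_l2 (fourier_l2 (abs_l2 f)) \<xi>) \<phi>" .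
qed

lemma fourier_L2_eq:
  fixes f :: "'a::euclidean_space \<Rightarrow> complex"
  assumes "f \<in> L2_space"
  shows "AE \<xi> in lborel. fourier_L2 f \<xi> = fconst TYPE('a) * rep_l2 (fourier_l2 (abs_l2 f)) \<xi>"
  unfolding fourier_L2_def by (rule L2_density_eq[OF represents_fourier[OF assms]])

lemma fourier_L2_mem: "f \<in> L2_space \<Longrightarrow> fourier_L2 f \<in> L2_space"
  using represents_density[OF represents_fourier, of f] unfolding fourier_L2_def represents_def by blast

definition symb :: "real \<Rightarrow> 'a::euclidean_space \<Rightarrow> complex" where
  "symb s \<xi> = complex_of_real (norm \<xi> powr s)"

text \<open>A relation rather than a multiplication operator, because the product of a square integrable
  function with the symbol need not be square integrable.\<close>

definition weighted :: "real \<Rightarrow> 'a::euclidean_space l2 \<Rightarrow> 'a l2 \<Rightarrow> bool" where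
  "weighted s f q \<longleftrightarrow> (AE \<xi> in lborel. rep_l2 q \<xi> = symb s \<xi> * rep_l2 f \<xi>)"

lemma symb_measurable [measurable]: "symb s \<in> borel_measurable borel"
  unfolding symb_def[abs_def] by measurable

lemma symb_bound: "s > 0 \<Longrightarrow> norm (symb s \<xi>) \<le> (1 + norm \<xi>) ^ nat \<lceil>s\<rceil>"
proof -
  assume s: "s > 0"
  have "norm \<xi> powr s \<le> (1 + norm \<xi>) powr s" using s by (intro powr_mono2) auto
  also have "\<dots> \<le> (1 + norm \<xi>) powr (real (nat \<lceil>s\<rceil>))" using s by (intro powr_mono) auto
  also have "\<dots> = (1 + norm \<xi>) ^ nat \<lceil>s\<rceil>" by (rule powr_realpow) (simp add: add_pos_nonneg)
  finally show ?thesis by (simp add: symb_def)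
qed

lemma symb_schwartz:
  assumes "s > 0" "\<phi> \<in> schwartz" shows "(\<lambda>\<xi>. symb s \<xi> * \<phi> \<xi>) \<in> L2_space"
  using schwartz_weight(2)[OF assms(2) symb_measurable symb_bound[OF assms(1)]] .

lemma weighted_represents:
  fixes f :: "'a::euclidean_space \<Rightarrow> complex"
  assumes f: "f \<in> L2_space" and q: "weighted s (fourier_l2 (abs_l2 f)) q"
  shows "represents (rep_l2 (inv_fourier_l2 q)) (frac_laplacian (s / 2) f)"
  unfolding represents_def
proof (intro conjI ballI)
  fix \<phi> :: "'a \<Rightarrow> complex" assume \<phi>: "\<phi> \<in> schwartz"
  note ae = inv_fourier_eq_inv_fourier_l2[OF schwartz_L2 schwartz_integrable, OF \<phi> \<phi>]
  have [measurable]: "\<phi> \<in> borel_measurable borel" "fourier_L2 f \<in> borel_measurable borel"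
    using schwartz_measurable[OF \<phi>] L2_space_measurable[OF fourier_L2_mem[OF f]] by auto
  note [measurable] = inv_fourier_measurable[OF schwartz_measurable[OF \<phi>]]
  have "frac_laplacian (s / 2) f \<phi> = (LINT \<xi>|lborel. rep_l2 q \<xi> * rep_l2 (inv_fourier_l2 (abs_l2 \<phi>)) \<xi>)"
    unfolding frac_laplacian_def inv_fourier_distr_def regular_def symb_def[symmetric]
    by (intro integral_cong_AE)
      (measurable, use ae fourier_L2_eq[OF f] q[unfolded weighted_def] in eventually_elim, simp)
  also have "\<dots> = bil (inv_fourier_l2 q) (abs_l2 \<phi>)"
    by (subst bil_inv_fourier_l2) (rule bil_rep[symmetric])
  also have "\<dots> = regular (rep_l2 (inv_fourier_l2 q)) \<phi>"
    using bil_abs[OF rep_l2_mem schwartz_L2[OF \<phi>], of "inv_fourier_l2 q"] by (simp add: regular_def)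
  finally show "frac_laplacian (s / 2) f \<phi> = regular (rep_l2 (inv_fourier_l2 q)) \<phi>" .
qed simp

lemma weighted_H_space:
  assumes f: "f \<in> L2_space" and q: "weighted s (fourier_l2 (abs_l2 f)) q"
  shows "f \<in> H_space s" "frac_seminorm s f = norm q"
proof -
  note r = weighted_represents[OF f q]
  show "f \<in> H_space s" using f r by (auto simp: H_space_def is_L2_def)
  show "frac_seminorm s f = norm q"
    unfolding frac_seminorm_def L2_norm_density[OF r] by (simp flip: norm_l2_rep)
qed

text \<open>Modulated Gaussians have translated Gaussians as inverse Fourier transforms, so testing with
  them identifies the multiple of the Fourier transform by the symbol pointwise.\<close>

lemma inv_fourier_gauss:
  fixes y :: "'a::euclidean_space"
  assumes c: "c > 0"
  shows "inv_fourier (gauss (1 / (4 * c)) 0 (- y)) \<xi>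
    = complex_of_real (sqrt (4 * pi * c) ^ DIM('a) / (2 * pi) ^ DIM('a)) * bump c y \<xi>"
proof -
  have "cis (\<xi> \<bullet> x) * gauss (1 / (4 * c)) 0 (- y) x
      = complex_of_real (exp (- (1 / (4 * c)) * (norm x)\<^sup>2)) * cis (- (x \<bullet> (y - \<xi>)))" for x
  proof -
    have "gauss (1 / (4 * c)) 0 (- y) x = complex_of_real (exp (- (1 / (4 * c)) * (norm x)\<^sup>2)) * cis (- (x \<bullet> y))"
      by (simp only: gauss_def exp_add exp_of_real cis_conv_exp power2_norm_eq_inner) simp
    then show ?thesis by (simp add: cis_mult inner_simps inner_commute mult.left_commute[of "cis _"])
  qed
  then have "inv_fourier (gauss (1 / (4 * c)) 0 (- y)) \<xi>
    = complex_of_real (sqrt (pi / (1 / (4 * c))) ^ DIM('a) * exp (- (norm (y - \<xi>))\<^sup>2 / (4 * (1 / (4 * c))))) / complex_of_real ((2 * pi) ^ DIM('a))"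
    using gauss_integral(2)[of "1 / (4 * c)" "y - \<xi>"] c by (simp only: inv_fourier_def) simp
  then show ?thesis
    by (simp add: bump_def norm_minus_commute mult_ac)
qed

lemma H_space_weighted:
  fixes f :: "'a::euclidean_space \<Rightarrow> complex"
  assumes s: "s > 0" and f: "f \<in> H_space s"
  shows "\<exists>q. weighted s (fourier_l2 (abs_l2 f)) q"
proof -
  from f have fL: "f \<in> L2_space" and "\<exists>g. represents g (frac_laplacian (s / 2) f)"
    by (auto simp: H_space_def is_L2_def)
  then obtain g where g: "represents g (frac_laplacian (s / 2) f)" by blast
  then have gL: "g \<in> L2_space" by (simp add: represents_def)
  define w where "w = fourier_l2 (abs_l2 g)"
  define F where "F \<xi> = symb s \<xi> * rep_l2 (fourier_l2 (abs_l2 f)) \<xi> - rep_l2 w \<xi>" for \<xi>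
  have int: "integrable lborel (\<lambda>\<xi>. symb s \<xi> * rep_l2 (fourier_l2 (abs_l2 f)) \<xi> * bump c y \<xi>)"
      "integrable lborel (\<lambda>\<xi>. rep_l2 w \<xi> * bump c y \<xi>)" if "c > 0" for c y
    using L2_integrable_mult[OF rep_l2_mem symb_schwartz[OF s bump_schwartz[OF that, of y]], of "fourier_l2 (abs_l2 f)"]
      L2_integrable_mult[OF rep_l2_mem bump_L2[OF that, of y], of w]
    by (simp_all add: mult_ac)
  have "AE \<xi> in lborel. F \<xi> = 0"
  proof (rule AE_zero_of_bump_integrals)
    show "integrable lborel (\<lambda>x. F x * bump 1 0 x)"
      using int[of 1 0] by (simp add: F_def left_diff_distrib)
    fix c :: real and y :: 'a assume c: "c > 0"
    define \<phi> where "\<phi> = gauss (1 / (4 * c)) 0 (- y)"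
    define k where "k = complex_of_real (sqrt (4 * pi * c) ^ DIM('a) / (2 * pi) ^ DIM('a))"
    have k: "k \<noteq> 0" using c by (simp add: k_def)
    have \<phi>: "\<phi> \<in> schwartz" using c by (simp add: \<phi>_def gauss_schwartz)
    have inv: "inv_fourier \<phi> = (\<lambda>\<xi>. k * bump c y \<xi>)"
      unfolding \<phi>_def k_def by (rule ext) (rule inv_fourier_gauss[OF c])
    note ae = inv_fourier_eq_inv_fourier_l2[OF schwartz_L2 schwartz_integrable, OF \<phi> \<phi>, unfolded inv]
    have [measurable]: "fourier_L2 f \<in> borel_measurable borel"
      using L2_space_measurable[OF fourier_L2_mem[OF fL]] by auto
    have "frac_laplacian (s / 2) f \<phi> = (LINT \<xi>|lborel. fconst TYPE('a) * k * (symb s \<xi> * rep_l2 (fourier_l2 (abs_l2 f)) \<xi> * bump c y \<xi>))"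
      unfolding frac_laplacian_def inv_fourier_distr_def regular_def symb_def[symmetric] inv
      by (intro integral_cong_AE) (measurable, use fourier_L2_eq[OF fL] in eventually_elim, simp)
    also have "\<dots> = fconst TYPE('a) * k * (LINT \<xi>|lborel. symb s \<xi> * rep_l2 (fourier_l2 (abs_l2 f)) \<xi> * bump c y \<xi>)"
      by (rule integral_mult_right_zero)
    finally have 1: "frac_laplacian (s / 2) f \<phi> = \<dots>" .
    have "regular g \<phi> = bil (inv_fourier_l2 w) (abs_l2 \<phi>)"
      by (simp add: w_def regular_def bil_abs gL schwartz_L2[OF \<phi>])
    also have "\<dots> = (LINT \<xi>|lborel. rep_l2 w \<xi> * rep_l2 (inv_fourier_l2 (abs_l2 \<phi>)) \<xi>)"
      by (subst bil_inv_fourier_l2) (rule bil_rep)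
    also have "\<dots> = (LINT \<xi>|lborel. fconst TYPE('a) * k * (rep_l2 w \<xi> * bump c y \<xi>))"
    proof (intro integral_cong_AE)
      show "AE \<xi> in lborel. rep_l2 w \<xi> * rep_l2 (inv_fourier_l2 (abs_l2 \<phi>)) \<xi> = fconst TYPE('a) * k * (rep_l2 w \<xi> * bump c y \<xi>)"
        using ae
      proof eventually_elim
        case (elim \<xi>)
        then have "rep_l2 (inv_fourier_l2 (abs_l2 \<phi>)) \<xi> = fconst TYPE('a) * k * bump c y \<xi>"
          by (simp add: eq_divide_eq mult_ac)
        then show ?case by (simp add: mult_ac)
      qed
    qed measurable
    also have "\<dots> = fconst TYPE('a) * k * (LINT \<xi>|lborel. rep_l2 w \<xi> * bump c y \<xi>)"
      by (rule integral_mult_right_zero)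
    finally have "(LINT \<xi>|lborel. symb s \<xi> * rep_l2 (fourier_l2 (abs_l2 f)) \<xi> * bump c y \<xi>) = (LINT \<xi>|lborel. rep_l2 w \<xi> * bump c y \<xi>)"
      using 1 g \<phi> k by (simp add: represents_def)
    then show "(LINT x|lborel. F x * bump c y x) = 0"
      using int[OF c, of y] by (simp add: F_def left_diff_distrib)
  qed
  then have "weighted s (fourier_l2 (abs_l2 f)) w"
    unfolding weighted_def by eventually_elim (simp add: F_def)
  then show ?thesis by blast
qed

section \<open>Multiplication operators\<close>

definition ebounded :: "real \<Rightarrow> ('a::euclidean_space \<Rightarrow> complex) \<Rightarrow> bool" where
  "ebounded C m \<longleftrightarrow> m \<in> borel_measurable borel \<and> 0 \<le> C \<and> (AE x in lborel. norm (m x) \<le> C)"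

definition mul :: "('a::euclidean_space \<Rightarrow> complex) \<Rightarrow> 'a l2 \<Rightarrow> 'a l2" where
  "mul m f = abs_l2 (\<lambda>x. m x * rep_l2 f x)"

lemma mul_mem: "ebounded C m \<Longrightarrow> (\<lambda>x. m x * rep_l2 f x) \<in> L2_space"
  by (rule L2_space_mult[where C=C]) (auto simp: ebounded_def)

lemma rep_mul: "ebounded C m \<Longrightarrow> AE x in lborel. rep_l2 (mul m f) x = m x * rep_l2 f x"
  unfolding mul_def by (rule rep_abs_l2[OF mul_mem])

lemma norm_l2_square: "(norm f)\<^sup>2 = (LINT x|lborel. (norm (rep_l2 f x))\<^sup>2)"
  by (simp add: norm_l2_rep L2_norm_def)

lemma norm_mul_le:
  assumes m: "ebounded C m" shows "norm (mul m f) \<le> C * norm f"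
proof (rule power2_le_imp_le)
  have C: "C \<ge> 0" and b: "AE x in lborel. norm (m x) \<le> C" using m by (auto simp: ebounded_def)
  have "(norm (mul m f))\<^sup>2 \<le> (LINT x|lborel. C\<^sup>2 * (norm (rep_l2 f x))\<^sup>2)"
    unfolding norm_l2_square
  proof (rule integral_mono_AE)
    show "AE x in lborel. (norm (rep_l2 (mul m f) x))\<^sup>2 \<le> C\<^sup>2 * (norm (rep_l2 f x))\<^sup>2"
      using rep_mul[OF m, of f] b
      by eventually_elim (auto simp: norm_mult power_mult_distrib intro!: mult_right_mono power_mono)
  qed (auto intro!: L2_space_integrable integrable_mult_right)
  also have "\<dots> = (C * norm f)\<^sup>2" by (simp add: norm_l2_square power_mult_distrib)
  finally show "(norm (mul m f))\<^sup>2 \<le> (C * norm f)\<^sup>2" .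
  show "0 \<le> C * norm f" using C by simp
qed

lemma mul_add: "ebounded C m \<Longrightarrow> mul m (f + g) = mul m f + mul m g"
proof (rule l2_eqI)
  assume m: "ebounded C m"
  show "AE x in lborel. rep_l2 (mul m (f + g)) x = rep_l2 (mul m f + mul m g) x"
    using rep_mul[OF m, of "f + g"] rep_mul[OF m, of f] rep_mul[OF m, of g] rep_l2_add[of f g] rep_l2_add[of "mul m f" "mul m g"]
    by eventually_elim (simp add: ring_distribs)
qed

lemma mul_scaleC: "ebounded C m \<Longrightarrow> mul m (scaleC c f) = scaleC c (mul m f)"
proof (rule l2_eqI)
  assume m: "ebounded C m"
  show "AE x in lborel. rep_l2 (mul m (scaleC c f)) x = rep_l2 (scaleC c (mul m f)) x"
    using rep_mul[OF m, of "scaleC c f"] rep_mul[OF m, of f] rep_l2_scaleC[of c f] rep_l2_scaleC[of c "mul m f"]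
    by eventually_elim simp
qed

lemma bounded_linear_mul: "ebounded C m \<Longrightarrow> bounded_linear (mul m)"
  by (rule bounded_linear_intro[where K=C])
    (auto simp: mul_add mul_scaleC scaleR_scaleC mult.commute dest: norm_mul_le)

lemma bil_mul: "ebounded C m \<Longrightarrow> bil (mul m f) g = bil f (mul m g)"
proof -
  assume m: "ebounded C m"
  then have [measurable]: "m \<in> borel_measurable borel" by (simp add: ebounded_def)
  have "bil (mul m f) g = (LINT x|lborel. m x * rep_l2 f x * rep_l2 g x)"
    unfolding bil_rep by (intro integral_cong_AE) (measurable, use rep_mul[OF m, of f] in eventually_elim, simp)
  also have "\<dots> = bil f (mul m g)"
    unfolding bil_rep by (intro integral_cong_AE) (measurable, use rep_mul[OF m, of g] in eventually_elim, simp)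
  finally show ?thesis .
qed

lemma cnj_measurable [measurable]: "cnj \<in> borel_measurable borel"
  by (intro borel_measurable_continuous_onI continuous_intros)

lemma cnj_mul: "ebounded C m \<Longrightarrow> cnj_l2 (mul m f) = mul (\<lambda>x. cnj (m x)) (cnj_l2 f)"
proof (rule l2_eqI)
  assume m: "ebounded C m"
  then have m': "ebounded C (\<lambda>x. cnj (m x))" by (auto simp: ebounded_def)
  show "AE x in lborel. rep_l2 (cnj_l2 (mul m f)) x = rep_l2 (mul (\<lambda>x. cnj (m x)) (cnj_l2 f)) x"
    using rep_mul[OF m, of f] rep_mul[OF m', of "cnj_l2 f"] rep_l2_cnj[of f] rep_l2_cnj[of "mul m f"]
    by eventually_elim simp
qed

lemma inner_mul: "ebounded C m \<Longrightarrow> (\<And>x. m x \<in> \<real>) \<Longrightarrow> inner (mul m f) g = inner f (mul m g)"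
  by (simp add: inner_l2_def bil_mul cnj_mul Reals_cnj_iff)

lemma ebounded_mult: "ebounded C m \<Longrightarrow> ebounded D n \<Longrightarrow> ebounded (C * D) (\<lambda>x. m x * n x)"
proof -
  assume m: "ebounded C m" and n: "ebounded D n"
  then have "AE x in lborel. norm (m x) \<le> C" "AE x in lborel. norm (n x) \<le> D" by (auto simp: ebounded_def)
  then have "AE x in lborel. norm (m x * n x) \<le> C * D"
    by eventually_elim (auto simp: norm_mult intro!: mult_mono' )
  then show ?thesis using m n by (auto simp: ebounded_def)
qed

lemma mul_mul: "ebounded C m \<Longrightarrow> ebounded D n \<Longrightarrow> mul m (mul n f) = mul (\<lambda>x. m x * n x) f"
proof (rule l2_eqI)
  assume m: "ebounded C m" and n: "ebounded D n"
  show "AE x in lborel. rep_l2 (mul m (mul n f)) x = rep_l2 (mul (\<lambda>x. m x * n x) f) x"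
    using rep_mul[OF m, of "mul n f"] rep_mul[OF n, of f] rep_mul[OF ebounded_mult[OF m n], of f]
    by eventually_elim simp
qed

text \<open>Strong convergence of uniformly bounded multipliers, by dominated convergence.\<close>

lemma mul_tendsto:
  fixes f :: "'a::euclidean_space l2"
  assumes mn: "\<And>n. ebounded C (mn n)" and m: "ebounded C m" and lim: "AE x in lborel. (\<lambda>n. mn n x) \<longlonglongrightarrow> m x"
  shows "(\<lambda>n. mul (mn n) f) \<longlonglongrightarrow> mul m f"
proof -
  have [measurable]: "mn n \<in> borel_measurable borel" "m \<in> borel_measurable borel" for n
    using mn m by (auto simp: ebounded_def)
  have C: "C \<ge> 0" using m by (simp add: ebounded_def)
  have eq: "(norm (mul (mn n) f - mul m f))\<^sup>2 = (LINT x|lborel. (norm ((mn n x - m x) * rep_l2 f x))\<^sup>2)" for n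
    unfolding norm_l2_square
    by (intro integral_cong_AE)
      (measurable, use rep_mul[OF mn[of n], of f] rep_mul[OF m, of f] rep_l2_diff[of "mul (mn n) f" "mul m f"] in eventually_elim,
        simp add: left_diff_distrib)
  have "(\<lambda>n. LINT x|lborel. (norm ((mn n x - m x) * rep_l2 f x))\<^sup>2) \<longlonglongrightarrow> (LINT x|(lborel :: 'a measure). 0)"
  proof (rule integral_dominated_convergence)
    show "integrable lborel (\<lambda>x. (2 * C)\<^sup>2 * (norm (rep_l2 f x))\<^sup>2)"
      by (intro integrable_mult_right L2_space_integrable) simp
    show "AE x in lborel. (\<lambda>n. (norm ((mn n x - m x) * rep_l2 f x))\<^sup>2) \<longlonglongrightarrow> 0"
      using lim
    proof eventually_elim
      case (elim x)
      have "(\<lambda>n. (norm ((mn n x - m x) * rep_l2 f x))\<^sup>2) \<longlonglongrightarrow> (norm ((m x - m x) * rep_l2 f x))\<^sup>2"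
        by (intro tendsto_intros elim)
      then show ?case by simp
    qed
    fix n
    have "AE x in lborel. norm (mn n x) \<le> C" "AE x in lborel. norm (m x) \<le> C"
      using mn m by (auto simp: ebounded_def)
    then show "AE x in lborel. norm ((norm ((mn n x - m x) * rep_l2 f x))\<^sup>2) \<le> (2 * C)\<^sup>2 * (norm (rep_l2 f x))\<^sup>2"
    proof eventually_elim
      case (elim x)
      then have "norm (mn n x - m x) \<le> 2 * C" using norm_triangle_ineq4[of "mn n x" "m x"] by linarith
      then have "(norm (mn n x - m x))\<^sup>2 \<le> (2 * C)\<^sup>2" by (intro power_mono) auto
      from mult_right_mono[OF this, of "(norm (rep_l2 f x))\<^sup>2"]
      show ?case by (simp add: norm_mult power_mult_distrib)
    qed
  qed auto
  then have "(\<lambda>n. (norm (mul (mn n) f - mul m f))\<^sup>2) \<longlonglongrightarrow> 0" by (simp add: eq)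
  then have "(\<lambda>n. sqrt ((norm (mul (mn n) f - mul m f))\<^sup>2)) \<longlonglongrightarrow> sqrt 0" by (rule tendsto_real_sqrt)
  then show ?thesis by (simp add: LIM_zero_iff tendsto_norm_zero_iff)
qed

text \<open>The multipliers depend on time only strongly continuously, not in operator norm; uniform boundedness
  lets the argument move with time as well.\<close>

lemma continuous_on_mul:
  assumes m: "\<And>t. t \<in> S \<Longrightarrow> ebounded C (m t)" and cont: "\<And>x. continuous_on S (\<lambda>t. m t x)"
    and f: "continuous_on S f"
  shows "continuous_on S (\<lambda>t::real. mul (m t) (f t))"
  unfolding continuous_on_sequentially
proof (intro allI ballI impI)
  fix X a assume a: "a \<in> S" and "(\<forall>n. X n \<in> S) \<and> X \<longlonglongrightarrow> a"
  then have X: "\<And>n. X n \<in> S" "X \<longlonglongrightarrow> a" by auto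
  have fX: "(\<lambda>n. f (X n)) \<longlonglongrightarrow> f a"
    using f a X unfolding continuous_on_sequentially by (auto simp: o_def)
  have mX: "(\<lambda>n. m (X n) x) \<longlonglongrightarrow> m a x" for x
    using cont[of x] a X unfolding continuous_on_sequentially by (auto simp: o_def)
  have 1: "(\<lambda>n. mul (m (X n)) (f a)) \<longlonglongrightarrow> mul (m a) (f a)"
    by (rule mul_tendsto[OF m[OF X(1)] m[OF a]]) (auto intro: mX)
  have "(\<lambda>n. mul (m (X n)) (f (X n) - f a)) \<longlonglongrightarrow> 0"
  proof (rule Lim_null_comparison)
    show "\<forall>\<^sub>F n in sequentially. norm (mul (m (X n)) (f (X n) - f a)) \<le> C * norm (f (X n) - f a)"
      using norm_mul_le[OF m[OF X(1)]] by auto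
    show "(\<lambda>n. C * norm (f (X n) - f a)) \<longlonglongrightarrow> 0"
      using tendsto_mult_right_zero[OF tendsto_norm_zero[OF LIM_zero[OF fX]]] by simp
  qed
  from tendsto_add[OF this 1]
  have "(\<lambda>n. mul (m (X n)) (f (X n) - f a) + mul (m (X n)) (f a)) \<longlonglongrightarrow> mul (m a) (f a)" by simp
  moreover have "mul (m (X n)) (f (X n) - f a) + mul (m (X n)) (f a) = mul (m (X n)) (f (X n))" for n
    by (simp flip: mul_add[OF m[OF X(1)]])
  ultimately show "((\<lambda>t. mul (m t) (f t)) \<circ> X) \<longlonglongrightarrow> mul (m a) (f a)" by (simp add: o_def)
qed

section \<open>Evolution equations with Lipschitz right-hand side\<close>

text \<open>In the supremum norm weighted by \<open>exp (- 2 L t)\<close> the Picard map is a contraction with factor one half,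
  so that no restriction on the length of the time interval is needed.\<close>

lemma lipschitz_ode_solution:
  fixes K :: "real \<Rightarrow> 'b::banach \<Rightarrow> 'b"
  assumes T: "T \<ge> 0" and L: "L > 0"
    and lip: "\<And>t x y. t \<in> {0..T} \<Longrightarrow> norm (K t x - K t y) \<le> L * norm (x - y)"
    and cont: "\<And>Y. continuous_on {0..T} Y \<Longrightarrow> continuous_on {0..T} (\<lambda>t. K t (Y t))"
  shows "\<exists>Y. Y 0 = Y0 \<and> (\<forall>t\<in>{0..T}. (Y has_vector_derivative K t (Y t)) (at t within {0..T}))"
proof -
  \<comment> \<open>bounded continuous functions on the whole line are used as the complete metric space; \<open>cl\<close> projects time to the interval\<close>
  define cl where "cl t = max 0 (min T t)" for t :: real
  have cl: "cl t \<in> {0..T}" "t \<in> {0..T} \<Longrightarrow> cl t = t" for t using T by (auto simp: cl_def)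
  have cl_cont: "continuous_on UNIV cl" unfolding cl_def by (intro continuous_intros)
  \<comment> \<open>the Picard map, conjugated by the weight\<close>
  define P where "P Z c = exp (- 2 * L * c) *\<^sub>R (Y0 + integral {0..c} (\<lambda>\<tau>. K \<tau> (exp (2 * L * \<tau>) *\<^sub>R apply_bcontfun Z \<tau>)))"
    for Z :: "real \<Rightarrow>\<^sub>C 'b" and c
  have Kc: "continuous_on {0..T} (\<lambda>\<tau>. K \<tau> (exp (2 * L * \<tau>) *\<^sub>R apply_bcontfun Z \<tau>))" for Z :: "real \<Rightarrow>\<^sub>C 'b"
    by (intro cont continuous_intros) (auto intro: continuous_on_subset[OF continuous_on_apply_bcontfun])
  have Ki: "(\<lambda>\<tau>. K \<tau> (exp (2 * L * \<tau>) *\<^sub>R apply_bcontfun Z \<tau>)) integrable_on {0..c}" if "c \<in> {0..T}" for Z :: "real \<Rightarrow>\<^sub>C 'b" and c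
    by (rule integrable_continuous_interval[OF continuous_on_subset[OF Kc]]) (use that in auto)
  have P_cont: "continuous_on {0..T} (P Z)" for Z
    unfolding P_def by (intro continuous_intros indefinite_integral_continuous_1 Ki) (use T in auto)
  have P_mem: "(\<lambda>t. P Z (cl t)) \<in> bcontfun" for Z
  proof -
    have "continuous_on UNIV (\<lambda>t. P Z (cl t))"
      by (rule continuous_on_compose2[OF P_cont cl_cont]) (use cl(1) in auto)
    moreover have "bounded (P Z ` {0..T})"
      by (intro compact_imp_bounded compact_continuous_image P_cont compact_Icc)
    then have "bounded (range (\<lambda>t. P Z (cl t)))"
      by (rule bounded_subset) (use cl(1) in auto)
    ultimately show ?thesis by (simp add: bcontfun_def)
  qed
  define \<Gamma> where "\<Gamma> Z = Bcontfun (\<lambda>t. P Z (cl t))" for Z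
  have \<Gamma>: "apply_bcontfun (\<Gamma> Z) t = P Z (cl t)" for Z t
    unfolding \<Gamma>_def by (subst Bcontfun_inverse[OF P_mem]) simp
  have "dist (\<Gamma> Z) (\<Gamma> W) \<le> 1/2 * dist Z W" for Z W
  proof (rule dist_bound)
    fix t :: real
    define c where "c = cl t"
    have c: "c \<in> {0..T}" using cl(1) by (simp add: c_def)
    define D where "D = dist Z W"
    let ?k = "\<lambda>Z \<tau>. K \<tau> (exp (2 * L * \<tau>) *\<^sub>R apply_bcontfun Z \<tau>)"
    have FTC: "((\<lambda>\<tau>. L * (exp (2 * L * \<tau>) * D)) has_integral (exp (2 * L * c) * D / 2 - exp (2 * L * 0) * D / 2)) {0..c}"
      using c L by (intro fundamental_theorem_of_calculus)
        (auto intro!: derivative_eq_intros simp flip: has_real_derivative_iff_has_vector_derivative)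
    have "norm (integral {0..c} (?k Z) - integral {0..c} (?k W)) = norm (integral {0..c} (\<lambda>\<tau>. ?k Z \<tau> - ?k W \<tau>))"
      by (subst Henstock_Kurzweil_Integration.integral_diff[OF Ki Ki, OF c c]) (rule refl)
    also have "\<dots> \<le> integral {0..c} (\<lambda>\<tau>. L * (exp (2 * L * \<tau>) * D))"
    proof (rule integral_norm_bound_integral)
      show "(\<lambda>\<tau>. ?k Z \<tau> - ?k W \<tau>) integrable_on {0..c}" by (intro Henstock_Kurzweil_Integration.integrable_diff Ki c)
      show "(\<lambda>\<tau>. L * (exp (2 * L * \<tau>) * D)) integrable_on {0..c}" using FTC by blast
      fix \<tau> assume "\<tau> \<in> {0..c}"
      then have \<tau>: "\<tau> \<in> {0..T}" using c by auto
      have "norm (?k Z \<tau> - ?k W \<tau>) \<le> L * norm (exp (2 * L * \<tau>) *\<^sub>R apply_bcontfun Z \<tau> - exp (2 * L * \<tau>) *\<^sub>R apply_bcontfun W \<tau>)"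
        by (rule lip[OF \<tau>])
      also have "\<dots> = L * (exp (2 * L * \<tau>) * dist (apply_bcontfun Z \<tau>) (apply_bcontfun W \<tau>))"
        by (simp add: dist_norm flip: scaleR_diff_right)
      also have "\<dots> \<le> L * (exp (2 * L * \<tau>) * D)"
        using L by (intro mult_left_mono) (auto simp: D_def dist_bounded)
      finally show "norm (?k Z \<tau> - ?k W \<tau>) \<le> L * (exp (2 * L * \<tau>) * D)" .
    qed
    also have "\<dots> \<le> exp (2 * L * c) * D / 2"
      using integral_unique[OF FTC] by (simp add: D_def)
    finally have le: "norm (integral {0..c} (?k Z) - integral {0..c} (?k W)) \<le> exp (2 * L * c) * D / 2" .
    have "dist (apply_bcontfun (\<Gamma> Z) t) (apply_bcontfun (\<Gamma> W) t)
        = exp (- 2 * L * c) * norm (integral {0..c} (?k Z) - integral {0..c} (?k W))"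
      by (simp add: \<Gamma> P_def c_def[symmetric] dist_norm flip: scaleR_diff_right)
    also have "\<dots> \<le> exp (- 2 * L * c) * (exp (2 * L * c) * D / 2)"
      by (intro mult_left_mono le) simp
    also have "\<dots> = 1/2 * D" by (simp flip: exp_add mult.assoc)
    finally show "dist (apply_bcontfun (\<Gamma> Z) t) (apply_bcontfun (\<Gamma> W) t) \<le> 1/2 * dist Z W" by (simp add: D_def)
  qed
  then obtain Z where Z: "\<Gamma> Z = Z"
    using banach_fix_type[of "1/2" \<Gamma>] by auto
  define Y where "Y t = Y0 + integral {0..t} (\<lambda>\<tau>. K \<tau> (exp (2 * L * \<tau>) *\<^sub>R apply_bcontfun Z \<tau>))" for t
  have Y: "exp (2 * L * t) *\<^sub>R apply_bcontfun Z t = Y t" if "t \<in> {0..T}" for t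
    using \<Gamma>[of Z t] cl(2)[OF that] by (simp add: Z P_def Y_def flip: exp_add)
  have "(Y has_vector_derivative K t (Y t)) (at t within {0..T})" if t: "t \<in> {0..T}" for t
  proof -
    have "((\<lambda>u. integral {0..u} (\<lambda>\<tau>. K \<tau> (exp (2 * L * \<tau>) *\<^sub>R apply_bcontfun Z \<tau>))) has_vector_derivative
        K t (exp (2 * L * t) *\<^sub>R apply_bcontfun Z t)) (at t within {0..T})"
      by (rule integral_has_vector_derivative[OF Kc t])
    then show ?thesis
      unfolding Y_def[abs_def] Y[OF t, unfolded Y_def, symmetric]
      by (auto intro!: derivative_eq_intros)
  qed
  moreover have "Y 0 = Y0" by (simp add: Y_def)
  ultimately show ?thesis by blast
qed


instance l2 :: (euclidean_space) banach ..

section \<open>Time dependent multipliers\<close>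

lemma mul_diff: "ebounded C m \<Longrightarrow> mul m (f - g) = mul m f - mul m g"
  using linear_diff[OF bounded_linear.linear[OF bounded_linear_mul]] by blast

lemma mul_minus: "ebounded C m \<Longrightarrow> mul m (- f) = - mul m f"
  using linear_neg[OF bounded_linear.linear[OF bounded_linear_mul]] by blast

lemma mul_diff_left: "ebounded C m \<Longrightarrow> ebounded D n \<Longrightarrow> mul (\<lambda>x. m x - n x) f = mul m f - mul n f"
  unfolding mul_def by (simp add: left_diff_distrib abs_l2_diff mul_mem)

lemma mul_add_left: "ebounded C m \<Longrightarrow> ebounded D n \<Longrightarrow> mul (\<lambda>x. m x + n x) f = mul m f + mul n f"
  unfolding mul_def by (simp add: ring_distribs abs_l2_add mul_mem)

lemma mul_cmult_left: "ebounded C m \<Longrightarrow> mul (\<lambda>x. complex_of_real r * m x) f = r *\<^sub>R mul m f"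
  unfolding mul_def by (simp add: scaleR_scaleC mult.assoc abs_l2_scaleC mul_mem)

lemma mul_one [simp]: "mul (\<lambda>x. 1) f = f"
  by (simp add: mul_def)

lemma has_vector_derivative_quadratic:
  fixes f :: "real \<Rightarrow> 'b::real_normed_vector"
  assumes "\<And>\<tau>. norm (f \<tau> - f t - (\<tau> - t) *\<^sub>R f') \<le> M * (\<tau> - t)\<^sup>2"
  shows "(f has_vector_derivative f') (at t within S)"
proof -
  have "((\<lambda>\<tau>. (1 / norm (\<tau> - t)) *\<^sub>R (f \<tau> - f t - (\<tau> - t) *\<^sub>R f')) \<longlongrightarrow> 0) (at t within S)"
  proof (rule Lim_null_comparison)
    show "\<forall>\<^sub>F \<tau> in at t within S. norm ((1 / norm (\<tau> - t)) *\<^sub>R (f \<tau> - f t - (\<tau> - t) *\<^sub>R f')) \<le> M * \<bar>\<tau> - t\<bar>"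
    proof (rule eventually_at_topological[THEN iffD2], intro exI[of _ UNIV] conjI ballI impI)
      fix \<tau> assume "\<tau> \<noteq> t"
      then have "norm (f \<tau> - f t - (\<tau> - t) *\<^sub>R f') / \<bar>\<tau> - t\<bar> \<le> M * (\<tau> - t)\<^sup>2 / \<bar>\<tau> - t\<bar>"
        by (intro divide_right_mono assms) auto
      also have "(\<tau> - t)\<^sup>2 = \<bar>\<tau> - t\<bar> * \<bar>\<tau> - t\<bar>" by (simp add: power2_eq_square)
      also have "M * (\<bar>\<tau> - t\<bar> * \<bar>\<tau> - t\<bar>) / \<bar>\<tau> - t\<bar> = M * \<bar>\<tau> - t\<bar>"
        using \<open>\<tau> \<noteq> t\<close> by (simp del: abs_mult_self_eq)
      finally show "norm ((1 / norm (\<tau> - t)) *\<^sub>R (f \<tau> - f t - (\<tau> - t) *\<^sub>R f')) \<le> M * \<bar>\<tau> - t\<bar>" by simp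
    qed auto
    have "((\<lambda>\<tau>. M * \<bar>\<tau> - t\<bar>) \<longlongrightarrow> M * \<bar>t - t\<bar>) (at t within S)" by (intro tendsto_intros)
    then show "((\<lambda>\<tau>. M * \<bar>\<tau> - t\<bar>) \<longlongrightarrow> 0) (at t within S)" by simp
  qed
  then show ?thesis
    unfolding has_vector_derivative_def has_derivative_within by (simp add: bounded_linear_scaleR_left algebra_simps)
qed

text \<open>A uniform quadratic Taylor bound for the multipliers means that the operators are differentiable in
  operator norm, and the product rule for applying an operator applies.\<close>

lemma mul_has_vector_derivative:
  fixes n n' :: "real \<Rightarrow> 'a::euclidean_space \<Rightarrow> complex"
  assumes n: "\<And>\<tau>. ebounded C (n \<tau>)" and n': "ebounded D (n' t)"
    and quad: "\<And>\<tau> x. norm (n \<tau> x - n t x - complex_of_real (\<tau> - t) * n' t x) \<le> M * (\<tau> - t)\<^sup>2"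
    and y: "(y has_vector_derivative y') (at t within S)"
  shows "((\<lambda>\<tau>. mul (n \<tau>) (y \<tau>)) has_vector_derivative (mul (n t) y' + mul (n' t) (y t))) (at t within S)"
proof -
  have M: "0 \<le> M" using order_trans[OF norm_ge_zero quad[of "t + 1" 0]] by simp
  define N where "N \<tau> = Blinfun (mul (n \<tau>))" for \<tau>
  define N' where "N' = Blinfun (mul (n' t))"
  have N: "blinfun_apply (N \<tau>) = mul (n \<tau>)" for \<tau>
    unfolding N_def by (rule bounded_linear_Blinfun_apply[OF bounded_linear_mul[OF n]])
  have N': "blinfun_apply N' = mul (n' t)"
    unfolding N'_def by (rule bounded_linear_Blinfun_apply[OF bounded_linear_mul[OF n']])
  have "(N has_vector_derivative N') (at t within S)"
  proof (rule has_vector_derivative_quadratic)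
    fix \<tau>
    show "norm (N \<tau> - N t - (\<tau> - t) *\<^sub>R N') \<le> M * (\<tau> - t)\<^sup>2"
    proof (rule norm_blinfun_bound)
      fix f :: "'a l2"
      have eb: "ebounded (M * (\<tau> - t)\<^sup>2) (\<lambda>x. n \<tau> x - n t x - complex_of_real (\<tau> - t) * n' t x)"
        using n[of \<tau>] n[of t] n' quad M by (auto simp: ebounded_def)
      have e1: "ebounded (C + C) (\<lambda>x. n \<tau> x - n t x)"
      proof -
        have "AE x in lborel. norm (n \<tau> x) \<le> C" "AE x in lborel. norm (n t x) \<le> C"
          using n[of \<tau>] n[of t] by (auto simp: ebounded_def)
        then have "AE x in lborel. norm (n \<tau> x - n t x) \<le> C + C"
          by eventually_elim (rule norm_triangle_le_diff, simp)
        then show ?thesis using n[of \<tau>] n[of t] by (auto simp: ebounded_def)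
      qed
      have e2: "ebounded (\<bar>\<tau> - t\<bar> * D) (\<lambda>x. complex_of_real (\<tau> - t) * n' t x)"
        by (rule ebounded_mult[OF _ n']) (auto simp: ebounded_def simp flip: of_real_diff)
      have "blinfun_apply (N \<tau> - N t - (\<tau> - t) *\<^sub>R N') f = mul (\<lambda>x. n \<tau> x - n t x - complex_of_real (\<tau> - t) * n' t x) f"
        unfolding mul_diff_left[OF e1 e2] mul_diff_left[OF n n] mul_cmult_left[OF n']
        by (simp add: N N' blinfun.diff_left blinfun.scaleR_left)
      then show "norm (blinfun_apply (N \<tau> - N t - (\<tau> - t) *\<^sub>R N') f) \<le> M * (\<tau> - t)\<^sup>2 * norm f"
        using norm_mul_le[OF eb, of f] by simp
    qed (use M in simp)
  qed
  from bounded_bilinear.has_vector_derivative[OF bounded_bilinear_blinfun_apply this y]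
  show ?thesis by (simp add: N N')
qed

lemma cis_taylor: "norm (cis y - cis x - \<i> * complex_of_real (y - x) * cis x) \<le> (y - x)\<^sup>2 / 2"
proof -
  have "norm (cis (y - x) - (1 + \<i> * complex_of_real (y - x))) \<le> (y - x)\<^sup>2 / 2"
    using iexp_approx1[of "y - x" 1] by (simp add: cis_conv_exp power2_eq_square)
  then have "norm (cis x) * norm (cis (y - x) - (1 + \<i> * complex_of_real (y - x))) \<le> (y - x)\<^sup>2 / 2" by simp
  also have "norm (cis x) * norm (cis (y - x) - (1 + \<i> * complex_of_real (y - x))) = norm (cis y - cis x - \<i> * complex_of_real (y - x) * cis x)"
    unfolding norm_mult[symmetric] by (simp add: algebra_simps cis_mult)
  finally show ?thesis .
qed

lemma cos_taylor: "\<bar>cos y - cos x + (y - x) * sin x\<bar> \<le> (y - x)\<^sup>2" for x y :: real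
proof -
  have "\<bar>Re (cis y - cis x - \<i> * complex_of_real (y - x) * cis x)\<bar> \<le> (y - x)\<^sup>2 / 2"
    by (rule order_trans[OF abs_Re_le_cmod cis_taylor])
  also have "\<dots> \<le> (y - x)\<^sup>2" by simp
  finally show ?thesis by (simp add: algebra_simps)
qed

lemma sin_taylor: "\<bar>sin y - sin x - (y - x) * cos x\<bar> \<le> (y - x)\<^sup>2" for x y :: real
proof -
  have "\<bar>Im (cis y - cis x - \<i> * complex_of_real (y - x) * cis x)\<bar> \<le> (y - x)\<^sup>2 / 2"
    by (rule order_trans[OF abs_Im_le_cmod cis_taylor])
  also have "\<dots> \<le> (y - x)\<^sup>2" by simp
  finally show ?thesis by (simp add: algebra_simps)
qed

definition cosm :: "real \<Rightarrow> real \<Rightarrow> 'a::euclidean_space \<Rightarrow> complex" where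
  "cosm s t \<xi> = complex_of_real (cos (t * norm \<xi> powr s))"

definition sinm :: "real \<Rightarrow> real \<Rightarrow> 'a::euclidean_space \<Rightarrow> complex" where
  "sinm s t \<xi> = complex_of_real (sin (t * norm \<xi> powr s))"

text \<open>The cut-off of the frequencies at which the symbol exceeds \<open>R\<close>; below it, the symbol is a
  bounded multiplier.\<close>

definition lowpass :: "real \<Rightarrow> real \<Rightarrow> 'a::euclidean_space \<Rightarrow> complex" where
  "lowpass s R \<xi> = (if norm \<xi> powr s \<le> R then 1 else 0)"

lemma ebounded_cosm: "ebounded 1 (cosm s t)"
  unfolding ebounded_def cosm_def[abs_def] by auto

lemma ebounded_sinm: "ebounded 1 (sinm s t)"
  unfolding ebounded_def sinm_def[abs_def] by auto

lemma ebounded_lowpass: "ebounded 1 (lowpass s R)"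
  unfolding ebounded_def lowpass_def[abs_def] by auto

lemma ebounded_lowpass_symb: "R \<ge> 0 \<Longrightarrow> ebounded R (\<lambda>\<xi>. lowpass s R \<xi> * symb s \<xi>)"
  unfolding ebounded_def lowpass_def[abs_def] symb_def[abs_def] by auto

text \<open>Below the cut-off the angle \<open>t |\<xi>|\<^sup>s\<close> moves with speed at most \<open>R\<close>, so that the rotations are
  differentiable in operator norm.\<close>

lemma lowpass_derivative:
  fixes f f' :: "real \<Rightarrow> real"
  assumes R: "R \<ge> 0" and y: "(y has_vector_derivative y') (at t within S)"
    and n: "\<And>t. n t = (\<lambda>\<xi>. complex_of_real (f (t * norm \<xi> powr s)))" "n' = (\<lambda>\<xi>. complex_of_real (f' (t * norm \<xi> powr s)))"
    and bound: "\<And>t. ebounded 1 (n t)" "ebounded 1 n'"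
    and taylor: "\<And>x y. \<bar>f y - f x - (y - x) * f' x\<bar> \<le> (y - x)\<^sup>2"
  shows "((\<lambda>\<tau>. mul (lowpass s R) (mul (n \<tau>) (y \<tau>))) has_vector_derivative
    (mul (lowpass s R) (mul (n t) y') + mul (\<lambda>\<xi>. lowpass s R \<xi> * symb s \<xi>) (mul n' (y t)))) (at t within S)"
proof -
  have "((\<lambda>\<tau>. mul (\<lambda>\<xi>. lowpass s R \<xi> * n \<tau> \<xi>) (y \<tau>)) has_vector_derivative
      (mul (\<lambda>\<xi>. lowpass s R \<xi> * n t \<xi>) y' + mul (\<lambda>\<xi>. lowpass s R \<xi> * symb s \<xi> * n' \<xi>) (y t))) (at t within S)"
  proof (rule mul_has_vector_derivative[OF _ _ _ y, where M="R\<^sup>2"])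
    show "ebounded (1 * 1) (\<lambda>\<xi>. lowpass s R \<xi> * n \<tau> \<xi>)" for \<tau>
      by (intro ebounded_mult ebounded_lowpass bound)
    show "ebounded (R * 1) (\<lambda>\<xi>. lowpass s R \<xi> * symb s \<xi> * n' \<xi>)"
      by (intro ebounded_mult ebounded_lowpass_symb R bound)
    fix \<tau> and \<xi> :: 'a
    define m where "m = norm \<xi> powr s"
    show "norm (lowpass s R \<xi> * n \<tau> \<xi> - lowpass s R \<xi> * n t \<xi>
        - complex_of_real (\<tau> - t) * (lowpass s R \<xi> * symb s \<xi> * n' \<xi>)) \<le> R\<^sup>2 * (\<tau> - t)\<^sup>2"
    proof (cases "m \<le> R")
      case True
      have m: "m \<ge> 0" by (simp add: m_def)
      have "norm (n \<tau> \<xi> - n t \<xi> - complex_of_real (\<tau> - t) * (symb s \<xi> * n' \<xi>))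
          = \<bar>f (\<tau> * m) - f (t * m) - (\<tau> * m - t * m) * f' (t * m)\<bar>"
        unfolding n symb_def m_def[symmetric]
        by (simp only: norm_of_real flip: of_real_mult of_real_diff) (simp add: algebra_simps)
      also have "\<dots> \<le> (\<tau> * m - t * m)\<^sup>2" by (rule taylor)
      also have "\<dots> = m\<^sup>2 * (\<tau> - t)\<^sup>2" by (simp add: power2_eq_square algebra_simps)
      also have "\<dots> \<le> R\<^sup>2 * (\<tau> - t)\<^sup>2" using True m by (intro mult_right_mono power_mono) auto
      finally show ?thesis using True by (simp add: lowpass_def m_def)
    qed (simp add: lowpass_def m_def)
  qed
  then show ?thesis
    by (simp only: mul_mul[OF ebounded_lowpass bound(1)] mul_mul[OF ebounded_lowpass_symb[OF R] bound(2)])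
qed

lemma lowpass_cosm_derivative:
  assumes R: "R \<ge> 0" and y: "(y has_vector_derivative y') (at t within S)"
  shows "((\<lambda>\<tau>. mul (lowpass s R) (mul (cosm s \<tau>) (y \<tau>))) has_vector_derivative
    (mul (lowpass s R) (mul (cosm s t) y') - mul (\<lambda>\<xi>. lowpass s R \<xi> * symb s \<xi>) (mul (sinm s t) (y t)))) (at t within S)"
proof -
  have minus: "mul (\<lambda>\<xi>. complex_of_real (- sin (t * norm \<xi> powr s))) f = - mul (sinm s t) f" for f :: "'a l2"
    using mul_cmult_left[OF ebounded_sinm[of s t], of "-1" f] by (simp add: sinm_def)
  have n: "cosm s t = (\<lambda>\<xi> :: 'a. complex_of_real (cos (t * norm \<xi> powr s)))" for t
    by (simp add: cosm_def[abs_def])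
  have bound: "ebounded 1 (\<lambda>\<xi> :: 'a. complex_of_real (- sin (t * norm \<xi> powr s)))"
    unfolding ebounded_def by auto
  have taylor: "\<bar>cos y - cos x - (y - x) * - sin x\<bar> \<le> (y - x)\<^sup>2" for x y :: real
    using cos_taylor[of y x] by simp
  show ?thesis
    using lowpass_derivative[OF R y n refl ebounded_cosm bound taylor]
    unfolding minus mul_minus[OF ebounded_lowpass_symb[OF R]] by simp
qed

lemma lowpass_sinm_derivative:
  assumes R: "R \<ge> 0" and y: "(y has_vector_derivative y') (at t within S)"
  shows "((\<lambda>\<tau>. mul (lowpass s R) (mul (sinm s \<tau>) (y \<tau>))) has_vector_derivative
    (mul (lowpass s R) (mul (sinm s t) y') + mul (\<lambda>\<xi>. lowpass s R \<xi> * symb s \<xi>) (mul (cosm s t) (y t)))) (at t within S)"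
  by (rule lowpass_derivative[where f=sin and f'=cos, OF R y _ _ ebounded_sinm ebounded_cosm sin_taylor])
    (simp_all add: sinm_def[abs_def] cosm_def[abs_def])

section \<open>The damped wave equation on the Fourier side\<close>

lemma mul_cong: "(\<And>x. m x = n x) \<Longrightarrow> mul m f = mul n f"
  by (simp add: mul_def)

lemma inner_mul_nonneg:
  assumes m: "ebounded C m" and pos: "\<And>x. m x \<in> \<real>\<^sub>\<ge>\<^sub>0"
  shows "0 \<le> inner (mul m f) f"
proof -
  have [measurable]: "m \<in> borel_measurable borel" using m by (simp add: ebounded_def)
  have "inner (mul m f) f = Re (LINT x|lborel. complex_of_real (Re (m x) * (norm (rep_l2 f x))\<^sup>2))"
    unfolding inner_l2_rep
  proof (intro arg_cong[of _ _ Re] integral_cong_AE)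
    show "AE x in lborel. rep_l2 (mul m f) x * cnj (rep_l2 f x) = complex_of_real (Re (m x) * (norm (rep_l2 f x))\<^sup>2)"
      using rep_mul[OF m, of f]
    proof eventually_elim
      case (elim x)
      obtain r where r: "m x = complex_of_real r" using pos[of x] by (auto simp: nonneg_Reals_def)
      show ?case unfolding elim r Re_complex_of_real of_real_mult complex_norm_square by (simp only: mult.assoc)
    qed
  qed measurable
  also have "\<dots> = (LINT x|lborel. Re (m x) * (norm (rep_l2 f x))\<^sup>2)" by (simp del: of_real_mult)
  also have "\<dots> \<ge> 0"
    using pos by (intro Bochner_Integration.integral_nonneg) (auto simp: complex_nonneg_Reals_iff)
  finally show ?thesis .
qed

locale damped_wave =
  fixes s T :: real and a b :: "'a::euclidean_space \<Rightarrow> complex" and A B :: real and f0 f1 q0 :: "'a l2"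
  assumes s: "s > 0" and T: "T > 0"
    and a: "ebounded A a" "\<And>x. a x \<in> \<real>\<^sub>\<ge>\<^sub>0" and b: "ebounded B b" "\<And>x. b x \<in> \<real>\<^sub>\<ge>\<^sub>0"
    and q0: "weighted s (fourier_l2 f0) q0"
begin

text \<open>The unknown is \<open>(p, y1, y2)\<close>, where \<open>p\<close> is the Fourier transform of \<open>u\<close> and \<open>(y1, y2)\<close> is
  the pair \<open>(|\<xi>|\<^sup>s p, p')\<close> rotated back by the free evolution. In these variables the unbounded
  symbol disappears from the equation. \<open>vel\<close> and \<open>strain\<close> rotate \<open>(y1, y2)\<close> forward again and give the velocity \<open>p'\<close> and \<open>|\<xi>|\<^sup>s p\<close>.\<close>

definition vel :: "real \<Rightarrow> 'a l2 \<times> 'a l2 \<times> 'a l2 \<Rightarrow> 'a l2" where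
  "vel t z = mul (cosm s t) (snd (snd z)) - mul (sinm s t) (fst (snd z))"

definition strain :: "real \<Rightarrow> 'a l2 \<times> 'a l2 \<times> 'a l2 \<Rightarrow> 'a l2" where
  "strain t z = mul (cosm s t) (fst (snd z)) + mul (sinm s t) (snd (snd z))"

definition force :: "'a l2 \<Rightarrow> 'a l2 \<Rightarrow> 'a l2" where
  "force p v = fourier_l2 (mul a (inv_fourier_l2 p) + mul b (inv_fourier_l2 v))"

definition rhs :: "real \<Rightarrow> 'a l2 \<times> 'a l2 \<times> 'a l2 \<Rightarrow> 'a l2 \<times> 'a l2 \<times> 'a l2" where
  "rhs t z = (vel t z, mul (sinm s t) (force (fst z) (vel t z)), - mul (cosm s t) (force (fst z) (vel t z)))"

lemma AB: "A \<ge> 0" "B \<ge> 0"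
  using a(1) b(1) by (auto simp: ebounded_def)

lemma vel_diff: "vel t (z - w) = vel t z - vel t w"
  by (simp add: vel_def mul_diff[OF ebounded_cosm] mul_diff[OF ebounded_sinm])

lemma force_diff: "force (p - p') (v - v') = force p v - force p' v'"
proof -
  interpret F: bounded_linear "fourier_l2 :: 'a l2 \<Rightarrow> 'a l2" by (rule bounded_linear_fourier_l2)
  interpret I: bounded_linear "inv_fourier_l2 :: 'a l2 \<Rightarrow> 'a l2" by (rule bounded_linear_inv_fourier_l2)
  show ?thesis
    unfolding force_def F.diff[symmetric] I.diff mul_diff[OF a(1)] mul_diff[OF b(1)] by (simp add: algebra_simps)
qed

lemma rhs_diff: "rhs t z - rhs t w = rhs t (z - w)"
  by (simp add: rhs_def vel_diff force_diff mul_diff[OF ebounded_cosm] mul_diff[OF ebounded_sinm])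

lemma norm_force_le: "norm (force p v) \<le> A * norm p + B * norm v"
proof -
  have "norm (force p v) \<le> norm (mul a (inv_fourier_l2 p)) + norm (mul b (inv_fourier_l2 v))"
    unfolding force_def norm_fourier_l2 by (rule norm_triangle_ineq)
  also have "\<dots> \<le> A * norm p + B * norm v"
    using norm_mul_le[OF a(1), of "inv_fourier_l2 p"] norm_mul_le[OF b(1), of "inv_fourier_l2 v"] by simp
  finally show ?thesis .
qed

lemma norm_rhs_le: "norm (rhs t z) \<le> (2 + 2 * (A + 2 * B)) * norm z"
proof -
  have n: "norm (fst z) \<le> norm z" "norm (fst (snd z)) \<le> norm z" "norm (snd (snd z)) \<le> norm z"
    using norm_fst_le[of "fst z" "snd z"] norm_snd_le[of "snd z" "fst z"]
      norm_fst_le[of "fst (snd z)" "snd (snd z)"] norm_snd_le[of "snd (snd z)" "fst (snd z)"] by auto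
  have v: "norm (vel t z) \<le> 2 * norm z"
    using norm_mul_le[OF ebounded_cosm, of s t "snd (snd z)"] norm_mul_le[OF ebounded_sinm, of s t "fst (snd z)"] n
      norm_triangle_ineq4[of "mul (cosm s t) (snd (snd z))" "mul (sinm s t) (fst (snd z))"]
    unfolding vel_def by linarith
  have f: "norm (force (fst z) (vel t z)) \<le> (A + 2 * B) * norm z"
    using norm_force_le[of "fst z" "vel t z"] mult_left_mono[OF n(1) AB(1)] mult_left_mono[OF v AB(2)]
    by (simp add: algebra_simps)
  have "norm (rhs t z) \<le> norm (vel t z) + (norm (mul (sinm s t) (force (fst z) (vel t z))) + norm (mul (cosm s t) (force (fst z) (vel t z))))"
    unfolding rhs_def by (intro order_trans[OF norm_Pair_le] add_mono order_refl order_trans[OF norm_Pair_le]) simp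
  also have "\<dots> \<le> 2 * norm z + ((A + 2 * B) * norm z + (A + 2 * B) * norm z)"
    using norm_mul_le[OF ebounded_sinm, of s t "force (fst z) (vel t z)"] norm_mul_le[OF ebounded_cosm, of s t "force (fst z) (vel t z)"] v f
    by (intro add_mono) linarith+
  finally show ?thesis by (simp add: algebra_simps)
qed

lemma continuous_on_cosm: "continuous_on S (\<lambda>t. cosm s t x)"
  unfolding cosm_def by (intro continuous_intros)

lemma continuous_on_sinm: "continuous_on S (\<lambda>t. sinm s t x)"
  unfolding sinm_def by (intro continuous_intros)

lemma continuous_on_vel: "continuous_on S Y \<Longrightarrow> continuous_on S (\<lambda>t. vel t (Y t))"
  unfolding vel_def
  by (intro continuous_intros continuous_on_mul[OF ebounded_cosm continuous_on_cosm] continuous_on_mul[OF ebounded_sinm continuous_on_sinm])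

lemma continuous_on_strain: "continuous_on S Y \<Longrightarrow> continuous_on S (\<lambda>t. strain t (Y t))"
  unfolding strain_def
  by (intro continuous_intros continuous_on_mul[OF ebounded_cosm continuous_on_cosm] continuous_on_mul[OF ebounded_sinm continuous_on_sinm])

lemma continuous_on_force:
  "continuous_on S p \<Longrightarrow> continuous_on S v \<Longrightarrow> continuous_on S (\<lambda>t::real. force (p t) (v t))"
  unfolding force_def
  by (intro bounded_linear.continuous_on[OF bounded_linear_fourier_l2] continuous_on_add
      bounded_linear.continuous_on[OF bounded_linear_mul[OF a(1)]] bounded_linear.continuous_on[OF bounded_linear_mul[OF b(1)]]
      bounded_linear.continuous_on[OF bounded_linear_inv_fourier_l2])

lemma continuous_on_rhs: "continuous_on S Y \<Longrightarrow> continuous_on S (\<lambda>t. rhs t (Y t))"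
  unfolding rhs_def
  by (intro continuous_intros continuous_on_vel continuous_on_force
      continuous_on_mul[OF ebounded_cosm continuous_on_cosm] continuous_on_mul[OF ebounded_sinm continuous_on_sinm])

definition Y :: "real \<Rightarrow> 'a l2 \<times> 'a l2 \<times> 'a l2" where
  "Y = (SOME Y. Y 0 = (fourier_l2 f0, q0, fourier_l2 f1) \<and>
    (\<forall>t\<in>{0..T}. (Y has_vector_derivative rhs t (Y t)) (at t within {0..T})))"

lemma Y: "Y 0 = (fourier_l2 f0, q0, fourier_l2 f1)"
    "\<And>t. t \<in> {0..T} \<Longrightarrow> (Y has_vector_derivative rhs t (Y t)) (at t within {0..T})"
proof -
  have "\<exists>Y. Y 0 = (fourier_l2 f0, q0, fourier_l2 f1) \<and>
    (\<forall>t\<in>{0..T}. (Y has_vector_derivative rhs t (Y t)) (at t within {0..T}))"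
  proof (rule lipschitz_ode_solution[where L="2 + 2 * (A + 2 * B)"])
    show "norm (rhs t x - rhs t y) \<le> (2 + 2 * (A + 2 * B)) * norm (x - y)" for t x y
      unfolding rhs_diff by (rule norm_rhs_le)
  qed (use T AB in \<open>auto intro: continuous_on_rhs\<close>)
  from someI_ex[OF this] show "Y 0 = (fourier_l2 f0, q0, fourier_l2 f1)"
    "\<And>t. t \<in> {0..T} \<Longrightarrow> (Y has_vector_derivative rhs t (Y t)) (at t within {0..T})"
    unfolding Y_def by blast+
qed

definition "p t = fst (Y t)"
definition "q t = strain t (Y t)"
definition "v t = vel t (Y t)"
definition "g t = force (p t) (v t)"

lemma Y_cont: "continuous_on {0..T} Y"
  using Y(2) by (meson continuous_on_eq_continuous_within has_vector_derivative_continuous)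

lemma p_cont: "continuous_on {0..T} p" and q_cont: "continuous_on {0..T} q"
  and v_cont: "continuous_on {0..T} v" and g_cont: "continuous_on {0..T} g"
proof -
  show 1: "continuous_on {0..T} p" unfolding p_def[abs_def] by (intro continuous_intros Y_cont)
  show "continuous_on {0..T} q" unfolding q_def[abs_def] by (intro continuous_on_strain Y_cont)
  show 2: "continuous_on {0..T} v" unfolding v_def[abs_def] by (intro continuous_on_vel Y_cont)
  show "continuous_on {0..T} g" unfolding g_def[abs_def] by (intro continuous_on_force 1 2)
qed

lemma p_deriv: "t \<in> {0..T} \<Longrightarrow> (p has_vector_derivative v t) (at t within {0..T})"
  and y1_deriv: "t \<in> {0..T} \<Longrightarrow> ((\<lambda>t. fst (snd (Y t))) has_vector_derivative mul (sinm s t) (g t)) (at t within {0..T})"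
  and y2_deriv: "t \<in> {0..T} \<Longrightarrow> ((\<lambda>t. snd (snd (Y t))) has_vector_derivative - mul (cosm s t) (g t)) (at t within {0..T})"
proof -
  assume t: "t \<in> {0..T}"
  note d = Y(2)[OF t]
  have 1: "bounded_linear (\<lambda>z :: 'a l2 \<times> 'a l2 \<times> 'a l2. fst (snd z))" "bounded_linear (\<lambda>z :: 'a l2 \<times> 'a l2 \<times> 'a l2. snd (snd z))"
    by (intro bounded_linear_compose[OF bounded_linear_fst] bounded_linear_compose[OF bounded_linear_snd] bounded_linear_snd)+
  show "(p has_vector_derivative v t) (at t within {0..T})"
    using bounded_linear.has_vector_derivative[OF bounded_linear_fst d] by (simp add: p_def[abs_def] v_def rhs_def)
  show "((\<lambda>t. fst (snd (Y t))) has_vector_derivative mul (sinm s t) (g t)) (at t within {0..T})"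
    using bounded_linear.has_vector_derivative[OF 1(1) d] by (simp add: p_def v_def g_def rhs_def)
  show "((\<lambda>t. snd (snd (Y t))) has_vector_derivative - mul (cosm s t) (g t)) (at t within {0..T})"
    using bounded_linear.has_vector_derivative[OF 1(2) d] by (simp add: p_def v_def g_def rhs_def)
qed

lemma cosm0: "mul (cosm s 0) f = f" and sinm0: "mul (sinm s 0) f = 0"
proof -
  show "mul (cosm s 0) f = f" by (simp add: cosm_def[abs_def])
  show "mul (sinm s 0) f = 0" by (simp add: sinm_def[abs_def] mul_def zero_l2_def)
qed

lemma initial: "p 0 = fourier_l2 f0" "q 0 = q0" "v 0 = fourier_l2 f1"
  by (simp_all add: p_def q_def v_def strain_def vel_def Y(1) cosm0 sinm0)

lemma mul_commute: "ebounded C m \<Longrightarrow> ebounded D n \<Longrightarrow> mul m (mul n f) = mul n (mul m f)"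
  by (simp add: mul_mul mult.commute)

text \<open>In the original variables the symbol reappears, but only below the cut-off. The contributions of \<open>g\<close>
  to \<open>q\<close> cancel.\<close>

lemma lowpass_q_deriv:
  assumes R: "R \<ge> 0" and t: "t \<in> {0..T}"
  shows "((\<lambda>t. mul (lowpass s R) (q t)) has_vector_derivative mul (\<lambda>\<xi>. lowpass s R \<xi> * symb s \<xi>) (v t)) (at t within {0..T})"
proof -
  note d = has_vector_derivative_add[OF lowpass_cosm_derivative[OF R y1_deriv[OF t], of s] lowpass_sinm_derivative[OF R y2_deriv[OF t], of s]]
  have "mul (cosm s t) (mul (sinm s t) (g t)) = mul (sinm s t) (mul (cosm s t) (g t))"
    by (rule mul_commute[OF ebounded_cosm ebounded_sinm])
  then show ?thesis
    using d unfolding q_def strain_def v_def vel_def mul_add[OF ebounded_lowpass] mul_diff[OF ebounded_lowpass_symb[OF R]]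
      mul_minus[OF ebounded_sinm] mul_minus[OF ebounded_lowpass]
    by (simp add: algebra_simps)
qed

lemma cos_sin_sum: "mul (cosm s t) (mul (cosm s t) f) + mul (sinm s t) (mul (sinm s t) f) = f"
proof -
  have "mul (\<lambda>x. cosm s t x * cosm s t x + sinm s t x * sinm s t x) f = mul (\<lambda>x. 1) f"
  proof (rule mul_cong)
    fix x
    have "cosm s t x * cosm s t x + sinm s t x * sinm s t x = complex_of_real ((cos (t * norm x powr s))\<^sup>2 + (sin (t * norm x powr s))\<^sup>2)"
      by (simp only: cosm_def sinm_def power2_eq_square of_real_mult of_real_add)
    then show "cosm s t x * cosm s t x + sinm s t x * sinm s t x = 1" by (simp del: of_real_add)
  qed
  then show ?thesis
    by (simp add: mul_mul[OF ebounded_cosm ebounded_cosm] mul_mul[OF ebounded_sinm ebounded_sinm]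
        mul_add_left[OF ebounded_mult[OF ebounded_cosm ebounded_cosm] ebounded_mult[OF ebounded_sinm ebounded_sinm], symmetric])
qed

lemma lowpass_v_deriv:
  assumes R: "R \<ge> 0" and t: "t \<in> {0..T}"
  shows "((\<lambda>t. mul (lowpass s R) (v t)) has_vector_derivative
    - mul (\<lambda>\<xi>. lowpass s R \<xi> * symb s \<xi>) (q t) - mul (lowpass s R) (g t)) (at t within {0..T})"
proof -
  note d = has_vector_derivative_diff[OF lowpass_cosm_derivative[OF R y2_deriv[OF t], of s] lowpass_sinm_derivative[OF R y1_deriv[OF t], of s]]
  have "mul (lowpass s R) (g t) = mul (lowpass s R) (mul (cosm s t) (mul (cosm s t) (g t)) + mul (sinm s t) (mul (sinm s t) (g t)))"
    by (simp only: cos_sin_sum)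
  also have "\<dots> = mul (lowpass s R) (mul (cosm s t) (mul (cosm s t) (g t))) + mul (lowpass s R) (mul (sinm s t) (mul (sinm s t) (g t)))"
    by (rule mul_add[OF ebounded_lowpass])
  finally show ?thesis
    using d unfolding v_def vel_def q_def strain_def mul_diff[OF ebounded_lowpass] mul_add[OF ebounded_lowpass_symb[OF R]]
      mul_minus[OF ebounded_cosm] mul_minus[OF ebounded_lowpass]
    by (simp only: diff_conv_add_uminus minus_add_distrib minus_minus add_ac)
qed

text \<open>Below every cut-off, \<open>q\<close> and the multiple of \<open>p\<close> by the symbol have the same initial value and
  the same derivative.\<close>

lemma q_weighted:
  assumes t: "t \<in> {0..T}" shows "weighted s (p t) (q t)"
proof -
  have R: "mul (lowpass s R) (q t) = mul (\<lambda>\<xi>. lowpass s R \<xi> * symb s \<xi>) (p t)" if R: "R \<ge> 0" for R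
  proof -
    let ?D = "\<lambda>t. mul (lowpass s R) (q t) - mul (\<lambda>\<xi>. lowpass s R \<xi> * symb s \<xi>) (p t)"
    have "(?D has_vector_derivative 0) (at \<tau> within {0..T})" if "\<tau> \<in> {0..T}" for \<tau>
      using has_vector_derivative_diff[OF lowpass_q_deriv[OF R that]
          bounded_linear.has_vector_derivative[OF bounded_linear_mul[OF ebounded_lowpass_symb[OF R, of s]] p_deriv[OF that]]] by simp
    then obtain c where c: "\<And>\<tau>. \<tau> \<in> {0..T} \<Longrightarrow> ?D \<tau> = c"
      using has_vector_derivative_zero_constant[of "{0..T}" ?D] by auto
    have "mul (lowpass s R) q0 = mul (\<lambda>\<xi>. lowpass s R \<xi> * symb s \<xi>) (fourier_l2 f0)"
    proof (rule l2_eqI)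
      show "AE x in lborel. rep_l2 (mul (lowpass s R) q0) x = rep_l2 (mul (\<lambda>\<xi>. lowpass s R \<xi> * symb s \<xi>) (fourier_l2 f0)) x"
        using rep_mul[OF ebounded_lowpass, of s R q0] rep_mul[OF ebounded_lowpass_symb[OF R], of s "fourier_l2 f0"] q0[unfolded weighted_def]
        by eventually_elim simp
    qed
    then have "c = 0" using c[of 0] T by (simp add: initial)
    then show ?thesis using c[OF t] by simp
  qed
  have "AE x in lborel. \<forall>n::nat. lowpass s (real n) x * rep_l2 (q t) x = lowpass s (real n) x * symb s x * rep_l2 (p t) x"
    unfolding AE_all_countable
  proof
    fix n :: nat
    show "AE x in lborel. lowpass s (real n) x * rep_l2 (q t) x = lowpass s (real n) x * symb s x * rep_l2 (p t) x"
      using rep_mul[OF ebounded_lowpass, of s "real n" "q t", unfolded R[OF of_nat_0_le_iff]]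
        rep_mul[OF ebounded_lowpass_symb[OF of_nat_0_le_iff], of s n "p t"]
      by eventually_elim metis
  qed
  then show ?thesis
    unfolding weighted_def
  proof eventually_elim
    case (elim x)
    obtain n :: nat where "norm x powr s \<le> real n" using real_arch_simple by blast
    then show ?case using elim[rule_format, of n] by (simp add: lowpass_def)
  qed
qed

lemma Reals_cosm: "cosm s t x \<in> \<real>" "sinm s t x \<in> \<real>"
  by (simp_all add: cosm_def sinm_def)

lemma norm_rotation: "(norm (q t))\<^sup>2 + (norm (v t))\<^sup>2 = (norm (fst (snd (Y t))))\<^sup>2 + (norm (snd (snd (Y t))))\<^sup>2"
proof -
  define y z where "y = fst (snd (Y t))" and "z = snd (snd (Y t))"
  have 1: "inner (mul (cosm s t) w) (mul (cosm s t) w) + inner (mul (sinm s t) w) (mul (sinm s t) w) = inner w w" for w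
    unfolding inner_mul[OF ebounded_cosm Reals_cosm(1)] inner_mul[OF ebounded_sinm Reals_cosm(2)]
    by (simp add: cos_sin_sum flip: inner_add_right)
  have 2: "inner (mul (cosm s t) y) (mul (sinm s t) z) = inner (mul (sinm s t) y) (mul (cosm s t) z)"
    unfolding inner_mul[OF ebounded_cosm Reals_cosm(1)] inner_mul[OF ebounded_sinm Reals_cosm(2)]
    by (simp only: mul_commute[OF ebounded_cosm ebounded_sinm, of s t s t z])
  have "inner (cy + sz) (cy + sz) + inner (cz - sy) (cz - sy)
      = (inner cy cy + inner sy sy) + (inner cz cz + inner sz sz) + 2 * (inner cy sz - inner sy cz)" for cy sy cz sz :: "'a l2"
    by (simp add: inner_simps inner_commute)
  from this[of "mul (cosm s t) y" "mul (sinm s t) z" "mul (cosm s t) z" "mul (sinm s t) y"]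
  show ?thesis
    unfolding q_def v_def strain_def vel_def y_def[symmetric] z_def[symmetric] power2_norm_eq_inner 1 2 by simp
qed

definition "energy t = (norm (q t))\<^sup>2 + (norm (v t))\<^sup>2 + inner (mul a (inv_fourier_l2 (p t))) (inv_fourier_l2 (p t))"

text \<open>The rotation preserves the sum of the squared norms, so the energy is differentiated in terms of
  \<open>y1\<close> and \<open>y2\<close>, which are differentiable although \<open>q\<close> and \<open>v\<close> need not be. The part of \<open>g\<close> coming
  from \<open>a\<close> cancels against the derivative of the potential energy.\<close>

lemma energy_deriv:
  assumes t: "t \<in> {0..T}"
  shows "(energy has_vector_derivative (- 2 * inner (mul b (inv_fourier_l2 (v t))) (inv_fourier_l2 (v t)))) (at t within {0..T})"
proof -
  let ?I = "inv_fourier_l2 :: 'a l2 \<Rightarrow> 'a l2"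
  let ?y = "\<lambda>t. fst (snd (Y t))" and ?z = "\<lambda>t. snd (snd (Y t))"
  have aR: "a x \<in> \<real>" for x using a(2)[of x] by (auto simp: nonneg_Reals_def)
  have E: "energy = (\<lambda>t. inner (?y t) (?y t) + inner (?z t) (?z t) + inner (mul a (?I (p t))) (?I (p t)))"
    by (rule ext) (simp only: energy_def norm_rotation, simp only: power2_norm_eq_inner)
  note dI = bounded_linear.has_vector_derivative[OF bounded_linear_inv_fourier_l2 p_deriv[OF t]]
  note d = has_vector_derivative_add[OF has_vector_derivative_add[OF
      bounded_bilinear.has_vector_derivative[OF bounded_bilinear_inner y1_deriv[OF t] y1_deriv[OF t]]
      bounded_bilinear.has_vector_derivative[OF bounded_bilinear_inner y2_deriv[OF t] y2_deriv[OF t]]]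
      bounded_bilinear.has_vector_derivative[OF bounded_bilinear_inner
        bounded_linear.has_vector_derivative[OF bounded_linear_mul[OF a(1)] dI] dI]]
  have y: "inner (?y t) (mul (sinm s t) (g t)) - inner (?z t) (mul (cosm s t) (g t)) = - inner (v t) (g t)"
    by (simp add: v_def vel_def inner_diff_left inner_mul[OF ebounded_cosm Reals_cosm(1)] inner_mul[OF ebounded_sinm Reals_cosm(2)])
  have vg: "inner (v t) (g t) = inner (?I (v t)) (mul a (?I (p t))) + inner (?I (v t)) (mul b (?I (v t)))"
    unfolding g_def force_def by (metis inner_commute inner_fourier_l2 inner_add_right)
  have aa: "inner (mul a (?I (v t))) (?I (p t)) = inner (mul a (?I (p t))) (?I (v t))"
    by (metis inner_mul[OF a(1) aR] inner_commute)
  have "inner (?y t) (mul (sinm s t) (g t)) + inner (mul (sinm s t) (g t)) (?y t) +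
      (inner (?z t) (- mul (cosm s t) (g t)) + inner (- mul (cosm s t) (g t)) (?z t)) +
      (inner (mul a (?I (p t))) (?I (v t)) + inner (mul a (?I (v t))) (?I (p t)))
    = - 2 * inner (mul b (?I (v t))) (?I (v t))"
    using y vg unfolding aa by (simp add: inner_commute)
  with d show ?thesis unfolding E by simp
qed

lemma energy_le:
  assumes t: "t \<in> {0..T}" shows "energy t \<le> energy 0"
proof (cases "t = 0")
  case False
  have "\<exists>x\<in>{0<..<t}. energy t - energy 0 = (\<lambda>h. h *\<^sub>R (- 2 * inner (mul b (inv_fourier_l2 (v x))) (inv_fourier_l2 (v x)))) (t - 0)"
  proof (rule mvt_simple)
    show "0 < t" using t False by auto
    fix x assume "0 \<le> x" "x \<le> t"
    then have "x \<in> {0..T}" "{0..t} \<subseteq> {0..T}" using t by auto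
    from has_vector_derivative_within_subset[OF energy_deriv[OF this(1)] this(2)]
    show "(energy has_derivative (\<lambda>h. h *\<^sub>R (- 2 * inner (mul b (inv_fourier_l2 (v x))) (inv_fourier_l2 (v x))))) (at x within {0..t})"
      by (simp add: has_vector_derivative_def)
  qed
  then obtain x where "energy t - energy 0 = t * (- 2 * inner (mul b (inv_fourier_l2 (v x))) (inv_fourier_l2 (v x)))" by auto
  moreover have "\<dots> \<le> 0"
    using inner_mul_nonneg[OF b(1) b(2), of "inv_fourier_l2 (v x)"] t
    by (intro mult_nonneg_nonpos[of t "- 2 * _"]) auto
  ultimately show ?thesis by linarith
qed simp

text \<open>The bounds are linear in \<open>A\<close>. This is what keeps the solution of a net of problems moderate.\<close>

lemma energy_bound:
  assumes t: "t \<in> {0..T}"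
  shows "norm (q t) \<le> (1 + A) * (norm f0 + norm q0) + norm f1" "norm (v t) \<le> (1 + A) * (norm f0 + norm q0) + norm f1"
    "norm (p t) \<le> norm f0 + T * ((1 + A) * (norm f0 + norm q0) + norm f1)"
proof -
  define M where "M = (1 + A) * (norm f0 + norm q0) + norm f1"
  have M: "M \<ge> 0" using AB by (simp add: M_def)
  have 0: "(norm (q \<tau>))\<^sup>2 + (norm (v \<tau>))\<^sup>2 \<le> M\<^sup>2" if "\<tau> \<in> {0..T}" for \<tau>
  proof -
    have "(norm (q \<tau>))\<^sup>2 + (norm (v \<tau>))\<^sup>2 \<le> energy \<tau>"
      using inner_mul_nonneg[OF a(1) a(2), of "inv_fourier_l2 (p \<tau>)"] by (simp add: energy_def)
    also have "\<dots> \<le> energy 0" by (rule energy_le[OF that])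
    also have "\<dots> = (norm q0)\<^sup>2 + (norm f1)\<^sup>2 + inner (mul a f0) f0"
      by (simp add: energy_def initial)
    also have "inner (mul a f0) f0 \<le> A * (norm f0)\<^sup>2"
    proof -
      have "inner (mul a f0) f0 \<le> norm (mul a f0) * norm f0" by (rule norm_cauchy_schwarz)
      also have "\<dots> \<le> (A * norm f0) * norm f0" by (intro mult_right_mono norm_mul_le a) auto
      finally show ?thesis by (simp add: power2_eq_square mult.assoc)
    qed
    also have "(norm q0)\<^sup>2 + (norm f1)\<^sup>2 + A * (norm f0)\<^sup>2 \<le> M\<^sup>2"
    proof -
      define x y z where "x = norm f0" and "y = norm q0" and "z = norm f1"
      have xyz: "x \<ge> 0" "y \<ge> 0" "z \<ge> 0" by (auto simp: x_def y_def z_def)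
      have "y\<^sup>2 + z\<^sup>2 + A * x\<^sup>2 \<le> ((1 + A) * x)\<^sup>2 + ((1 + A) * y)\<^sup>2 + z\<^sup>2"
      proof -
        have "A * x\<^sup>2 \<le> (1 + A)\<^sup>2 * x\<^sup>2"
          using AB by (intro mult_right_mono) (auto simp: power2_eq_square algebra_simps)
        moreover have "1 * y\<^sup>2 \<le> (1 + A)\<^sup>2 * y\<^sup>2"
          using AB by (intro mult_right_mono) (auto simp: power2_eq_square algebra_simps)
        ultimately show ?thesis by (simp add: power_mult_distrib)
      qed
      also have "\<dots> \<le> ((1 + A) * x + (1 + A) * y + z)\<^sup>2"
      proof -
        define X Z where "X = (1 + A) * x" and "Z = (1 + A) * y"
        have XZ: "0 \<le> X" "0 \<le> Z" using AB xyz by (auto simp: X_def Z_def)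
        have eq: "(X + Z + z)\<^sup>2 = X\<^sup>2 + Z\<^sup>2 + z\<^sup>2 + 2 * (X * Z + X * z + Z * z)"
          by (simp add: power2_eq_square algebra_simps)
        have "0 \<le> X * Z + X * z + Z * z" using XZ xyz by simp
        then show ?thesis unfolding X_def[symmetric] Z_def[symmetric] eq by simp
      qed
      finally show ?thesis by (simp add: M_def x_def y_def z_def ring_distribs)
    qed
    finally show ?thesis by simp
  qed
  have qv: "norm (q \<tau>) \<le> M" "norm (v \<tau>) \<le> M" if "\<tau> \<in> {0..T}" for \<tau>
  proof -
    have "(norm (q \<tau>))\<^sup>2 \<le> M\<^sup>2" "(norm (v \<tau>))\<^sup>2 \<le> M\<^sup>2"
      using 0[OF that] by (smt (verit) zero_le_power2)+
    then show "norm (q \<tau>) \<le> M" "norm (v \<tau>) \<le> M" using M power2_le_imp_le by blast+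
  qed
  have "norm (p t - p 0) \<le> M * norm (t - 0)"
  proof (rule differentiable_bound[of "{0..T}" p "\<lambda>x h. h *\<^sub>R v x"])
    show "(p has_derivative (\<lambda>h. h *\<^sub>R v x)) (at x within {0..T})" if "x \<in> {0..T}" for x
      using p_deriv[OF that] by (simp add: has_vector_derivative_def)
    show "onorm (\<lambda>h. h *\<^sub>R v x) \<le> M" if "x \<in> {0..T}" for x
      using qv(2)[OF that] by (intro onorm_le) (simp add: mult.commute[of M] mult_left_mono)
  qed (use t T in auto)
  also have "\<dots> \<le> M * T" using t M by (intro mult_left_mono) auto
  finally have "norm (p t) \<le> norm f0 + T * M"
    using norm_triangle_sub[of "p t" "p 0"] by (simp add: initial mult.commute)
  then show "norm (q t) \<le> (1 + A) * (norm f0 + norm q0) + norm f1" "norm (v t) \<le> (1 + A) * (norm f0 + norm q0) + norm f1"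
    "norm (p t) \<le> norm f0 + T * ((1 + A) * (norm f0 + norm q0) + norm f1)"
    using qv[OF t] by (auto simp: M_def)
qed

end

section \<open>Time slices of test functions\<close>

lemma has_vector_derivative_iff_quotient:
  fixes f :: "real \<Rightarrow> 'b::real_normed_vector"
  shows "(f has_vector_derivative f') (at t within S) \<longleftrightarrow> ((\<lambda>\<tau>. (f \<tau> - f t) /\<^sub>R (\<tau> - t)) \<longlongrightarrow> f') (at t within S)"
proof -
  have "(f has_vector_derivative f') (at t within S) \<longleftrightarrow>
      ((\<lambda>\<tau>. norm ((1 / norm (\<tau> - t)) *\<^sub>R (f \<tau> - (f t + (\<tau> - t) *\<^sub>R f')))) \<longlongrightarrow> 0) (at t within S)"
    unfolding has_vector_derivative_def has_derivative_within tendsto_norm_zero_iff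
    by (simp only: bounded_linear_scaleR_left simp_thms)
  also have "\<dots> \<longleftrightarrow> ((\<lambda>\<tau>. norm ((f \<tau> - f t) /\<^sub>R (\<tau> - t) - f')) \<longlongrightarrow> 0) (at t within S)"
  proof (rule tendsto_cong, rule eventually_at_topological[THEN iffD2], intro exI[of _ UNIV] conjI ballI impI)
    fix \<tau> assume "\<tau> \<noteq> t"
    then have "f \<tau> - (f t + (\<tau> - t) *\<^sub>R f') = (\<tau> - t) *\<^sub>R ((f \<tau> - f t) /\<^sub>R (\<tau> - t) - f')"
      by (simp add: scaleR_diff_right)
    then have "norm (f \<tau> - (f t + (\<tau> - t) *\<^sub>R f')) = \<bar>\<tau> - t\<bar> * norm ((f \<tau> - f t) /\<^sub>R (\<tau> - t) - f')"
      by (simp only: norm_scaleR)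
    then show "norm ((1 / norm (\<tau> - t)) *\<^sub>R (f \<tau> - (f t + (\<tau> - t) *\<^sub>R f'))) = norm ((f \<tau> - f t) /\<^sub>R (\<tau> - t) - f')"
      using \<open>\<tau> \<noteq> t\<close> by (simp only: norm_scaleR) simp
  qed auto
  also have "\<dots> \<longleftrightarrow> ((\<lambda>\<tau>. (f \<tau> - f t) /\<^sub>R (\<tau> - t)) \<longlongrightarrow> f') (at t within S)"
    unfolding tendsto_norm_zero_iff by (rule LIM_zero_iff)
  finally show ?thesis .
qed

lemma fun_support_zero: "z \<notin> fun_support \<psi> \<Longrightarrow> \<psi> z = 0"
  using closure_subset[of "{z. \<psi> z \<noteq> 0}"] by (auto simp: fun_support_def)

lemma smooth_has_derivative:
  assumes "smooth \<psi>" shows "(\<psi> has_derivative frechet_derivative \<psi> (at z)) (at z)"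
proof -
  have "partials [] \<psi> differentiable_on UNIV" using assms unfolding smooth_def by blast
  then show ?thesis by (simp add: differentiable_on_def frechet_derivative_works)
qed

lemma smooth_continuous: "smooth \<psi> \<Longrightarrow> continuous_on UNIV \<psi>"
  by (meson smooth_has_derivative continuous_at_imp_continuous_on has_derivative_continuous)

lemma partials_append: "partials (vs @ ws) f = partials vs (partials ws f)"
  by (simp add: partials_def)

lemma smooth_partials: "smooth \<psi> \<Longrightarrow> ws \<in> lists Basis \<Longrightarrow> smooth (partials ws \<psi>)"
  unfolding smooth_def by (auto simp flip: partials_append)

lemma fun_support_partial: "fun_support (partial v \<psi>) \<subseteq> fun_support \<psi>"
proof -
  have "partial v \<psi> z = 0" if "z \<notin> fun_support \<psi>" for z
  proof -
    have "open (- fun_support \<psi>)" unfolding fun_support_def by (intro open_Compl closed_closure)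
    have "((\<lambda>z. 0) has_derivative (\<lambda>h. 0)) (at z)" by simp
    then have "(\<psi> has_derivative (\<lambda>h. 0)) (at z)"
      by (rule has_derivative_transform_within_open[OF _ \<open>open (- fun_support \<psi>)\<close>])
        (use that fun_support_zero in \<open>auto simp: fun_support_zero\<close>)
    then show ?thesis by (rule partial_eq)
  qed
  then have "{z. partial v \<psi> z \<noteq> 0} \<subseteq> fun_support \<psi>" by blast
  then show ?thesis
    unfolding fun_support_def[of "partial v \<psi>"] by (rule closure_minimal) (simp add: fun_support_def)
qed

lemma test_functions_partial:
  assumes "\<psi> \<in> test_functions \<Omega>" "v \<in> Basis" shows "partial v \<psi> \<in> test_functions \<Omega>"
proof -
  have "smooth (partials [v] \<psi>)" using assms by (intro smooth_partials) (auto simp: test_functions_def)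
  moreover have "compact (fun_support (partial v \<psi>))"
  proof -
    have "compact (fun_support \<psi> \<inter> fun_support (partial v \<psi>))"
      using assms by (intro compact_Int_closed) (auto simp: test_functions_def fun_support_def)
    then show ?thesis using fun_support_partial[of v \<psi>] by (simp add: Int_absorb1)
  qed
  ultimately show ?thesis
    using assms fun_support_partial[of v \<psi>] by (auto simp: test_functions_def partials_Cons)
qed

lemma test_functions_partials:
  "\<psi> \<in> test_functions \<Omega> \<Longrightarrow> vs \<in> lists Basis \<Longrightarrow> partials vs \<psi> \<in> test_functions \<Omega>"
  by (induction vs) (auto simp: partials_Cons intro: test_functions_partial)

lemma test_functions_bound:
  assumes "\<psi> \<in> test_functions \<Omega>"
  shows "\<exists>C r. C \<ge> 0 \<and> (\<forall>t x. norm (\<psi> (t, x)) \<le> C * indicator (cball 0 r) x)"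
proof -
  have c: "continuous_on UNIV \<psi>" and K: "compact (fun_support \<psi>)"
    using assms by (auto simp: test_functions_def smooth_continuous)
  have "bounded (\<psi> ` fun_support \<psi>)"
    by (intro compact_imp_bounded compact_continuous_image[OF continuous_on_subset[OF c] K]) auto
  then obtain C where C: "C > 0" "\<And>z. z \<in> fun_support \<psi> \<Longrightarrow> norm (\<psi> z) \<le> C"
    by (auto simp: bounded_pos)
  obtain r where r: "\<And>z. z \<in> fun_support \<psi> \<Longrightarrow> norm z \<le> r"
    using compact_imp_bounded[OF K] by (auto simp: bounded_iff)
  have "norm (\<psi> (t, x)) \<le> C * indicator (cball 0 r) x" for t x
  proof (cases "(t, x) \<in> fun_support \<psi>")
    case True
    then have "norm x \<le> r" using r[OF True] norm_snd_le[of x t] by linarith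
    then show ?thesis using C(2)[OF True] by simp
  qed (use C(1) in \<open>simp add: fun_support_zero\<close>)
  then show ?thesis using C(1) by (intro exI[of _ C] exI[of _ r]) auto
qed

lemma ball_supported:
  fixes f :: "'a::euclidean_space \<Rightarrow> complex"
  assumes f: "f \<in> borel_measurable borel" and C: "C \<ge> 0" and b: "\<And>x. norm (f x) \<le> C * indicator (cball 0 r) x"
  shows "f \<in> L2_space" "integrable lborel f" "norm (abs_l2 f) \<le> C * sqrt (measure lborel (cball (0::'a) r))"
proof -
  have i: "integrable lborel (indicat_real (cball (0::'a) r))"
    by (rule integrable_real_indicator) (simp_all add: emeasure_lborel_cball_finite[simplified])
  have sq: "(norm (f x))\<^sup>2 \<le> C\<^sup>2 * indicator (cball 0 r) x" for x
    using power_mono[OF b[of x], of 2] by (auto simp: power_mult_distrib indicator_def)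
  show L2: "f \<in> L2_space"
    by (rule L2_space_dominated[OF f integrable_mult_right[OF i, of "C\<^sup>2"]]) (use sq in simp)
  show "integrable lborel f"
    by (rule Bochner_Integration.integrable_bound[OF integrable_mult_right[OF i, of C]])
      (use f C b in \<open>auto simp: abs_mult\<close>)
  have "(LINT x|lborel. (norm (f x))\<^sup>2) \<le> (LINT x|lborel. C\<^sup>2 * indicator (cball (0::'a) r) x)"
    by (intro integral_mono L2_space_integrable L2 integrable_mult_right i sq)
  also have "\<dots> = C\<^sup>2 * measure lborel (cball (0::'a) r)" by simp
  finally have "L2_norm f \<le> sqrt (C\<^sup>2 * measure lborel (cball (0::'a) r))"
    unfolding L2_norm_def by (rule real_sqrt_le_mono)
  then show "norm (abs_l2 f) \<le> C * sqrt (measure lborel (cball (0::'a) r))"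
    using C by (simp add: norm_abs_l2 L2 real_sqrt_mult)
qed

definition slice :: "(real \<times> 'a::euclidean_space \<Rightarrow> complex) \<Rightarrow> real \<Rightarrow> 'a l2" where
  "slice \<psi> t = abs_l2 (\<lambda>x. \<psi> (t, x))"

lemma slice_measurable:
  assumes "\<psi> \<in> test_functions \<Omega>" shows "(\<lambda>x. \<psi> (t, x)) \<in> borel_measurable borel"
  using assms
  by (intro borel_measurable_continuous_onI continuous_on_compose2[OF smooth_continuous, of \<psi>])
    (auto simp: test_functions_def intro!: continuous_intros)

lemma slice_bounded:
  assumes "\<psi> \<in> test_functions \<Omega>" shows "\<exists>M. \<forall>t. norm (slice \<psi> t) \<le> M"
proof -
  obtain C r where C: "C \<ge> 0" "\<And>t x. norm (\<psi> (t, x)) \<le> C * indicator (cball 0 r) x"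
    using test_functions_bound[OF assms] by blast
  show ?thesis unfolding slice_def using ball_supported(3)[OF slice_measurable[OF assms] C(1) C(2)] by blast
qed

lemma slice_L2: "\<psi> \<in> test_functions \<Omega> \<Longrightarrow> (\<lambda>x. \<psi> (t, x)) \<in> L2_space"
  and slice_integrable: "\<psi> \<in> test_functions \<Omega> \<Longrightarrow> integrable lborel (\<lambda>x. \<psi> (t, x))"
proof -
  assume \<psi>: "\<psi> \<in> test_functions \<Omega>"
  obtain C r where C: "C \<ge> 0" "\<And>t x. norm (\<psi> (t, x)) \<le> C * indicator (cball 0 r) x"
    using test_functions_bound[OF \<psi>] by blast
  show "(\<lambda>x. \<psi> (t, x)) \<in> L2_space" "integrable lborel (\<lambda>x. \<psi> (t, x))"
    using ball_supported[OF slice_measurable[OF \<psi>] C(1) C(2)] by blast+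
qed

lemma partial_line:
  assumes "smooth \<psi>"
  shows "((\<lambda>h. \<psi> (z + h *\<^sub>R w)) has_vector_derivative partial w \<psi> (z + h *\<^sub>R w)) (at h within S)"
proof -
  note d = smooth_has_derivative[OF assms, of "z + h *\<^sub>R w"]
  have "((\<lambda>h. z + h *\<^sub>R w) has_derivative (\<lambda>k. k *\<^sub>R w)) (at h within S)"
    by (auto intro!: derivative_eq_intros)
  from has_derivative_in_compose[OF this, of \<psi>] d
  have "((\<lambda>h. \<psi> (z + h *\<^sub>R w)) has_derivative (\<lambda>k. frechet_derivative \<psi> (at (z + h *\<^sub>R w)) (k *\<^sub>R w))) (at h within S)"
    by (auto intro: has_derivative_at_withinI)
  then show ?thesis
    by (simp add: has_vector_derivative_def partial_def linear_cmul[OF has_derivative_linear[OF d]])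
qed

lemma partial_time:
  "smooth \<psi> \<Longrightarrow> ((\<lambda>\<tau>. \<psi> (\<tau>, x)) has_vector_derivative partial (1, 0) \<psi> (t, x)) (at t within S)"
  using partial_line[of \<psi> "(0, x)" "(1, 0)" t S] by simp

lemma partial_space:
  "smooth \<psi> \<Longrightarrow> ((\<lambda>h. \<psi> (t, x + h *\<^sub>R b)) has_vector_derivative partial (0, b) \<psi> (t, x + h *\<^sub>R b)) (at h within S)"
  using partial_line[of \<psi> "(t, x)" "(0, b)" h S] by simp

lemma Basis_time [simp]: "(1, 0) \<in> (Basis :: (real \<times> 'a::euclidean_space) set)"
  by (simp add: Basis_prod_def)

lemma Basis_space: "b \<in> Basis \<Longrightarrow> (0, b) \<in> (Basis :: (real \<times> 'a::euclidean_space) set)"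
  by (simp add: Basis_prod_def)

text \<open>The second time derivative of a test function is bounded and supported in a fixed ball, which makes
  the second order Taylor remainder small in L2.\<close>

lemma slice_deriv:
  fixes \<psi> :: "real \<times> 'a::euclidean_space \<Rightarrow> complex"
  assumes \<psi>: "\<psi> \<in> test_functions \<Omega>"
  shows "(slice \<psi> has_vector_derivative slice (partial (1, 0) \<psi>) t) (at t within S)"
proof -
  let ?\<psi>1 = "partial (1, 0) \<psi>" let ?\<psi>2 = "partial (1, 0) ?\<psi>1"
  have \<psi>1: "?\<psi>1 \<in> test_functions \<Omega>" by (rule test_functions_partial[OF \<psi> Basis_time])
  have \<psi>2: "?\<psi>2 \<in> test_functions \<Omega>" by (rule test_functions_partial[OF \<psi>1 Basis_time])
  have sm: "smooth \<psi>" "smooth ?\<psi>1" using \<psi> \<psi>1 by (auto simp: test_functions_def)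
  obtain C r where C: "C \<ge> 0" "\<And>t x. norm (?\<psi>2 (t, x)) \<le> C * indicator (cball 0 r) x"
    using test_functions_bound[OF \<psi>2] by blast
  show ?thesis
  proof (rule has_vector_derivative_quadratic)
    fix \<tau>
    define F where "F x = \<psi> (\<tau>, x) - \<psi> (t, x) - complex_of_real (\<tau> - t) * ?\<psi>1 (t, x)" for x
    have "norm (F x) \<le> (C * (\<tau> - t)\<^sup>2) * indicator (cball 0 r) x" for x
    proof -
      define c where "c = C * indicator (cball 0 r) x"
      have lip: "norm (?\<psi>1 (\<sigma>, x) - ?\<psi>1 (t, x)) \<le> c * \<bar>\<tau> - t\<bar>" if "\<sigma> \<in> closed_segment t \<tau>" for \<sigma>
      proof -
        have "norm (?\<psi>1 (\<sigma>, x) - ?\<psi>1 (t, x)) \<le> c * norm (\<sigma> - t)"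
          using C(2) partial_time[OF sm(2)]
          by (intro differentiable_bound[of UNIV "\<lambda>\<sigma>. ?\<psi>1 (\<sigma>, x)" "\<lambda>\<sigma> h. h *\<^sub>R ?\<psi>2 (\<sigma>, x)"])
            (auto simp: has_vector_derivative_def c_def mult.commute[of _ "\<bar>_\<bar>"] intro!: onorm_le mult_left_mono)
        also have "\<dots> \<le> c * \<bar>\<tau> - t\<bar>"
          using that C(1) by (intro mult_left_mono) (auto simp: c_def closed_segment_eq_real_ivl split: if_splits)
        finally show ?thesis .
      qed
      have "norm (\<psi> (\<tau>, x) - \<psi> (t, x) - (\<tau> - t) *\<^sub>R ?\<psi>1 (t, x)) \<le> norm (\<tau> - t) * (c * \<bar>\<tau> - t\<bar>)"
        by (rule vector_differentiable_bound_linearization[OF partial_time[OF sm(1)] _ lip]) auto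
      also have "\<dots> = c * (\<tau> - t)\<^sup>2" by (simp add: power2_eq_square mult.left_commute)
      finally show ?thesis by (simp add: F_def c_def scaleR_conv_of_real mult_ac)
    qed
    moreover have "F \<in> borel_measurable borel"
      unfolding F_def using slice_measurable[OF \<psi>] slice_measurable[OF \<psi>1] by simp
    ultimately have "norm (abs_l2 F) \<le> (C * (\<tau> - t)\<^sup>2) * sqrt (measure lborel (cball (0::'a) r))"
      using C(1) by (intro ball_supported) auto
    moreover have "abs_l2 F = slice \<psi> \<tau> - slice \<psi> t - (\<tau> - t) *\<^sub>R slice ?\<psi>1 t"
      unfolding F_def slice_def scaleR_scaleC
      by (simp add: abs_l2_diff L2_space_diff L2_space_cmult abs_l2_scaleC slice_L2[OF \<psi>] slice_L2[OF \<psi>1] del: of_real_diff)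
    ultimately show "norm (slice \<psi> \<tau> - slice \<psi> t - (\<tau> - t) *\<^sub>R slice ?\<psi>1 t) \<le> (C * sqrt (measure lborel (cball (0::'a) r))) * (\<tau> - t)\<^sup>2"
      by (simp add: mult_ac)
  qed
qed

lemma slice_outside:
  assumes "\<psi> \<in> test_functions ({0<..<T} \<times> UNIV)" "t \<notin> {0<..<T}"
  shows "slice \<psi> t = 0"
proof -
  have "\<psi> (t, x) = 0" for x using assms by (intro fun_support_zero) (auto simp: test_functions_def)
  then show ?thesis by (simp add: slice_def zero_l2_def)
qed

text \<open>Differentiating under the integral the translation formula for the inverse Fourier transform.\<close>

lemma inv_fourier_partial:
  fixes \<psi> :: "real \<times> 'a::euclidean_space \<Rightarrow> complex"
  assumes \<psi>: "\<psi> \<in> test_functions \<Omega>" and b: "b \<in> Basis"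
  shows "inv_fourier (\<lambda>x. partial (0, b) \<psi> (t, x)) \<xi> = - \<i> * complex_of_real (b \<bullet> \<xi>) * inv_fourier (\<lambda>x. \<psi> (t, x)) \<xi>"
proof -
  let ?\<psi>1 = "partial (0, b) \<psi>"
  have \<psi>1: "?\<psi>1 \<in> test_functions \<Omega>" by (rule test_functions_partial[OF \<psi> Basis_space[OF b]])
  have sm: "smooth \<psi>" using \<psi> by (auto simp: test_functions_def)
  obtain C r where C: "C \<ge> 0" "\<And>t x. norm (?\<psi>1 (t, x)) \<le> C * indicator (cball 0 r) x"
    using test_functions_bound[OF \<psi>1] by blast
  have [measurable]: "(\<lambda>x. \<psi> (t, x)) \<in> borel_measurable borel" "(\<lambda>x. ?\<psi>1 (t, x)) \<in> borel_measurable borel"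
    by (rule slice_measurable[OF \<psi>], rule slice_measurable[OF \<psi>1])
  define h where "h n = 1 / real (Suc n)" for n
  have h: "h n > 0" "h n \<le> 1" "h \<longlonglongrightarrow> 0" for n
    using LIMSEQ_inverse_real_of_nat by (auto simp: h_def[abs_def] inverse_eq_divide)
  have h': "filterlim h (at 0) sequentially"
    by (simp add: filterlim_at h(3) less_imp_neq[OF h(1), symmetric])
  define I where "I = (LINT x|lborel. cis (x \<bullet> \<xi>) * \<psi> (t, x))"
  have cI: "integrable lborel (\<lambda>x. cis (x \<bullet> \<xi>) * \<psi> (t, x))"
    by (rule Bochner_Integration.integrable_bound[OF slice_integrable[OF \<psi>, of t]]) (auto simp: norm_mult)
  have transl: "(LINT x|lborel. cis (x \<bullet> \<xi>) * \<psi> (t, x + c *\<^sub>R b)) = cis (- (c * (b \<bullet> \<xi>))) * I"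
    and translI: "integrable lborel (\<lambda>x. cis (x \<bullet> \<xi>) * \<psi> (t, x + c *\<^sub>R b))" for c
  proof -
    have eq: "cis (x \<bullet> \<xi>) * \<psi> (t, x + c *\<^sub>R b) = cis (- (c * (b \<bullet> \<xi>))) * (cis ((c *\<^sub>R b + 1 *\<^sub>R x) \<bullet> \<xi>) * \<psi> (t, c *\<^sub>R b + 1 *\<^sub>R x))" for x
      unfolding mult.assoc[symmetric] cis_mult by (simp add: inner_simps add.commute)
    show "integrable lborel (\<lambda>x. cis (x \<bullet> \<xi>) * \<psi> (t, x + c *\<^sub>R b))"
      unfolding eq using integrable_lborel_affine[OF _ cI, of 1 "c *\<^sub>R b"] by (intro integrable_mult_right) simp
    show "(LINT x|lborel. cis (x \<bullet> \<xi>) * \<psi> (t, x + c *\<^sub>R b)) = cis (- (c * (b \<bullet> \<xi>))) * I"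
      unfolding eq I_def integral_mult_right_zero
      by (subst integral_lborel_affine[of 1 "\<lambda>x. cis (x \<bullet> \<xi>) * \<psi> (t, x)" "c *\<^sub>R b"]) auto
  qed
  have "(\<lambda>n. LINT x|lborel. cis (x \<bullet> \<xi>) * ((\<psi> (t, x + h n *\<^sub>R b) - \<psi> (t, x)) / complex_of_real (h n)))
      \<longlonglongrightarrow> (LINT x|lborel. cis (x \<bullet> \<xi>) * ?\<psi>1 (t, x))"
  proof (rule integral_dominated_convergence)
    have "integrable lborel (indicat_real (cball (0::'a) (r + 1)))"
      by (rule integrable_real_indicator) (simp_all add: emeasure_lborel_cball_finite[simplified])
    then show "integrable lborel (\<lambda>x. C * indicat_real (cball (0::'a) (r + 1)) x)" by (rule integrable_mult_right)
    show "(\<lambda>x. cis (x \<bullet> \<xi>) * ((\<psi> (t, x + h n *\<^sub>R b) - \<psi> (t, x)) / complex_of_real (h n))) \<in> borel_measurable lborel" for n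
    proof -
      have [measurable]: "(\<lambda>x. \<psi> (t, x + h n *\<^sub>R b)) \<in> borel_measurable borel"
        using measurable_compose[of "\<lambda>x. x + h n *\<^sub>R b" borel borel "\<lambda>x. \<psi> (t, x)" borel] by simp
      show ?thesis by measurable
    qed
    show "AE x in lborel. (\<lambda>n. cis (x \<bullet> \<xi>) * ((\<psi> (t, x + h n *\<^sub>R b) - \<psi> (t, x)) / complex_of_real (h n))) \<longlonglongrightarrow> cis (x \<bullet> \<xi>) * ?\<psi>1 (t, x)"
    proof (rule AE_I2, rule tendsto_mult_left)
      fix x
      have "((\<lambda>c. (\<psi> (t, x + c *\<^sub>R b) - \<psi> (t, x)) /\<^sub>R c) \<longlongrightarrow> ?\<psi>1 (t, x)) (at 0)"
        using partial_space[OF sm, of t x b 0 UNIV]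
        by (simp add: has_vector_derivative_iff_quotient)
      from filterlim_compose[OF this h']
      show "(\<lambda>n. (\<psi> (t, x + h n *\<^sub>R b) - \<psi> (t, x)) / complex_of_real (h n)) \<longlonglongrightarrow> ?\<psi>1 (t, x)"
        by (simp add: scaleR_conv_of_real divide_inverse mult.commute)
    qed
    fix n
    show "AE x in lborel. norm (cis (x \<bullet> \<xi>) * ((\<psi> (t, x + h n *\<^sub>R b) - \<psi> (t, x)) / complex_of_real (h n))) \<le> C * indicator (cball 0 (r + 1)) x"
    proof (rule AE_I2)
      fix x
      have "norm (\<psi> (t, x + h n *\<^sub>R b) - \<psi> (t, x + 0 *\<^sub>R b)) \<le> (C * indicator (cball 0 (r + 1)) x) * norm (h n - 0)"
      proof (rule differentiable_bound[of "{0..1}" "\<lambda>c. \<psi> (t, x + c *\<^sub>R b)" "\<lambda>c k. k *\<^sub>R ?\<psi>1 (t, x + c *\<^sub>R b)"])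
        show "((\<lambda>c. \<psi> (t, x + c *\<^sub>R b)) has_derivative (\<lambda>k. k *\<^sub>R ?\<psi>1 (t, x + c *\<^sub>R b))) (at c within {0..1})" for c
          using partial_space[OF sm] by (simp add: has_vector_derivative_def)
        fix c :: real assume c: "c \<in> {0..1}"
        have "norm (?\<psi>1 (t, x + c *\<^sub>R b)) \<le> C * indicator (cball 0 (r + 1)) x"
        proof -
          have "norm x \<le> norm (x + c *\<^sub>R b) + norm (c *\<^sub>R b)" using norm_triangle_ineq4[of "x + c *\<^sub>R b" "c *\<^sub>R b"] by simp
          also have "norm (c *\<^sub>R b) \<le> 1" using c b by simp
          finally have "indicator (cball 0 r) (x + c *\<^sub>R b) \<le> (indicator (cball 0 (r + 1)) x :: real)"
            by (auto simp: indicator_def)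
          then show ?thesis using C order_trans mult_left_mono by meson
        qed
        then show "onorm (\<lambda>k. k *\<^sub>R ?\<psi>1 (t, x + c *\<^sub>R b)) \<le> C * indicator (cball 0 (r + 1)) x"
          by (intro onorm_le) (simp add: mult.commute[of _ "\<bar>_\<bar>"] mult_left_mono)
      qed (use h(1,2)[of n] in auto)
      then show "norm (cis (x \<bullet> \<xi>) * ((\<psi> (t, x + h n *\<^sub>R b) - \<psi> (t, x)) / complex_of_real (h n))) \<le> C * indicator (cball 0 (r + 1)) x"
        using h(1)[of n] by (simp add: norm_mult norm_divide pos_divide_le_eq)
    qed
  qed measurable
  moreover have "(LINT x|lborel. cis (x \<bullet> \<xi>) * ((\<psi> (t, x + h n *\<^sub>R b) - \<psi> (t, x)) / complex_of_real (h n)))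
      = ((cis (- (h n * (b \<bullet> \<xi>))) - 1) /\<^sub>R h n) * I" for n
  proof -
    have "(LINT x|lborel. cis (x \<bullet> \<xi>) * ((\<psi> (t, x + h n *\<^sub>R b) - \<psi> (t, x)) / complex_of_real (h n)))
        = (LINT x|lborel. (cis (x \<bullet> \<xi>) * \<psi> (t, x + h n *\<^sub>R b) - cis (x \<bullet> \<xi>) * \<psi> (t, x)) / complex_of_real (h n))"
      by (simp add: right_diff_distrib)
    also have "\<dots> = (cis (- (h n * (b \<bullet> \<xi>))) * I - I) / complex_of_real (h n)"
      using Bochner_Integration.integral_diff[OF translI[of "h n"] cI] by (simp add: transl I_def)
    finally show ?thesis by (simp add: scaleR_conv_of_real divide_inverse algebra_simps)
  qed
  moreover have "(\<lambda>n. ((cis (- (h n * (b \<bullet> \<xi>))) - 1) /\<^sub>R h n) * I) \<longlonglongrightarrow> (- \<i> * complex_of_real (b \<bullet> \<xi>)) * I"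
  proof (rule tendsto_mult_right)
    have "((\<lambda>c. cis (- (c * (b \<bullet> \<xi>)))) has_vector_derivative (- \<i> * complex_of_real (b \<bullet> \<xi>))) (at 0)"
    proof (rule has_vector_derivative_quadratic)
      fix c :: real
      have "norm (cis (- (c * (b \<bullet> \<xi>))) - cis 0 - \<i> * complex_of_real (- (c * (b \<bullet> \<xi>)) - 0) * cis 0) \<le> (- (c * (b \<bullet> \<xi>)) - 0)\<^sup>2 / 2"
        by (rule cis_taylor)
      then show "norm (cis (- (c * (b \<bullet> \<xi>))) - cis (- (0 * (b \<bullet> \<xi>))) - (c - 0) *\<^sub>R (- \<i> * complex_of_real (b \<bullet> \<xi>))) \<le> ((b \<bullet> \<xi>)\<^sup>2 / 2) * (c - 0)\<^sup>2"
        by (simp add: scaleR_conv_of_real power_mult_distrib mult_ac)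
    qed
    then have "((\<lambda>c. (cis (- (c * (b \<bullet> \<xi>))) - 1) /\<^sub>R c) \<longlongrightarrow> - \<i> * complex_of_real (b \<bullet> \<xi>)) (at 0)"
      by (simp add: has_vector_derivative_iff_quotient)
    from filterlim_compose[OF this h']
    show "(\<lambda>n. (cis (- (h n * (b \<bullet> \<xi>))) - 1) /\<^sub>R h n) \<longlonglongrightarrow> - \<i> * complex_of_real (b \<bullet> \<xi>)" .
  qed
  ultimately have "(LINT x|lborel. cis (x \<bullet> \<xi>) * ?\<psi>1 (t, x)) = (- \<i> * complex_of_real (b \<bullet> \<xi>)) * I"
    by (auto intro: LIMSEQ_unique)
  then show ?thesis by (simp add: inv_fourier_def I_def inner_commute)
qed

lemma replicate_Basis: "b \<in> Basis \<Longrightarrow> replicate k (0 :: real, b) \<in> lists Basis"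
  by (induction k) (auto dest: Basis_space)

lemma inv_fourier_partials:
  fixes \<psi> :: "real \<times> 'a::euclidean_space \<Rightarrow> complex"
  assumes \<psi>: "\<psi> \<in> test_functions \<Omega>" and b: "b \<in> Basis"
  shows "inv_fourier (\<lambda>x. partials (replicate k (0, b)) \<psi> (t, x)) \<xi> = (- \<i> * complex_of_real (b \<bullet> \<xi>)) ^ k * inv_fourier (\<lambda>x. \<psi> (t, x)) \<xi>"
proof (induction k)
  case (Suc k)
  have "partials (replicate k (0, b)) \<psi> \<in> test_functions \<Omega>"
    by (rule test_functions_partials[OF \<psi> replicate_Basis[OF b]])
  from inv_fourier_partial[OF this b] Suc show ?case by (simp add: partials_Cons)
qed simp

lemma sum_power_le:
  fixes y :: "'b \<Rightarrow> real"
  assumes "finite S" "S \<noteq> {}" and y: "\<And>b. b \<in> S \<Longrightarrow> y b \<ge> 0"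
  shows "(\<Sum>b\<in>S. y b) ^ k \<le> real (card S) ^ k * (\<Sum>b\<in>S. y b ^ k)"
proof -
  obtain c where c: "c \<in> S" "y c = Max (y ` S)" using assms by (metis (mono_tags) Max_in finite_imageI image_iff image_is_empty)
  have le: "y b \<le> y c" if "b \<in> S" for b using that assms by (simp add: c)
  have "(\<Sum>b\<in>S. y b) \<le> real (card S) * y c" using sum_bounded_above[of S y "y c"] le by simp
  then have "(\<Sum>b\<in>S. y b) ^ k \<le> (real (card S) * y c) ^ k" using y by (intro power_mono sum_nonneg) auto
  also have "\<dots> = real (card S) ^ k * y c ^ k" by (simp add: power_mult_distrib)
  also have "\<dots> \<le> real (card S) ^ k * (\<Sum>b\<in>S. y b ^ k)"
    using y c assms by (intro mult_left_mono member_le_sum) auto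
  finally show ?thesis .
qed

lemma symb_square_le:
  fixes \<xi> :: "'a::euclidean_space"
  assumes s: "s > 0"
  shows "(norm (symb s \<xi>))\<^sup>2 \<le> 1 + real DIM('a) ^ nat \<lceil>s\<rceil> * (\<Sum>b\<in>Basis. ((b \<bullet> \<xi>)\<^sup>2) ^ nat \<lceil>s\<rceil>)"
proof -
  define k where "k = nat \<lceil>s\<rceil>"
  have "(norm \<xi> powr s)\<^sup>2 \<le> 1 + ((norm \<xi>)\<^sup>2) ^ k"
  proof (cases "norm \<xi> \<le> 1")
    case True
    then have "norm \<xi> powr s \<le> 1" using s powr_mono2[of s "norm \<xi>" 1] by simp
    then have "(norm \<xi> powr s)\<^sup>2 \<le> 1\<^sup>2" by (intro power_mono) auto
    then show ?thesis by (simp add: add_increasing2)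
  next
    case False
    then have "norm \<xi> powr s \<le> norm \<xi> powr (real k)" using s by (intro powr_mono) (auto simp: k_def)
    also have "\<dots> = norm \<xi> ^ k" using False by (intro powr_realpow) auto
    finally have "(norm \<xi> powr s)\<^sup>2 \<le> (norm \<xi> ^ k)\<^sup>2" by (intro power_mono) auto
    then show ?thesis by (simp add: mult.commute flip: power_mult)
  qed
  also have "(norm \<xi>)\<^sup>2 = (\<Sum>b\<in>Basis. (b \<bullet> \<xi>)\<^sup>2)"
    unfolding power2_norm_eq_inner by (subst euclidean_inner) (simp add: power2_eq_square inner_commute)
  also have "1 + (\<Sum>b\<in>Basis. (b \<bullet> \<xi>)\<^sup>2) ^ k \<le> 1 + real DIM('a) ^ k * (\<Sum>b\<in>Basis. ((b \<bullet> \<xi>)\<^sup>2) ^ k)"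
    by (intro add_left_mono sum_power_le) auto
  finally show ?thesis by (simp add: symb_def k_def)
qed

text \<open>The symbol is dominated by powers of the coordinates, and these act on the Fourier transform of
  a time slice as derivatives of the test function.\<close>

lemma symb_slice:
  fixes \<psi> :: "real \<times> 'a::euclidean_space \<Rightarrow> complex"
  assumes \<psi>: "\<psi> \<in> test_functions \<Omega>" and s: "s > 0"
  shows "(\<lambda>\<xi>. symb s \<xi> * rep_l2 (inv_fourier_l2 (slice \<psi> t)) \<xi>) \<in> L2_space"
    and "\<exists>M. \<forall>t. norm (abs_l2 (\<lambda>\<xi>. symb s \<xi> * rep_l2 (inv_fourier_l2 (slice \<psi> t)) \<xi>)) \<le> M"
proof -
  define k where "k = nat \<lceil>s\<rceil>"
  define d where "d = real DIM('a) ^ k"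
  define \<psi>b where "\<psi>b b = partials (replicate k (0, b)) \<psi>" for b :: 'a
  have \<psi>b: "\<psi>b b \<in> test_functions \<Omega>" if "b \<in> Basis" for b
    unfolding \<psi>b_def by (rule test_functions_partials[OF \<psi> replicate_Basis[OF that]])
  define H where "H t \<xi> = (norm (rep_l2 (inv_fourier_l2 (slice \<psi> t)) \<xi>))\<^sup>2
      + d * (\<Sum>b\<in>Basis. (norm (rep_l2 (inv_fourier_l2 (slice (\<psi>b b) t)) \<xi>))\<^sup>2)" for t \<xi>
  have H: "integrable lborel (H t)" for t
    unfolding H_def by (intro Bochner_Integration.integrable_add integrable_mult_right Bochner_Integration.integrable_sum L2_space_integrable rep_l2_mem)
  have HI: "(LINT \<xi>|lborel. H t \<xi>) = (norm (slice \<psi> t))\<^sup>2 + d * (\<Sum>b\<in>Basis. (norm (slice (\<psi>b b) t))\<^sup>2)" for t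
    unfolding H_def by (simp add: L2_space_integrable flip: norm_l2_square)
  have pt: "AE \<xi> in lborel. (norm (symb s \<xi> * rep_l2 (inv_fourier_l2 (slice \<psi> t)) \<xi>))\<^sup>2 \<le> H t \<xi>" for t
  proof -
    have "AE \<xi> in lborel. \<forall>b\<in>Basis. inv_fourier (\<lambda>x. \<psi>b b (t, x)) \<xi> = rep_l2 (inv_fourier_l2 (slice (\<psi>b b) t)) \<xi> / fconst TYPE('a)"
      by (intro AE_finite_allI)
        (auto simp: slice_def intro!: inv_fourier_eq_inv_fourier_l2 slice_L2[OF \<psi>b] slice_integrable[OF \<psi>b])
    moreover have "AE \<xi> in lborel. inv_fourier (\<lambda>x. \<psi> (t, x)) \<xi> = rep_l2 (inv_fourier_l2 (slice \<psi> t)) \<xi> / fconst TYPE('a)"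
      unfolding slice_def by (intro inv_fourier_eq_inv_fourier_l2 slice_L2[OF \<psi>] slice_integrable[OF \<psi>])
    ultimately show ?thesis
    proof eventually_elim
      case (elim \<xi>)
      define r where "r = rep_l2 (inv_fourier_l2 (slice \<psi> t)) \<xi>"
      have "rep_l2 (inv_fourier_l2 (slice (\<psi>b b) t)) \<xi> = (- \<i> * complex_of_real (b \<bullet> \<xi>)) ^ k * r" if "b \<in> Basis" for b
        using elim that inv_fourier_partials[OF \<psi> that, of k t \<xi>] by (simp add: \<psi>b_def r_def)
      then have nb: "(norm (rep_l2 (inv_fourier_l2 (slice (\<psi>b b) t)) \<xi>))\<^sup>2 = ((b \<bullet> \<xi>)\<^sup>2) ^ k * (norm r)\<^sup>2" if "b \<in> Basis" for b
        using that by (simp add: norm_mult norm_power power_mult_distrib mult.commute power_even_abs flip: power_mult)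
      have "(norm (symb s \<xi> * r))\<^sup>2 \<le> (1 + d * (\<Sum>b\<in>Basis. ((b \<bullet> \<xi>)\<^sup>2) ^ k)) * (norm r)\<^sup>2"
        using symb_square_le[OF s, of \<xi>] unfolding norm_mult power_mult_distrib d_def k_def by (rule mult_right_mono) simp
      also have "\<dots> = H t \<xi>"
        unfolding H_def r_def[symmetric] using nb by (simp add: ring_distribs sum_distrib_right mult.assoc)
      finally show ?case by (simp add: r_def)
    qed
  qed
  show L2: "(\<lambda>\<xi>. symb s \<xi> * rep_l2 (inv_fourier_l2 (slice \<psi> t)) \<xi>) \<in> L2_space" for t
    by (rule L2_space_dominated[OF _ H pt]) measurable
  obtain M where M: "\<And>t. norm (slice \<psi> t) \<le> M" using slice_bounded[OF \<psi>] by blast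
  obtain Mb where Mb: "\<And>b t. b \<in> Basis \<Longrightarrow> norm (slice (\<psi>b b) t) \<le> Mb b"
    using slice_bounded[OF \<psi>b] by metis
  have "norm (abs_l2 (\<lambda>\<xi>. symb s \<xi> * rep_l2 (inv_fourier_l2 (slice \<psi> t)) \<xi>)) \<le> sqrt (M\<^sup>2 + d * (\<Sum>b\<in>Basis. (Mb b)\<^sup>2))" for t
  proof -
    have "(LINT \<xi>|lborel. (norm (symb s \<xi> * rep_l2 (inv_fourier_l2 (slice \<psi> t)) \<xi>))\<^sup>2) \<le> (LINT \<xi>|lborel. H t \<xi>)"
      by (intro integral_mono_AE L2_space_integrable L2 H pt)
    also have "\<dots> \<le> M\<^sup>2 + d * (\<Sum>b\<in>Basis. (Mb b)\<^sup>2)"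
      unfolding HI using M Mb by (intro add_mono mult_left_mono sum_mono power_mono) (auto simp: d_def)
    finally show ?thesis
      unfolding norm_abs_l2[OF L2] L2_norm_def by (rule real_sqrt_le_mono)
  qed
  then show "\<exists>M. \<forall>t. norm (abs_l2 (\<lambda>\<xi>. symb s \<xi> * rep_l2 (inv_fourier_l2 (slice \<psi> t)) \<xi>)) \<le> M" by blast
qed

section \<open>The equation in the sense of distributions\<close>

lemma
  fixes f :: "real \<Rightarrow> complex"
  assumes f: "continuous_on {0..T} f"
  shows set_integrable_open: "set_integrable lborel {0<..<T} f"
    and LINT_open: "(LINT t:{0<..<T}|lborel. f t) = (LINT t:{0..T}|lborel. f t)"
proof -
  have i: "set_integrable lborel {0..T} f" by (rule borel_integrable_atLeastAtMost'[OF f])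
  show i': "set_integrable lborel {0<..<T} f" by (rule set_integrable_subset[OF i]) auto
  show "(LINT t:{0<..<T}|lborel. f t) = (LINT t:{0..T}|lborel. f t)"
    unfolding set_lebesgue_integral_def
  proof (rule integral_cong_AE)
    have "AE t in lborel. t \<noteq> 0" "AE t in lborel. t \<noteq> T" by (rule AE_lborel_singleton)+
    then show "AE t in lborel. indicat_real {0<..<T} t *\<^sub>R f t = indicat_real {0..T} t *\<^sub>R f t"
      by eventually_elim (auto simp: indicator_def)
  qed (use i i' in \<open>auto simp: set_integrable_def\<close>)
qed

lemma LINT_derivative:
  fixes f F :: "real \<Rightarrow> complex"
  assumes T: "T \<ge> 0" and f: "continuous_on {0..T} f"
    and F: "\<And>t. t \<in> {0..T} \<Longrightarrow> (F has_vector_derivative f t) (at t within {0..T})" and F0: "F T = F 0"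
  shows "(LINT t:{0<..<T}|lborel. f t) = 0"
  unfolding LINT_open[OF f] unfolding set_lebesgue_integral_def
  using integral_FTC_atLeastAtMost[OF T _ f, of F] F F0 by simp

context damped_wave
begin

interpretation bil: bounded_bilinear "bil :: 'a l2 \<Rightarrow> 'a l2 \<Rightarrow> complex"
  by (rule bounded_bilinear_bil)

interpretation inv: bounded_linear "inv_fourier_l2 :: 'a l2 \<Rightarrow> 'a l2"
  by (rule bounded_linear_inv_fourier_l2)

abbreviation strip :: "(real \<times> 'a) set" where "strip \<equiv> {0<..<T} \<times> UNIV"

lemma slice_cont: "\<psi> \<in> test_functions strip \<Longrightarrow> continuous_on S (slice \<psi>)"
  using slice_deriv[of \<psi> strip] by (meson continuous_on_eq_continuous_within has_vector_derivative_continuous)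

text \<open>Integration by parts in time; there are no boundary terms because test functions vanish near the ends
  of the interval.\<close>

lemma LINT_parts:
  assumes \<psi>: "\<psi> \<in> test_functions strip"
    and F: "\<And>t. t \<in> {0..T} \<Longrightarrow> (F has_vector_derivative F' t) (at t within {0..T})" and F': "continuous_on {0..T} F'"
  shows "(LINT t:{0<..<T}|lborel. bil (F t) (slice (partial (1, 0) \<psi>) t)) = - (LINT t:{0<..<T}|lborel. bil (F' t) (slice \<psi> t))"
proof -
  have \<psi>1: "partial (1, 0) \<psi> \<in> test_functions strip" by (rule test_functions_partial[OF \<psi> Basis_time])
  have Fc: "continuous_on {0..T} F"
    using F by (meson continuous_on_eq_continuous_within has_vector_derivative_continuous)
  have c: "continuous_on {0..T} (\<lambda>t. bil (F t) (slice (partial (1, 0) \<psi>) t))" "continuous_on {0..T} (\<lambda>t. bil (F' t) (slice \<psi> t))"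
    by (intro bil.continuous_on Fc F' slice_cont \<psi> \<psi>1)+
  have "(LINT t:{0<..<T}|lborel. bil (F t) (slice (partial (1, 0) \<psi>) t) + bil (F' t) (slice \<psi> t)) = 0"
  proof (rule LINT_derivative)
    show "((\<lambda>t. bil (F t) (slice \<psi> t)) has_vector_derivative bil (F t) (slice (partial (1, 0) \<psi>) t) + bil (F' t) (slice \<psi> t)) (at t within {0..T})"
      if "t \<in> {0..T}" for t
      by (rule bil.has_vector_derivative[OF F[OF that] slice_deriv[OF \<psi>]])
  qed (use T c slice_outside[OF \<psi>] in \<open>auto intro!: continuous_intros simp: bil.zero_right\<close>)
  then show ?thesis
    by (subst (asm) set_integral_add(2)[OF set_integrable_open[OF c(1)] set_integrable_open[OF c(2)]])
      (simp add: add_eq_0_iff2)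
qed

text \<open>Below a cut-off \<open>v\<close> is differentiable, and integrating the derivative of its pairing with \<open>\<Psi>\<close> gives
  the identity with the cut-off inserted; \<open>\<Psi>\<close> is the transformed time slice. In the term with \<open>q\<close> the symbol is moved from \<open>q\<close> to the
  test function, where it is harmless; then dominated convergence removes the cut-off.\<close>

lemma weak_form:
  assumes \<phi>: "\<phi> \<in> test_functions strip"
  defines "w \<equiv> \<lambda>t. abs_l2 (\<lambda>\<xi>. symb s \<xi> * rep_l2 (inv_fourier_l2 (slice \<phi> t)) \<xi>)"
  shows "(LINT t:{0<..<T}|lborel. bil (inv_fourier_l2 (v t)) (slice (partial (1, 0) \<phi>) t))
    = (LINT t:{0<..<T}|lborel. bil (q t) (w t)) + (LINT t:{0<..<T}|lborel. bil (inv_fourier_l2 (g t)) (slice \<phi> t))"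
proof -
  define \<Psi> where "\<Psi> t = inv_fourier_l2 (slice \<phi> t)" for t
  define D where "D t = inv_fourier_l2 (slice (partial (1, 0) \<phi>) t)" for t
  have \<phi>1: "partial (1, 0) \<phi> \<in> test_functions strip" by (rule test_functions_partial[OF \<phi> Basis_time])
  have \<Psi>D: "continuous_on {0..T} \<Psi>" "continuous_on {0..T} D"
    unfolding \<Psi>_def[abs_def] D_def[abs_def] by (intro inv.continuous_on slice_cont \<phi> \<phi>1)+
  have \<Psi>': "(\<Psi> has_vector_derivative D t) (at t within {0..T})" for t
    unfolding \<Psi>_def[abs_def] D_def by (rule inv.has_vector_derivative[OF slice_deriv[OF \<phi>]])
  have \<Psi>0: "\<Psi> 0 = 0" "\<Psi> T = 0" unfolding \<Psi>_def by (simp_all add: slice_outside[OF \<phi>] inv.zero)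
  define S where "S n t = bil (mul (lowpass s (real n)) (v t)) (D t)
      - bil (mul (lowpass s (real n)) (q t)) (w t) - bil (mul (lowpass s (real n)) (g t)) (\<Psi> t)" for n t
  \<comment> \<open>\<open>S n\<close> is the integrand with frequencies cut off at \<open>n\<close>, and \<open>Slim\<close> its limit\<close>
  define Slim where "Slim t = bil (v t) (D t) - bil (q t) (w t) - bil (g t) (\<Psi> t)" for t
  have S_eq: "S n t = bil (mul (lowpass s (real n)) (v t)) (D t) + bil (- mul (\<lambda>\<xi>. lowpass s (real n) \<xi> * symb s \<xi>) (q t) - mul (lowpass s (real n)) (g t)) (\<Psi> t)" for n t
  proof -
    have e: "ebounded (real n) (\<lambda>\<xi>. lowpass s (real n) \<xi> * symb s \<xi>)" by (rule ebounded_lowpass_symb) simp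
    have "mul (\<lambda>\<xi>. lowpass s (real n) \<xi> * symb s \<xi>) (\<Psi> t) = mul (lowpass s (real n)) (w t)"
    proof (rule l2_eqI)
      show "AE x in lborel. rep_l2 (mul (\<lambda>\<xi>. lowpass s (real n) \<xi> * symb s \<xi>) (\<Psi> t)) x = rep_l2 (mul (lowpass s (real n)) (w t)) x"
        using rep_mul[OF e, of "\<Psi> t"] rep_mul[OF ebounded_lowpass, of s "real n" "w t"] rep_abs_l2[OF symb_slice(1)[OF \<phi> s, of t], folded \<Psi>_def]
        unfolding w_def by eventually_elim (simp add: \<Psi>_def)
    qed
    then have "bil (mul (\<lambda>\<xi>. lowpass s (real n) \<xi> * symb s \<xi>) (q t)) (\<Psi> t) = bil (mul (lowpass s (real n)) (q t)) (w t)"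
      by (simp add: bil_mul[OF e] bil_mul[OF ebounded_lowpass])
    then show ?thesis by (simp add: S_def bil.diff_left bil.minus_left)
  qed
  have S_cont: "continuous_on {0..T} (S n)" for n
  proof -
    have e: "ebounded (real n) (\<lambda>\<xi>. lowpass s (real n) \<xi> * symb s \<xi>)" by (rule ebounded_lowpass_symb) simp
    show ?thesis
      unfolding S_eq[abs_def]
      by (intro continuous_intros bil.continuous_on \<Psi>D v_cont q_cont g_cont
          bounded_linear.continuous_on[OF bounded_linear_mul[OF ebounded_lowpass]]
          bounded_linear.continuous_on[OF bounded_linear_mul[OF e]])
  qed
  have S0: "(LINT t:{0<..<T}|lborel. S n t) = 0" for n
  proof (rule LINT_derivative)
    show "((\<lambda>t. bil (mul (lowpass s (real n)) (v t)) (\<Psi> t)) has_vector_derivative S n t) (at t within {0..T})" if "t \<in> {0..T}" for t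
      unfolding S_eq by (rule bil.has_vector_derivative[OF lowpass_v_deriv[OF _ that] \<Psi>']) simp
  qed (use T S_cont \<Psi>0 in \<open>auto simp: bil.zero_right\<close>)
  obtain Mw where Mw: "\<And>t. norm (w t) \<le> Mw" using symb_slice(2)[OF \<phi> s] unfolding w_def by blast
  have bd: "\<exists>K. \<forall>t\<in>{0..T}. norm (f t) \<le> K" if "continuous_on {0..T} f" for f :: "real \<Rightarrow> 'a l2"
    using compact_imp_bounded[OF compact_continuous_image[OF that compact_Icc]] by (auto simp: bounded_iff)
  obtain Kv Kq Kg K\<Psi> KD where K: "\<And>t. t \<in> {0..T} \<Longrightarrow> norm (v t) \<le> Kv" "\<And>t. t \<in> {0..T} \<Longrightarrow> norm (q t) \<le> Kq"
    "\<And>t. t \<in> {0..T} \<Longrightarrow> norm (g t) \<le> Kg" "\<And>t. t \<in> {0..T} \<Longrightarrow> norm (\<Psi> t) \<le> K\<Psi>" "\<And>t. t \<in> {0..T} \<Longrightarrow> norm (D t) \<le> KD"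
    using bd[OF v_cont] bd[OF q_cont] bd[OF g_cont] bd[OF \<Psi>D(1)] bd[OF \<Psi>D(2)] by metis
  define C where "C = Kv * KD + Kq * Mw + Kg * K\<Psi>"
  have low: "norm (mul (lowpass s R) f) \<le> norm f" for R and f :: "'a l2"
    using norm_mul_le[OF ebounded_lowpass, of s R f] by simp
  have bilb: "norm (bil (mul (lowpass s R) f) h) \<le> F * H" if "norm f \<le> F" "norm h \<le> H" for R F H and f h :: "'a l2"
    by (rule order_trans[OF norm_bil_le mult_mono]) (use low[of R f] that in \<open>auto intro: order_trans[OF norm_ge_zero]\<close>)
  have Sb: "norm (S n t) \<le> C" if "t \<in> {0..T}" for n t
    unfolding S_def C_def
    by (rule order_trans[OF norm_triangle_ineq4 add_mono[OF order_trans[OF norm_triangle_ineq4 add_mono]]])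
      (intro bilb K Mw that)+
  have lim: "(\<lambda>n. S n t) \<longlonglongrightarrow> Slim t" for t
  proof -
    have m: "(\<lambda>n. mul (lowpass s (real n)) f) \<longlonglongrightarrow> f" for f :: "'a l2"
    proof -
      have "(\<lambda>n. mul (lowpass s (real n)) f) \<longlonglongrightarrow> mul (\<lambda>x. 1) f"
      proof (rule mul_tendsto[where C=1])
        show "ebounded 1 (lowpass s (real n) :: 'a \<Rightarrow> complex)" for n by (rule ebounded_lowpass)
        show "ebounded 1 (\<lambda>x :: 'a. 1)" by (simp add: ebounded_def)
        show "AE x :: 'a in lborel. (\<lambda>n. lowpass s (real n) x) \<longlonglongrightarrow> 1"
        proof (rule AE_I2, rule tendsto_eventually)
          fix x :: 'a
          obtain N :: nat where "norm x powr s \<le> real N" using real_arch_simple by blast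
          then show "\<forall>\<^sub>F n in sequentially. lowpass s (real n) x = 1"
            by (intro eventually_sequentiallyI[of N]) (auto simp: lowpass_def)
        qed
      qed
      then show ?thesis by simp
    qed
    show ?thesis unfolding S_def Slim_def by (intro tendsto_diff bil.tendsto m tendsto_const)
  qed
  have meas: "(\<lambda>t. indicat_real {0<..<T} t *\<^sub>R S n t) \<in> borel_measurable lborel" for n
    using set_integrable_open[OF S_cont] by (auto simp: set_integrable_def)
  have limI: "(\<lambda>n. indicat_real {0<..<T} t *\<^sub>R S n t) \<longlonglongrightarrow> indicat_real {0<..<T} t *\<^sub>R Slim t" for t
    by (intro tendsto_intros lim)
  have measI: "(\<lambda>t. indicat_real {0<..<T} t *\<^sub>R Slim t) \<in> borel_measurable lborel"
    by (rule borel_measurable_LIMSEQ_metric[OF meas limI])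
  have dom: "integrable lborel (\<lambda>t. C * indicat_real {0<..<T} t)"
    by (intro integrable_mult_right integrable_real_indicator) (use T in auto)
  have domb: "AE t in lborel. norm (indicat_real {0<..<T} t *\<^sub>R S n t) \<le> C * indicat_real {0<..<T} t" for n
    using Sb by (intro AE_I2) (auto simp: indicator_def)
  have "set_integrable lborel {0<..<T} Slim"
    unfolding set_integrable_def
    by (rule integrable_dominated_convergence[OF measI meas dom AE_I2[OF limI] domb])
  moreover have "(LINT t:{0<..<T}|lborel. Slim t) = 0"
  proof -
    have "(\<lambda>n. LINT t:{0<..<T}|lborel. S n t) \<longlonglongrightarrow> (LINT t:{0<..<T}|lborel. Slim t)"
      unfolding set_lebesgue_integral_def
      by (rule integral_dominated_convergence[OF measI meas dom AE_I2[OF limI] domb])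
    then show ?thesis by (simp add: S0 LIMSEQ_const_iff)
  qed
  moreover have i1: "set_integrable lborel {0<..<T} (\<lambda>t. bil (v t) (D t))" and i2: "set_integrable lborel {0<..<T} (\<lambda>t. bil (g t) (\<Psi> t))"
    by (intro set_integrable_open bil.continuous_on v_cont g_cont \<Psi>D)+
  ultimately have "(LINT t:{0<..<T}|lborel. bil (v t) (D t) - bil (g t) (\<Psi> t) - Slim t)
      = (LINT t:{0<..<T}|lborel. bil (v t) (D t)) - (LINT t:{0<..<T}|lborel. bil (g t) (\<Psi> t))"
    by (simp add: set_integral_diff)
  moreover have "bil (v t) (D t) - bil (g t) (\<Psi> t) - Slim t = bil (q t) (w t)" for t
    by (simp add: Slim_def)
  ultimately show ?thesis
    by (simp add: D_def \<Psi>_def bil_inv_fourier_l2)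
qed

definition sol :: "real \<Rightarrow> 'a \<Rightarrow> complex" where
  "sol t = rep_l2 (inv_fourier_l2 (p t))"

lemma sol_L2 [simp]: "sol t \<in> L2_space"
  by (simp add: sol_def)

lemma abs_sol: "abs_l2 (sol t) = inv_fourier_l2 (p t)"
  by (simp add: sol_def)

lemma regular_slice: "\<psi> \<in> test_functions \<Omega> \<Longrightarrow> regular (rep_l2 f) (\<lambda>x. \<psi> (t, x)) = bil f (slice \<psi> t)"
  using bil_abs[OF rep_l2_mem slice_L2, of \<psi> \<Omega> f t] by (simp add: slice_def regular_def)

lemma regular_mul_slice:
  assumes \<psi>: "\<psi> \<in> test_functions \<Omega>" and m: "ebounded C m"
  shows "regular (rep_l2 f) (\<lambda>x. m x * \<psi> (t, x)) = bil (mul m f) (slice \<psi> t)"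
proof -
  have [measurable]: "m \<in> borel_measurable borel" using m by (simp add: ebounded_def)
  have [measurable]: "(\<lambda>x. \<psi> (t, x)) \<in> borel_measurable borel" by (rule slice_measurable[OF \<psi>])
  show ?thesis
    unfolding regular_slice[OF \<psi>, of "mul m f" t, symmetric] unfolding regular_def
    by (intro integral_cong_AE) (measurable, use rep_mul[OF m, of f] in eventually_elim, simp)
qed

text \<open>The factor \<open>|\<xi>|\<^sup>2\<^sup>s\<close> is split evenly between the solution and the test function.\<close>

lemma frac_laplacian_slice:
  assumes \<psi>: "\<psi> \<in> test_functions \<Omega>" and t: "t \<in> {0..T}"
  shows "frac_laplacian s (sol t) (\<lambda>x. \<psi> (t, x)) = bil (q t) (abs_l2 (\<lambda>\<xi>. symb s \<xi> * rep_l2 (inv_fourier_l2 (slice \<psi> t)) \<xi>))"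
proof -
  have [measurable]: "(\<lambda>x. \<psi> (t, x)) \<in> borel_measurable borel" by (rule slice_measurable[OF \<psi>])
  note [measurable] = inv_fourier_measurable[OF slice_measurable[OF \<psi>, of t]]
  have [measurable]: "fourier_L2 (sol t) \<in> borel_measurable borel"
    using L2_space_measurable[OF fourier_L2_mem[OF sol_L2]] by auto
  have "frac_laplacian s (sol t) (\<lambda>x. \<psi> (t, x)) = (LINT \<xi>|lborel. rep_l2 (q t) \<xi> * (symb s \<xi> * rep_l2 (inv_fourier_l2 (slice \<psi> t)) \<xi>))"
    unfolding frac_laplacian_def inv_fourier_distr_def regular_def symb_def[symmetric]
  proof (intro integral_cong_AE)
    show "AE \<xi> in lborel. symb (2 * s) \<xi> * fourier_L2 (sol t) \<xi> * inv_fourier (\<lambda>x. \<psi> (t, x)) \<xi>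
        = rep_l2 (q t) \<xi> * (symb s \<xi> * rep_l2 (inv_fourier_l2 (slice \<psi> t)) \<xi>)"
      using fourier_L2_eq[OF sol_L2, of t] q_weighted[OF t, unfolded weighted_def]
        inv_fourier_eq_inv_fourier_l2[OF slice_L2[OF \<psi>, of t] slice_integrable[OF \<psi>, of t]]
    proof eventually_elim
      case (elim \<xi>)
      have "symb (2 * s) \<xi> = symb s \<xi> * symb s \<xi>"
        by (simp only: symb_def mult_2 powr_add of_real_mult)
      then show ?case using elim by (simp add: abs_sol slice_def)
    qed
  qed measurable
  also have "\<dots> = bil (q t) (abs_l2 (\<lambda>\<xi>. symb s \<xi> * rep_l2 (inv_fourier_l2 (slice \<psi> t)) \<xi>))"
    using bil_abs[OF rep_l2_mem symb_slice(1)[OF \<psi> s, of t], of "q t"] by simp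
  finally show ?thesis .
qed

lemma sol_solves:
  assumes b_smooth: "smooth b" shows "solves_equation s T a b sol"
  unfolding solves_equation_def Let_def
proof
  fix \<phi> assume \<phi>: "\<phi> \<in> test_functions strip"
  let ?\<phi>1 = "partial (1, 0) \<phi>" let ?\<phi>2 = "partial (1, 0) ?\<phi>1"
  let ?u = "\<lambda>t. inv_fourier_l2 (p t)" let ?ut = "\<lambda>t. inv_fourier_l2 (v t)"
  have \<phi>1: "?\<phi>1 \<in> test_functions strip" by (rule test_functions_partial[OF \<phi> Basis_time])
  have \<phi>2: "?\<phi>2 \<in> test_functions strip" by (rule test_functions_partial[OF \<phi>1 Basis_time])
  have u': "(?u has_vector_derivative ?ut t) (at t within {0..T})" if "t \<in> {0..T}" for t
    by (rule inv.has_vector_derivative[OF p_deriv[OF that]])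
  have bu': "((\<lambda>t. mul b (?u t)) has_vector_derivative mul b (?ut t)) (at t within {0..T})" if "t \<in> {0..T}" for t
    by (rule bounded_linear.has_vector_derivative[OF bounded_linear_mul[OF b(1)] u'[OF that]])
  have c: "continuous_on {0..T} ?u" "continuous_on {0..T} ?ut" by (intro inv.continuous_on p_cont v_cont)+
  have cm: "continuous_on {0..T} (\<lambda>t. mul a (?u t))" "continuous_on {0..T} (\<lambda>t. mul b (?ut t))"
    by (intro bounded_linear.continuous_on[OF bounded_linear_mul[OF a(1)]] bounded_linear.continuous_on[OF bounded_linear_mul[OF b(1)]] c)+
  have 1: "dt (dt (regular_spacetime T sol)) \<phi> = - (LINT t:{0<..<T}|lborel. bil (?ut t) (slice ?\<phi>1 t))"
    unfolding dt_def regular_spacetime_def sol_def regular_slice[OF \<phi>2]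
    using LINT_parts[OF \<phi>1 u' c(2)] by simp
  have 2: "frac_laplacian_spacetime s T sol \<phi>
      = (LINT t:{0<..<T}|lborel. bil (q t) (abs_l2 (\<lambda>\<xi>. symb s \<xi> * rep_l2 (inv_fourier_l2 (slice \<phi> t)) \<xi>)))"
    unfolding frac_laplacian_spacetime_def
    by (rule set_lebesgue_integral_cong) (auto simp: frac_laplacian_slice[OF \<phi>])
  have 3: "mult_coeff a (regular_spacetime T sol) \<phi> = (LINT t:{0<..<T}|lborel. bil (mul a (?u t)) (slice \<phi> t))"
    unfolding mult_coeff_def regular_spacetime_def sol_def prod.case regular_mul_slice[OF \<phi> a(1)] ..
  have 4: "mult_coeff b (dt (regular_spacetime T sol)) \<phi> = (LINT t:{0<..<T}|lborel. bil (mul b (?ut t)) (slice \<phi> t))"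
  proof -
    \<comment> \<open>\<open>partial\<close> is a directional derivative of a total derivative, so the product rule uses that \<open>b\<close> is differentiable\<close>
    have "partial (1, 0) (\<lambda>(t, x). b x * \<phi> (t, x)) z = (\<lambda>(t, x). b x * ?\<phi>1 (t, x)) z" for z
    proof -
      have B: "((\<lambda>z. b (snd z)) has_derivative (\<lambda>h. frechet_derivative b (at (snd z)) (snd h))) (at z)"
        using has_derivative_compose[OF has_derivative_snd[OF has_derivative_ident] smooth_has_derivative[OF b_smooth]] .
      have P: "(\<phi> has_derivative frechet_derivative \<phi> (at z)) (at z)"
        using \<phi> by (intro smooth_has_derivative) (simp add: test_functions_def)
      have "partial (1, 0) (\<lambda>z. b (snd z) * \<phi> z) z
          = b (snd z) * frechet_derivative \<phi> (at z) (1, 0) + frechet_derivative b (at (snd z)) (snd (1::real, 0::'a)) * \<phi> z"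
        by (rule partial_eq[OF has_derivative_mult[OF B P]])
      also have "frechet_derivative b (at (snd z)) (snd (1::real, 0::'a)) = 0"
        using linear_0[OF has_derivative_linear[OF smooth_has_derivative[OF b_smooth]]] by simp
      finally show ?thesis by (simp add: partial_def split_beta')
    qed
    then have "partial (1, 0) (\<lambda>(t, x). b x * \<phi> (t, x)) = (\<lambda>(t, x). b x * ?\<phi>1 (t, x))" by (rule ext)
    then have "mult_coeff b (dt (regular_spacetime T sol)) \<phi> = - (LINT t:{0<..<T}|lborel. bil (mul b (?u t)) (slice ?\<phi>1 t))"
      unfolding mult_coeff_def dt_def regular_spacetime_def sol_def
      by (simp add: regular_mul_slice[OF \<phi>1 b(1)])
    also have "\<dots> = (LINT t:{0<..<T}|lborel. bil (mul b (?ut t)) (slice \<phi> t))"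
      using LINT_parts[OF \<phi> bu' cm(2)] by simp
    finally show ?thesis .
  qed
  have "inv_fourier_l2 (g t) = mul a (?u t) + mul b (?ut t)" for t by (simp add: g_def force_def)
  then have "(LINT t:{0<..<T}|lborel. bil (inv_fourier_l2 (g t)) (slice \<phi> t))
      = (LINT t:{0<..<T}|lborel. bil (mul a (?u t)) (slice \<phi> t)) + (LINT t:{0<..<T}|lborel. bil (mul b (?ut t)) (slice \<phi> t))"
    by (simp add: bil.add_left)
      (intro set_integral_add set_integrable_open bil.continuous_on cm slice_cont \<phi>)
  with weak_form[OF \<phi>] show "dt (dt (regular_spacetime T sol)) \<phi> + frac_laplacian_spacetime s T sol \<phi>
      + mult_coeff a (regular_spacetime T sol) \<phi> + mult_coeff b (dt (regular_spacetime T sol)) \<phi> = 0"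
    unfolding 1 2 3 4 by simp
qed

end

section \<open>The solution belongs to the energy space\<close>

lemma weighted_diff:
  "weighted s f h \<Longrightarrow> weighted s f' h' \<Longrightarrow> weighted s (f - f') (h - h')"
  unfolding weighted_def
proof -
  assume "AE \<xi> in lborel. rep_l2 h \<xi> = symb s \<xi> * rep_l2 f \<xi>" "AE \<xi> in lborel. rep_l2 h' \<xi> = symb s \<xi> * rep_l2 f' \<xi>"
  then show "AE \<xi> in lborel. rep_l2 (h - h') \<xi> = symb s \<xi> * rep_l2 (f - f') \<xi>"
    using rep_l2_diff[of f f'] rep_l2_diff[of h h'] by eventually_elim (simp add: right_diff_distrib)
qed

context damped_wave
begin

interpretation inv: bounded_linear "inv_fourier_l2 :: 'a l2 \<Rightarrow> 'a l2"
  by (rule bounded_linear_inv_fourier_l2)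

interpretation four: bounded_linear "fourier_l2 :: 'a l2 \<Rightarrow> 'a l2"
  by (rule bounded_linear_fourier_l2)

lemma sol_H:
  assumes t: "t \<in> {0..T}"
  shows "sol t \<in> H_space s" "frac_seminorm s (sol t) = norm (q t)"
  using weighted_H_space[OF sol_L2, of s t "q t"] q_weighted[OF t] by (simp_all add: abs_sol)

lemma sol_H_diff:
  assumes t: "t \<in> {0..T}" "\<tau> \<in> {0..T}"
  shows "H_norm s (\<lambda>x. sol \<tau> x - sol t x) = norm (p \<tau> - p t) + norm (q \<tau> - q t)"
proof -
  have L2: "(\<lambda>x. sol \<tau> x - sol t x) \<in> L2_space" by (intro L2_space_diff sol_L2)
  have abs: "abs_l2 (\<lambda>x. sol \<tau> x - sol t x) = inv_fourier_l2 (p \<tau> - p t)"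
    by (simp add: abs_l2_diff abs_sol inv.diff)
  have "weighted s (fourier_l2 (abs_l2 (\<lambda>x. sol \<tau> x - sol t x))) (q \<tau> - q t)"
    unfolding abs fourier_inv_fourier_l2 by (intro weighted_diff q_weighted t)
  from weighted_H_space(2)[OF L2 this] norm_abs_l2[OF L2] show ?thesis
    by (simp add: H_norm_def abs)
qed

lemma sol_cont_H: "cont_in_time (H_space s) (H_norm s) T sol"
  unfolding cont_in_time_def
proof (intro conjI ballI)
  fix t assume t: "t \<in> {0..T}"
  show "sol t \<in> H_space s" by (rule sol_H(1)[OF t])
  have "(p \<longlongrightarrow> p t) (at t within {0..T})" "(q \<longlongrightarrow> q t) (at t within {0..T})"
    using p_cont q_cont t by (auto simp: continuous_on_def)
  then have "((\<lambda>\<tau>. norm (p \<tau> - p t) + norm (q \<tau> - q t)) \<longlongrightarrow> norm (p t - p t) + norm (q t - q t)) (at t within {0..T})"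
    by (intro tendsto_intros)
  moreover have ev: "\<forall>\<^sub>F \<tau> in at t within {0..T}. H_norm s (\<lambda>x. sol \<tau> x - sol t x) = norm (p \<tau> - p t) + norm (q \<tau> - q t)"
    by (auto simp: eventually_at_filter sol_H_diff[OF t])
  ultimately show "((\<lambda>\<tau>. H_norm s (\<lambda>x. sol \<tau> x - sol t x)) \<longlongrightarrow> 0) (at t within {0..T})"
    by (simp add: tendsto_cong[OF ev])
qed

text \<open>Time derivatives in L2 are vector derivatives of the curve of classes, and these are unique.\<close>

lemma time_deriv_iff:
  assumes t: "t \<in> {0..T}"
  shows "has_L2_time_deriv T sol t w \<longleftrightarrow> w \<in> L2_space \<and> abs_l2 w = inv_fourier_l2 (v t)"
proof (cases "w \<in> L2_space")
  case True
  let ?u = "\<lambda>t. inv_fourier_l2 (p t)"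
  have d: "(?u has_vector_derivative inv_fourier_l2 (v t)) (at t within {0..T})"
    by (rule inv.has_vector_derivative[OF p_deriv[OF t]])
  have eq: "L2_norm (\<lambda>x. (sol \<tau> x - sol t x) / complex_of_real (\<tau> - t) - w x) = norm ((?u \<tau> - ?u t) /\<^sub>R (\<tau> - t) - abs_l2 w)" for \<tau>
  proof -
    let ?F = "\<lambda>x. complex_of_real (inverse (\<tau> - t)) * (sol \<tau> x - sol t x)"
    have L2: "(\<lambda>x. sol \<tau> x - sol t x) \<in> L2_space" "?F \<in> L2_space"
      by (intro L2_space_cmult L2_space_diff sol_L2)+
    have "(\<lambda>x. (sol \<tau> x - sol t x) / complex_of_real (\<tau> - t) - w x) = (\<lambda>x. ?F x - w x)"
      by (simp add: divide_inverse mult.commute)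
    moreover have "L2_norm (\<lambda>x. ?F x - w x) = norm (abs_l2 ?F - abs_l2 w)"
      using norm_abs_l2[OF L2_space_diff[OF L2(2) True]] abs_l2_diff[OF L2(2) True] by simp
    moreover have "abs_l2 ?F = (?u \<tau> - ?u t) /\<^sub>R (\<tau> - t)"
      unfolding abs_l2_scaleC[OF L2(1)] abs_l2_diff[OF sol_L2 sol_L2] abs_sol scaleR_scaleC ..
    ultimately show ?thesis by simp
  qed
  have "has_L2_time_deriv T sol t w \<longleftrightarrow> (?u has_vector_derivative abs_l2 w) (at t within {0..T})"
    unfolding has_L2_time_deriv_def has_vector_derivative_iff_quotient eq tendsto_norm_zero_iff LIM_zero_iff using True by simp
  also have "\<dots> \<longleftrightarrow> abs_l2 w = inv_fourier_l2 (v t)"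
    using d vector_derivative_unique_within_closed_interval[of 0 T t ?u "abs_l2 w" "inv_fourier_l2 (v t)"] T t by auto
  finally show ?thesis using True by simp
qed (simp add: has_L2_time_deriv_def)

lemma time_deriv_sol:
  assumes t: "t \<in> {0..T}"
  shows "L2_time_deriv T sol t \<in> L2_space" "abs_l2 (L2_time_deriv T sol t) = inv_fourier_l2 (v t)"
    "\<exists>w. has_L2_time_deriv T sol t w"
proof -
  have ex: "has_L2_time_deriv T sol t (rep_l2 (inv_fourier_l2 (v t)))" by (simp add: time_deriv_iff[OF t])
  then show "\<exists>w. has_L2_time_deriv T sol t w" by blast
  have "has_L2_time_deriv T sol t (L2_time_deriv T sol t)"
    unfolding L2_time_deriv_def using ex by (rule someI[where P="has_L2_time_deriv T sol t"])
  then show "L2_time_deriv T sol t \<in> L2_space" "abs_l2 (L2_time_deriv T sol t) = inv_fourier_l2 (v t)"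
    by (simp_all add: time_deriv_iff[OF t])
qed

lemma sol_C1: "sol \<in> C1_L2 T"
proof -
  have "cont_in_time L2_space L2_norm T (L2_time_deriv T sol)"
    unfolding cont_in_time_def
  proof (intro conjI ballI)
    fix t assume t: "t \<in> {0..T}"
    show "L2_time_deriv T sol t \<in> L2_space" by (rule time_deriv_sol(1)[OF t])
    have "(v \<longlongrightarrow> v t) (at t within {0..T})" using v_cont t by (auto simp: continuous_on_def)
    then have "((\<lambda>\<tau>. norm (v \<tau> - v t)) \<longlongrightarrow> norm (v t - v t)) (at t within {0..T})" by (intro tendsto_intros)
    moreover have eq: "L2_norm (\<lambda>x. L2_time_deriv T sol \<tau> x - L2_time_deriv T sol t x) = norm (v \<tau> - v t)" if \<tau>: "\<tau> \<in> {0..T}" for \<tau>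
    proof -
      have "abs_l2 (\<lambda>x. L2_time_deriv T sol \<tau> x - L2_time_deriv T sol t x) = inv_fourier_l2 (v \<tau> - v t)"
        by (simp add: abs_l2_diff time_deriv_sol \<tau> t inv.diff del: atLeastAtMost_iff)
      then show ?thesis
        using norm_abs_l2[OF L2_space_diff[OF time_deriv_sol(1)[OF \<tau>] time_deriv_sol(1)[OF t]]] by simp
    qed
    moreover have ev: "\<forall>\<^sub>F \<tau> in at t within {0..T}. L2_norm (\<lambda>x. L2_time_deriv T sol \<tau> x - L2_time_deriv T sol t x) = norm (v \<tau> - v t)"
      by (auto simp: eventually_at_filter eq)
    ultimately show "((\<lambda>\<tau>. L2_norm (\<lambda>x. L2_time_deriv T sol \<tau> x - L2_time_deriv T sol t x)) \<longlongrightarrow> 0) (at t within {0..T})"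
      by (simp add: tendsto_cong[OF ev])
  qed
  then show ?thesis using time_deriv_sol(3) by (simp add: C1_L2_def)
qed

lemma sol_energy_space: "sol \<in> energy_space s T"
  using sol_cont_H sol_C1 by (simp add: energy_space_def)

lemma norm1_sol:
  assumes t: "t \<in> {0..T}"
  shows "norm1 s T sol t \<le> (3 + T) * ((1 + A) * (norm f0 + norm q0) + norm f1)"
proof -
  have "norm1 s T sol t = norm (p t) + norm (q t) + norm (v t)"
    using norm_abs_l2[OF sol_L2, of t] norm_abs_l2[OF time_deriv_sol(1)[OF t]]
    by (simp add: norm1_def sol_H(2)[OF t] abs_sol time_deriv_sol(2)[OF t])
  moreover have "norm f0 \<le> (1 + A) * (norm f0 + norm q0) + norm f1"
  proof -
    have "1 * norm f0 \<le> (1 + A) * (norm f0 + norm q0)" using AB by (intro mult_mono) auto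
    then show ?thesis by (simp add: add_increasing2)
  qed
  ultimately show ?thesis using energy_bound[OF t] by (simp add: algebra_simps)
qed

lemma sol_initial:
  assumes u0: "u0 \<in> L2_space" "f0 = abs_l2 u0" and u1: "u1 \<in> L2_space" "f1 = abs_l2 u1"
  shows "AE x in lborel. sol 0 x = u0 x" "AE x in lborel. L2_time_deriv T sol 0 x = u1 x"
proof -
  show "AE x in lborel. sol 0 x = u0 x"
    using rep_abs_l2[OF u0(1), folded u0(2)] by (simp add: sol_def initial)
  have 0: "0 \<in> {0..T}" using T by simp
  show "AE x in lborel. L2_time_deriv T sol 0 x = u1 x"
    using trans[OF time_deriv_sol(2)[OF 0, unfolded initial inv_fourier_fourier_l2] u1(2)]
    by (simp only: abs_l2_eq_iff[OF time_deriv_sol(1)[OF 0] u1(1)])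
qed

end

section \<open>Existence of very weak solutions\<close>

lemma Linf_ebounded: "a \<in> Linf_space \<Longrightarrow> ebounded (Linf_norm a) a"
proof -
  assume a: "a \<in> Linf_space"
  define S where "S = esssup lborel (\<lambda>x. ereal (norm (a x)))"
  have [measurable]: "a \<in> borel_measurable borel" and S: "S < \<infinity>" using a by (auto simp: Linf_space_def S_def)
  have "0 = esssup lborel (\<lambda>x :: 'a. 0 :: ereal)" by (rule esssup_const[symmetric]) simp
  also have "\<dots> \<le> S" unfolding S_def by (rule esssup_mono) auto
  finally have "S \<ge> 0" .
  then have Sr: "S = ereal (Linf_norm a)" "Linf_norm a \<ge> 0"
    using S unfolding Linf_norm_def S_def[symmetric] by (cases S; simp)+
  have "AE x in lborel. ereal (norm (a x)) \<le> S" unfolding S_def by (rule esssup_AE)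
  then show ?thesis using Sr by (simp add: ebounded_def)
qed

text \<open>The bound is polynomial in the norms of \<open>a\<close> and of the data, so that moderateness of these passes
  to the solution.\<close>

lemma cauchy_problem_solution:
  fixes a b u0 u1 :: "'a::euclidean_space \<Rightarrow> complex"
  assumes s: "s > 0" and T: "T > 0"
    and a_Linf: "a \<in> Linf_space" "\<And>x. a x \<in> \<real>\<^sub>\<ge>\<^sub>0" and b_Linf: "b \<in> Linf_space" "\<And>x. b x \<in> \<real>\<^sub>\<ge>\<^sub>0" 
    and b_smooth: "smooth b" and u0: "u0 \<in> H_space s" and u1: "u1 \<in> L2_space"
  shows "\<exists>u\<in>energy_space s T. solves_cauchy s T a b u0 u1 u \<and>
    (\<forall>t\<in>{0..T}. norm1 s T u t \<le> (3 + T) * ((1 + Linf_norm a) * H_norm s u0 + L2_norm u1))"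
proof -
  have u0L: "u0 \<in> L2_space" using u0 by (simp add: H_space_def)
  obtain q0 where q0: "weighted s (fourier_l2 (abs_l2 u0)) q0" using H_space_weighted[OF s u0] by blast
  interpret damped_wave s T a b "Linf_norm a" "Linf_norm b" "abs_l2 u0" "abs_l2 u1" q0
    by unfold_locales (use s T a_Linf b_Linf q0 in \<open>auto intro: Linf_ebounded\<close>)
  have H: "H_norm s u0 = norm (abs_l2 u0) + norm q0"
    using weighted_H_space(2)[OF u0L q0] by (simp add: H_norm_def norm_abs_l2[OF u0L])
  have "solves_cauchy s T a b u0 u1 sol"
    using sol_solves[OF b_smooth] sol_initial[OF u0L refl u1 refl] by (simp add: solves_cauchy_def)
  moreover have "norm1 s T sol t \<le> (3 + T) * ((1 + Linf_norm a) * H_norm s u0 + L2_norm u1)" if "t \<in> {0..T}" for t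
    using norm1_sol[OF that] by (simp add: H norm_abs_l2[OF u1])
  ultimately show ?thesis using sol_energy_space by blast
qed

theorem theorem3p2:
  fixes s T :: real
    and a b u0 u1 :: "'a::euclidean_space datum"
    and conva convb conv0 conv1 :: "'a conv_mode"
  assumes "s > 0" and "T > 0"
    and "valid_datum a" and "valid_datum b" and "valid_datum u0" and "valid_datum u1"
    and "\<exists>ae. Linf_moderate_approx conva a ae \<and> nonneg_net ae"
    and "\<exists>be. Linf_moderate_approx convb b be \<and> nonneg_net be"
    and "\<exists>u0e. H_moderate_approx s conv0 u0 u0e"
    and "\<exists>u1e. L2_moderate_approx conv1 u1 u1e"
  shows "\<exists>ue. very_weak_solution conva convb conv0 conv1 s T a b u0 u1 ue"
proof -
  obtain ae be u0e u1e where
    ae: "Linf_moderate_approx conva a ae" "nonneg_net ae" and be: "Linf_moderate_approx convb b be" "nonneg_net be"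
    and u0e: "H_moderate_approx s conv0 u0 u0e" and u1e: "L2_moderate_approx conv1 u1 u1e"
    using assms by blast
  have "\<exists>u\<in>energy_space s T. solves_cauchy s T (ae \<epsilon>) (be \<epsilon>) (u0e \<epsilon>) (u1e \<epsilon>) u \<and>
      (\<forall>t\<in>{0..T}. norm1 s T u t \<le> (3 + T) * ((1 + Linf_norm (ae \<epsilon>)) * H_norm s (u0e \<epsilon>) + L2_norm (u1e \<epsilon>)))"
    if \<epsilon>: "\<epsilon> \<in> {0<..1}" for \<epsilon>
    using \<epsilon> ae be u0e u1e
    by (intro cauchy_problem_solution[OF assms(1,2)])
      (auto simp: Linf_moderate_approx_def H_moderate_approx_def L2_moderate_approx_def approximation_def moderate_def nonneg_net_def)
  then obtain ue where ue: "\<And>\<epsilon>. \<epsilon> \<in> {0<..1} \<Longrightarrow> ue \<epsilon> \<in> energy_space s T"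
      "\<And>\<epsilon>. \<epsilon> \<in> {0<..1} \<Longrightarrow> solves_cauchy s T (ae \<epsilon>) (be \<epsilon>) (u0e \<epsilon>) (u1e \<epsilon>) (ue \<epsilon>)"
      "\<And>\<epsilon> t. \<epsilon> \<in> {0<..1} \<Longrightarrow> t \<in> {0..T} \<Longrightarrow>
        norm1 s T (ue \<epsilon>) t \<le> (3 + T) * ((1 + Linf_norm (ae \<epsilon>)) * H_norm s (u0e \<epsilon>) + L2_norm (u1e \<epsilon>))"
    by metis
  have powi: "\<epsilon> powi (- int N) = (inverse \<epsilon>) ^ N" for \<epsilon> :: real and N
    by (simp add: power_int_minus power_inverse)
  obtain N1 C1 where C1: "C1 > 0" "\<And>\<epsilon>. \<epsilon> \<in> {0<..1} \<Longrightarrow> Linf_norm (ae \<epsilon>) \<le> C1 * inverse \<epsilon> ^ N1"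
    using ae(1) unfolding Linf_moderate_approx_def moderate_def powi by blast
  obtain N2 C2 where C2: "C2 > 0" "\<And>\<epsilon>. \<epsilon> \<in> {0<..1} \<Longrightarrow> H_norm s (u0e \<epsilon>) \<le> C2 * inverse \<epsilon> ^ N2"
    using u0e unfolding H_moderate_approx_def moderate_def powi by blast
  obtain N3 C3 where C3: "C3 > 0" "\<And>\<epsilon>. \<epsilon> \<in> {0<..1} \<Longrightarrow> L2_norm (u1e \<epsilon>) \<le> C3 * inverse \<epsilon> ^ N3"
    using u1e unfolding L2_moderate_approx_def moderate_def powi by blast
  define C where "C = (3 + T) * ((1 + C1) * C2 + C3)"
  have "norm1 s T (ue \<epsilon>) t \<le> C * \<epsilon> powi (- int (N1 + N2 + N3))" if \<epsilon>: "\<epsilon> \<in> {0<..1}" and t: "t \<in> {0..T}" for \<epsilon> t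
  proof -
    \<comment> \<open>as \<open>E \<ge> 1\<close>, all powers may be raised to the common exponent\<close>
    define E where "E = inverse \<epsilon>"
    have E: "E \<ge> 1" using \<epsilon> by (simp add: E_def one_le_inverse)
    have "Linf_norm (ae \<epsilon>) \<ge> 0"
      using ae(1) \<epsilon> Linf_ebounded[of "ae \<epsilon>"] by (auto simp: Linf_moderate_approx_def moderate_def ebounded_def)
    moreover have "1 + Linf_norm (ae \<epsilon>) \<le> (1 + C1) * E ^ N1"
      using C1(2)[OF \<epsilon>] one_le_power[OF E, of N1] by (simp add: E_def ring_distribs)
    moreover have "0 \<le> H_norm s (u0e \<epsilon>)" by (simp add: H_norm_def frac_seminorm_def L2_norm_nonneg)
    ultimately have "(1 + Linf_norm (ae \<epsilon>)) * H_norm s (u0e \<epsilon>) \<le> ((1 + C1) * E ^ N1) * (C2 * E ^ N2)"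
      using C2(2)[OF \<epsilon>] by (intro mult_mono) (auto simp: E_def)
    also have "\<dots> = ((1 + C1) * C2) * E ^ (N1 + N2)" by (simp add: power_add)
    also have "\<dots> \<le> ((1 + C1) * C2) * E ^ (N1 + N2 + N3)"
      using C1 C2 E by (intro mult_left_mono power_increasing) auto
    finally have "(1 + Linf_norm (ae \<epsilon>)) * H_norm s (u0e \<epsilon>) \<le> ((1 + C1) * C2) * E ^ (N1 + N2 + N3)" .
    moreover have "L2_norm (u1e \<epsilon>) \<le> C3 * E ^ (N1 + N2 + N3)"
      using C3 E by (intro order_trans[OF C3(2)[OF \<epsilon>, folded E_def]] mult_left_mono power_increasing) auto
    ultimately have "(1 + Linf_norm (ae \<epsilon>)) * H_norm s (u0e \<epsilon>) + L2_norm (u1e \<epsilon>) \<le> ((1 + C1) * C2 + C3) * E ^ (N1 + N2 + N3)"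
      by (simp add: ring_distribs)
    then have "(3 + T) * ((1 + Linf_norm (ae \<epsilon>)) * H_norm s (u0e \<epsilon>) + L2_norm (u1e \<epsilon>)) \<le> (3 + T) * (((1 + C1) * C2 + C3) * E ^ (N1 + N2 + N3))"
      using assms(2) by (intro mult_left_mono) auto
    with ue(3)[OF \<epsilon> t] show ?thesis unfolding powi C_def E_def[symmetric] by (simp add: mult.assoc)
  qed
  moreover have "C > 0" using C1(1) C2(1) C3(1) assms(2) by (simp add: C_def add_pos_pos)
  ultimately have "C1_moderate s T ue"
    using ue(1) unfolding C1_moderate_def by blast
  then have "very_weak_solution conva convb conv0 conv1 s T a b u0 u1 ue"
    unfolding very_weak_solution_def using ue(1,2) ae be u0e u1e by blast
  then show ?thesis by blast
qed

end
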